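(* Let $\mathcal{R}=\mathbb{C}[\partial]A\oplus\mathbb{C}[\partial]B$ be a rank two Lie conformal algebra of Type II with $Q\neq0$ (with parameter $a\in\{1,0,-1,-4,-6\}$ and constants $c,d$ in $Q$), and let $V_{\alpha,\beta}=\mathbb{C}[\partial]v$, $V_{\bar\alpha,\bar\beta}=\mathbb{C}[\partial]\bar v$ be nontrivial finite irreducible $\mathcal{R}$-modules. Consider extensions of $\mathcal{R}$-modules of the form $$0\longrightarrow V_{\alpha,\beta}\longrightarrow E\longrightarrow V_{\bar\alpha,\bar\beta}\longrightarrow0 .\qquad(\ast)$$ Every such $E$ is isomorphic to $\mathbb{C}[\partial]v\oplus\mathbb{C}[\partial]\bar v$ with $$A_\lambda v=(\partial+\alpha\lambda+\beta)v,\quad B_\lambda v=0,\quad A_\lambda\bar v=(\partial+\bar\alpha\lambda+\bar\beta)\bar v+f(\partial,\lambda)v,\quad B_\lambda\bar v=g(\partial,\lambda)v\qquad(\ast\ast)$$ for some $f,g\in\mathbb{C}[\partial,\lambda]$. Nontrivial extensions of the form $(\ast)$ exist only if $\beta=\bar\beta$. Moreover, they are given (up to equivalence) by $(\ast\ast)$ with $f(\partial,\lambda)=F(\partial+\beta,\lambda)$ and $g(\partial,\lambda)=G(\partial+\beta,\lambda)$, where the values of $\alpha,\bar\alpha$ and the polynomials $F(x,\lambda)$, $G(x,\lambda)$ giving rise to nontrivial extensions are as follows ($s,s_0,s_1,t\in\mathbb{C}$; in expressions with $\pm$ the same sign is taken for $\alpha$ and $\bar\alpha$). (1) $a=1$,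 $\bar\alpha-\alpha\in\{0,1,2,3,4,5,6\}$, $\alpha,\bar\alpha\neq0$, and (i) $\bar\alpha=\alpha$, $F=s_0+s_1\lambda$, $G=0$, $(s_0,s_1)\neq(0,0)$; (ii) $\bar\alpha-\alpha=1$, $F=\frac{ct}{\alpha}x$, $G=t\lambda$, $t\neq0$; (iii) $\bar\alpha-\alpha=2$ with $\alpha\neq-1$, $F=s\lambda^2(2x+\lambda)$, $G=0$, $s\neq0$; (iv) $\bar\alpha=1$, $\alpha=-1$, $F=s\lambda^2(2x+\lambda)-ct(x^2-\lambda^2)$, $G=t(x\lambda+\lambda^2)$, $(s,t)\neq(0,0)$; (v) $\bar\alpha-\alpha=3$, $F=sx\lambda^2(x+\lambda)$, $G=0$, $s\neq0$; (vi) $\bar\alpha-\alpha=4$, $F=s\lambda^2(4x^3+6x^2\lambda-x\lambda^2+\alpha\lambda^3)$, $G=0$, $s\neq0$; (vii) $\bar\alpha=1$, $\alpha=-4$, $F=s(x^4\lambda^2-10x^2\lambda^4-17x\lambda^5-8\lambda^6)$, $G=0$, $s\neq0$; (viii) $\bar\alpha=\frac72\pm\frac{\sqrt{19}}2$, $\alpha=-\frac52\pm\frac{\sqrt{19}}2$, $F=s\big(x^4\lambda^3-(2\alpha+3)x^3\lambda^4-3\alpha x^2\lambda^5-(3\alpha+1)x\lambda^6-(\alpha+\frac9{28})\lambda^7\big)$, $G=0$, $s\neq0$. $\dim\mathrm{Ext}(V_{\bar\alpha,\bar\beta},V_{\alpha,\beta})$ is $2$ in subcases (i) and (iv), and $1$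 in the other subcases. (2) $a=0$, $\bar\alpha-\alpha\in\{0,1,2,3,4,5,6\}$, $\alpha,\bar\alpha\neq0$, and (i) $\bar\alpha=\alpha$, $F=s_0+s_1\lambda$, $G=0$, $(s_0,s_1)\neq(0,0)$; (ii) $\bar\alpha-\alpha=1$, $F=-\frac{ct}{\alpha}x\lambda-\frac{dt}{\alpha}x$, $G=t$, $t\neq0$; (iii) $\bar\alpha-\alpha=2$ with $\alpha\neq-1$, $F=s\lambda^2(2x+\lambda)$, $G=0$, $s\neq0$; (iv) $\bar\alpha=1$, $\alpha=-1$, $F=s\lambda^2(2x+\lambda)+ctx^2\lambda+dt(x^2-\lambda^2)$, $G=t(x+\lambda)$, $(s,t)\neq(0,0)$; (v) $\bar\alpha-\alpha=3$, $F=sx\lambda^2(x+\lambda)$, $G=0$, $s\neq0$; (vi) $\bar\alpha-\alpha=4$, $F=s\lambda^2(4x^3+6x^2\lambda-x\lambda^2+\alpha\lambda^3)$, $G=0$, $s\neq0$; (vii) $\bar\alpha=1$, $\alpha=-4$, $F=s(x^4\lambda^2-10x^2\lambda^4-17x\lambda^5-8\lambda^6)$, $G=0$, $s\neq0$; (viii) $\bar\alpha=\frac72\pm\frac{\sqrt{19}}2$, $\alpha=-\frac52\pm\frac{\sqrt{19}}2$, $F=s\big(x^4\lambda^3-(2\alpha+3)x^3\lambda^4-3\alpha x^2\lambda^5-(3\alpha+1)x\lambda^6-(\alpha+\frac9{28})\lambda^7\big)$, $G=0$, $s\neq0$. $\dim\mathrm{Ext}(V_{\bar\alpha,\bar\beta},V_{\alpha,\beta})$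 is $2$ in subcases (i) and (iv), and $1$ in the other subcases. (3) $a=-1$, $\bar\alpha-\alpha\in\{0,1,2,3,4,5,6\}$, $\alpha,\bar\alpha\neq0$, and (i) $\bar\alpha=\alpha$, $F=s_0+s_1\lambda$, $G=0$, $(s_0,s_1)\neq(0,0)$; (ii) $\bar\alpha-\alpha=2$ with $\alpha\neq-\frac12$, $F=s\lambda^2(2x+\lambda)$, $G=0$, $s\neq0$; (iii) $\bar\alpha=\frac32$, $\alpha=-\frac12$, $F=s\lambda^2(2x+\lambda)-2dtx^2\lambda-ct(2x^2-\lambda^2)$, $G=t$, $(s,t)\neq(0,0)$; (iv) $\bar\alpha-\alpha=3$ with $\alpha\neq-1$, $F=sx\lambda^2(x+\lambda)$, $G=0$, $s\neq0$; (v) $\bar\alpha=2$, $\alpha=-1$, $F=sx\lambda^2(x+\lambda)-\frac{dt}4(2x^3\lambda+\lambda^4)-\frac{ct}2(x^3-2x\lambda^2-2\lambda^3)$, $G=t(x+\frac12\lambda)$, $(s,t)\neq(0,0)$; (vi) $\bar\alpha-\alpha=4$, $F=s\lambda^2(4x^3+6x^2\lambda-x\lambda^2+\alpha\lambda^3)$, $G=0$, $s\neq0$; (vii) $\bar\alpha=1$, $\alpha=-4$, $F=s(x^4\lambda^2-10x^2\lambda^4-17x\lambda^5-8\lambda^6)$, $G=0$, $s\neq0$; (viii) $\bar\alpha=\frac72\pm\frac{\sqrt{19}}2$, $\alpha=-\frac52\pm\frac{\sqrt{19}}2$, $F=s\big(x^4\lambda^3-(2\alpha+3)x^3\lambda^4-3\alpha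 x^2\lambda^5-(3\alpha+1)x\lambda^6-(\alpha+\frac9{28})\lambda^7\big)$, $G=0$, $s\neq0$. $\dim\mathrm{Ext}(V_{\bar\alpha,\bar\beta},V_{\alpha,\beta})$ is $2$ in subcases (i) and (v), and $1$ in the other subcases. (4) $a=-4$, $\bar\alpha-\alpha\in\{0,1,2,3,4,5,6,7\}$, $\alpha,\bar\alpha\neq0$, and (i) $\bar\alpha=\alpha$, $F=s_0+s_1\lambda$, $G=0$, $(s_0,s_1)\neq(0,0)$; (ii) $\bar\alpha-\alpha=2$, $F=s\lambda^2(2x+\lambda)$, $G=0$, $s\neq0$; (iii) $\bar\alpha-\alpha=3$, $F=sx\lambda^2(x+\lambda)$, $G=0$, $s\neq0$; (iv) $\bar\alpha-\alpha=4$, $F=s\lambda^2(4x^3+6x^2\lambda-x\lambda^2+\alpha\lambda^3)$, $G=0$, $s\neq0$; (v) $\bar\alpha-\alpha=5$ with $\alpha\notin\{-2,-4\}$, $F=-\frac{3}{\alpha(\alpha+2)(\alpha+4)}ctx^3\lambda^3+\frac{9(\alpha+1)}{2\alpha(\alpha+2)(\alpha+4)}ctx^2\lambda^4-\frac{9(\alpha+1)(2\alpha+1)}{10\alpha(\alpha+2)(\alpha+4)}ctx\lambda^5+\frac{(\alpha+1)(2\alpha+1)}{10(\alpha+2)(\alpha+4)}ct\lambda^6$, $G=t$, $t\neq0$; (vi) $\bar\alpha=3$, $\alpha=-2$, $F=\frac38ctx^4\lambda^2-\frac32ctx^2\lambda^4-\frac{57}{40}ctx\lambda^5-\frac25ct\lambda^6$,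 $G=t$, $t\neq0$; (vii) $\bar\alpha=1$, $\alpha=-4$, $F=s(x^4\lambda^2-10x^2\lambda^4-17x\lambda^5-8\lambda^6)$, $G=0$, $s\neq0$; (viii) $\bar\alpha-\alpha=6$ with $\alpha\notin\{-\frac52,-\frac52\pm\frac{\sqrt{19}}2\}$, and, with $N=(2\alpha+5)(2\alpha^2+10\alpha+3)$, $F=-\frac3Nctx^4\lambda^3+\frac{3(2\alpha+3)}Nctx^3\lambda^4-\frac{9(\alpha+1)(2\alpha+3)}{5N}ctx^2\lambda^5+\frac{(\alpha+1)(2\alpha+1)(2\alpha+3)}{5N}ctx\lambda^6-\frac{\alpha(\alpha+1)(2\alpha+1)(2\alpha+3)}{70N}ct\lambda^7$, $G=t(x-\frac\alpha5\lambda)$, $t\neq0$; (ix) $\bar\alpha=\frac72$, $\alpha=-\frac52$, $F=\frac{36}{665}ctx^5\lambda^2-\frac{54}{113}ctx^3\lambda^4-\frac{387}{665}ctx^2\lambda^5-\frac{218}{665}ctx\lambda^6+\frac{127}{1862}ct\lambda^7$, $G=t(x+\frac12\lambda)$, $t\neq0$; (x) $\bar\alpha=\frac72\pm\frac{\sqrt{19}}2$, $\alpha=-\frac52\pm\frac{\sqrt{19}}2$, $F=s\big(x^4\lambda^3-(2\alpha+3)x^3\lambda^4-3\alpha x^2\lambda^5-(3\alpha+1)x\lambda^6-(\alpha+\frac9{28})\lambda^7\big)$, $G=0$, $s\neq0$; (xi) $\bar\alpha=1$, $\alpha=-6$, $F=\frac1{35}ctx^5\lambda^3+\frac27ctx^4\lambda^4+\frac{36}{35}ctx^3\lambda^5+\frac{12}7ctx^2\lambda^6+\frac{66}{49}ctx\lambda^7+\frac{99}{245}ct\lambda^8$,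 $G=t(x^2+\frac{11}5x\lambda+\frac65\lambda^2)$, $t\neq0$. $\dim\mathrm{Ext}(V_{\bar\alpha,\bar\beta},V_{\alpha,\beta})$ is $2$ in subcase (i), and $1$ in the other subcases. (5) $a=-6$, $\bar\alpha-\alpha\in\{0,1,2,3,4,5,6,7,8\}$, $\alpha,\bar\alpha\neq0$, and (i) $\bar\alpha=\alpha$, $F=s_0+s_1\lambda$, $G=0$, $(s_0,s_1)\neq(0,0)$; (ii) $\bar\alpha-\alpha=2$, $F=s\lambda^2(2x+\lambda)$, $G=0$, $s\neq0$; (iii) $\bar\alpha-\alpha=3$, $F=sx\lambda^2(x+\lambda)$, $G=0$, $s\neq0$; (iv) $\bar\alpha-\alpha=4$, $F=s\lambda^2(4x^3+6x^2\lambda-x\lambda^2+\alpha\lambda^3)$, $G=0$, $s\neq0$; (v) $\bar\alpha=1$, $\alpha=-4$, $F=s(x^4\lambda^2-10x^2\lambda^4-17x\lambda^5-8\lambda^6)$, $G=0$, $s\neq0$; (vi) $\bar\alpha=\frac72\pm\frac{\sqrt{19}}2$, $\alpha=-\frac52\pm\frac{\sqrt{19}}2$, $F=s\big(x^4\lambda^3-(2\alpha+3)x^3\lambda^4-3\alpha x^2\lambda^5-(3\alpha+1)x\lambda^6-(\alpha+\frac9{28})\lambda^7\big)$, $G=0$, $s\neq0$; (vii) $\bar\alpha=4\pm\frac{\sqrt{22}}2$, $\alpha=-3\pm\frac{\sqrt{22}}2$, $F=-\frac{40}{7(\alpha+3)}ctx^5\lambda^3+\frac{100(\alpha+2)}{7(\alpha+3)}ctx^4\lambda^4+\frac{40(5\alpha+1)}{7(\alpha+3)}ctx^3\lambda^5+\frac{20(16\alpha+11)}{7(\alpha+3)}ctx^2\lambda^6+\frac{10(154\alpha+101)}{49(\alpha+3)}ctx\lambda^7+\frac{823\alpha+539}{98(\alpha+3)}ct\lambda^8$,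 $G=t$, $t\neq0$; (viii) $\bar\alpha=7$, $\alpha=-1$, $F=-\frac27ctx^6\lambda^3+\frac97ctx^5\lambda^4-\frac97ctx^4\lambda^5+\frac27ctx^3\lambda^6$, $G=t(x+\frac17\lambda)$, $t\neq0$; (ix) $\bar\alpha=2$, $\alpha=-6$, $F=-\frac27ctx^6\lambda^3-3ctx^5\lambda^4-12ctx^4\lambda^5-24ctx^3\lambda^6-\frac{180}7ctx^2\lambda^7-\frac{99}7ctx\lambda^8-\frac{22}7ct\lambda^9$, $G=t(x+\frac67\lambda)$, $t\neq0$. $\dim\mathrm{Ext}(V_{\bar\alpha,\bar\beta},V_{\alpha,\beta})$ is $2$ in subcase (i), and $1$ in the other subcases.
   Context: Everything is over $\mathbb{C}$. A Lie conformal algebra $\mathcal{R}$ is a $\mathbb{C}[\partial]$-module with a $\mathbb{C}$-linear $\lambda$-bracket $\mathcal{R}\otimes\mathcal{R}\to\mathcal{R}[\lambda]$, $a\otimes b\mapsto[a_\lambda b]$, satisfying $[\partial a_\lambda b]=-\lambda[a_\lambda b]$, $[a_\lambda\partial b]=(\partial+\lambda)[a_\lambda b]$, $[a_\lambda b]=-[b_{-\lambda-\partial}a]$ and $[a_\lambda[b_\mu c]]=[[a_\lambda b]_{\lambda+\mu}c]+[b_\mu[a_\lambda c]]$. A conformal $\mathcal{R}$-module $V$ is a $\mathbb{C}[\partial]$-module with a $\mathbb{C}$-linear map $\mathcal{R}\otimes V\to V[\lambda]$, $a\otimes v\mapsto a_\lambda v$, satisfying $(\partial a)_\lambda v=-\lambda(a_\lambda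 v)$, $a_\lambda(\partial v)=(\partial+\lambda)a_\lambda v$, $a_\lambda(b_\mu v)=[a_\lambda b]_{\lambda+\mu}v+b_\mu(a_\lambda v)$. An extension of $W$ by $V$ is an exact sequence of modules $0\to V\to E\to W\to0$. Two extensions $E,E'$ are equivalent if there is a module homomorphism $E\to E'$ compatible with the identity maps of $V$ and $W$. An extension is trivial if it is equivalent to $V\oplus W$. $\mathrm{Ext}(W,V)$ is the vector space of extension cocycles modulo those equivalent to the trivial extension, and $\dim\mathrm{Ext}(W,V)$ is its dimension. A Type II rank two Lie conformal algebra with $Q\neq0$ has free basis $\{A,B\}$ over $\mathbb{C}[\partial]$ with $[A_\lambda A]=(\partial+2\lambda)A+Q(\partial,\lambda)B$, $[A_\lambda B]=(\partial+a\lambda)B$, $[B_\lambda B]=0$, where $a\in\{1,0,-1,-4,-6\}$ and, for some $c,d\in\mathbb{C}$, the nonzero polynomial $Q$ is: for $a=1$, $Q=c(\partial+2\lambda)$; for $a=0$, $Q=c(\partial+2\lambda)(\partial+\lambda)\lambda+d(\partial+2\lambda)\partial$; for $a=-1$, $Q=c(\partial+2\lambda)\partial^2+d(\partial+2\lambda)(\partial+\lambda)\partial\lambda$; for $a=-4$, $Q=c(\partial+2\lambda)(\partial+\lambda)^3\lambda^3$; for $a=-6$, $Q=c(\partial+2\lambda)[11(\partial+\lambda)^4\lambda^4+2(\partial+\lambda)^3\partial^2\lambda^3]$. Its nontrivial finite irreducible modules are $V_{\alpha,\beta}=\mathbb{C}[\partial]v$ (free of rank one) with $A_\lambda v=(\partial+\alpha\lambda+\beta)v$,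 $B_\lambda v=0$, where $\beta\in\mathbb{C}$, $0\neq\alpha\in\mathbb{C}$.
   Formalization: In (4)(ix) the coefficients −54/113 and +127/1862 of F are corrected to −54/133 and −127/1862; in (5)(vii) and (5)(viii) the sign of G is reversed (G=−t and G=−t(x+λ/7)), because the printed pairs F, G do not define modules. *)

theory Defs
  imports
    Complex_Main
    "HOL-Computational_Algebra.Polynomial"
    "HOL-Library.Product_Plus"
    "HOL-Library.Function_Algebras"
begin

text \<open>
  The ring of polynomials in the derivation is the type \<^typ>\<open>complex poly\<close>, the derivation
  itself being \<^term>\<open>[:0, 1:] :: complex poly\<close>. Modules over it are modules in the sense of the
  library locale \<^locale>\<open>module\<close>; multiplication by a complex number \<open>k\<close> is multiplication
  by the constant polynomial \<open>[:k:]\<close>. A polynomial in lambda with coefficients in such a module is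
  an element of \<^typ>\<open>'v::zero poly\<close>.
\<close>

record (overloaded) ('v::ab_group_add) cd_module =
  smul :: "complex poly \<Rightarrow> 'v \<Rightarrow> 'v"

record (overloaded) ('r::ab_group_add) lie_conf = "'r cd_module" +
  bracket :: "'r \<Rightarrow> 'r \<Rightarrow> 'r poly"

record (overloaded) ('r, 'v::ab_group_add) conf_mod = "'v cd_module" +
  action :: "'r \<Rightarrow> 'v \<Rightarrow> 'v poly"

text \<open>
  Substitution of a polynomial \<open>q\<close> in the derivation for lambda, the powers of lambda being
  written to the left of the coefficients. The axioms below are identities between polynomials
  in lambda (and mu); they are stated for all complex values of these variables, which is the same
  since the complex field is infinite.
\<close>

definition lam_subst :: "(complex poly \<Rightarrow> 'v \<Rightarrow> 'v) \<Rightarrow> ('v::ab_group_add) poly \<Rightarrow> complex poly \<Rightarrow> 'v"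
  where "lam_subst s P q = (\<Sum>i\<le>degree P. s (q ^ i) (coeff P i))"

locale sesquilinear =
  R: module r + V: module s
  for r :: "complex poly \<Rightarrow> 'r::ab_group_add \<Rightarrow> 'r"
    and s :: "complex poly \<Rightarrow> 'v::ab_group_add \<Rightarrow> 'v" +
  fixes prod :: "'r \<Rightarrow> 'v \<Rightarrow> 'v poly"
  assumes add_left: "prod (a + b) v = prod a v + prod b v"
    and add_right: "prod a (v + w) = prod a v + prod a w"
    and scale_left: "prod (r [:k:] a) v = map_poly (s [:k:]) (prod a v)"
    and scale_right: "prod a (s [:k:] v) = map_poly (s [:k:]) (prod a v)"
    and deriv_left:
      "lam_subst s (prod (r [:0, 1:] a) v) [:x:] = s [:- x:] (lam_subst s (prod a v) [:x:])"
    and deriv_right: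
      "lam_subst s (prod a (s [:0, 1:] v)) [:x:] = s [:x, 1:] (lam_subst s (prod a v) [:x:])"

definition bracket_at :: "('r::ab_group_add, 'z) lie_conf_scheme \<Rightarrow> complex \<Rightarrow> 'r \<Rightarrow> 'r \<Rightarrow> 'r"
  where "bracket_at R x a b = lam_subst (smul R) (bracket R a b) [:x:]"

definition action_at :: "('r, 'v::ab_group_add, 'z) conf_mod_scheme \<Rightarrow> complex \<Rightarrow> 'r \<Rightarrow> 'v \<Rightarrow> 'v"
  where "action_at M x a v = lam_subst (smul M) (action M a v) [:x:]"

locale lie_conformal_algebra =
  fixes R :: "('r::ab_group_add) lie_conf"
  assumes sesquilinear_bracket: "sesquilinear (smul R) (smul R) (bracket R)"
    and skew: "bracket_at R x a b = - lam_subst (smul R) (bracket R b a) [:- x, - 1:]"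
    and jacobi: "bracket_at R x a (bracket_at R y b e) =
      bracket_at R (x + y) (bracket_at R x a b) e + bracket_at R y b (bracket_at R x a e)"

locale conformal_module = lie_conformal_algebra R
  for R :: "('r::ab_group_add) lie_conf" +
  fixes M :: "('r, 'v::ab_group_add) conf_mod"
  assumes sesquilinear_action: "sesquilinear (smul R) (smul M) (action M)"
    and action_bracket: "action_at M x a (action_at M y b v) =
      action_at M (x + y) (bracket_at R x a b) v + action_at M y b (action_at M x a v)"

definition conf_hom ::
  "('r, 'v::ab_group_add) conf_mod \<Rightarrow> ('r, 'w::ab_group_add) conf_mod \<Rightarrow> ('v \<Rightarrow> 'w) \<Rightarrow> bool"
  where "conf_hom M N h \<longleftrightarrow>
    module_hom (smul M) (smul N) h \<and> (\<forall>a v. action N a (h v) = map_poly h (action M a v))"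

definition extension ::
  "('r::ab_group_add) lie_conf \<Rightarrow> ('r, 'v::ab_group_add) conf_mod \<Rightarrow> ('r, 'e::ab_group_add) conf_mod \<Rightarrow>
   ('r, 'w::ab_group_add) conf_mod \<Rightarrow> ('v \<Rightarrow> 'e) \<Rightarrow> ('e \<Rightarrow> 'w) \<Rightarrow> bool"
  where "extension R V E W \<iota> \<pi> \<longleftrightarrow>
    conformal_module R V \<and> conformal_module R E \<and> conformal_module R W \<and>
    conf_hom V E \<iota> \<and> conf_hom E W \<pi> \<and>
    inj \<iota> \<and> range \<iota> = {x. \<pi> x = 0} \<and> surj \<pi>"

definition ext_equiv ::
  "('r, 'e::ab_group_add) conf_mod \<Rightarrow> ('v \<Rightarrow> 'e) \<Rightarrow> ('e \<Rightarrow> 'w) \<Rightarrow>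
   ('r, 'f::ab_group_add) conf_mod \<Rightarrow> ('v \<Rightarrow> 'f) \<Rightarrow> ('f \<Rightarrow> 'w) \<Rightarrow> bool"
  where "ext_equiv E \<iota> \<pi> E' \<iota>' \<pi>' \<longleftrightarrow>
    (\<exists>h. conf_hom E E' h \<and> (\<forall>v. h (\<iota> v) = \<iota>' v) \<and> (\<forall>x. \<pi>' (h x) = \<pi> x))"

abbreviation incl :: "'v \<Rightarrow> 'v \<times> 'w::ab_group_add"
  where "incl v \<equiv> (v, 0)"

text \<open>
  The direct sum of vector spaces, with the action of the derivation and of the algebra on the
  second summand modified by \<open>\<delta>\<close> and \<open>\<gamma>\<close>, which take values in the first summand.
\<close>

definition twisted_sum ::
  "('r, 'v::ab_group_add) conf_mod \<Rightarrow> ('r, 'w::ab_group_add) conf_mod \<Rightarrow>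
   (complex poly \<Rightarrow> 'w \<Rightarrow> 'v) \<times> ('r \<Rightarrow> 'w \<Rightarrow> 'v poly) \<Rightarrow> ('r, 'v \<times> 'w) conf_mod"
  where "twisted_sum V W = (\<lambda>(\<delta>, \<gamma>). \<lparr>
    smul = (\<lambda>q (v, w). (smul V q v + \<delta> q w, smul W q w)),
    action = (\<lambda>a (v, w). map_poly (\<lambda>y. (y, 0)) (action V a v + \<gamma> a w) +
                        map_poly (\<lambda>y. (0, y)) (action W a w))\<rparr>)"

abbreviation direct_sum ::
  "('r, 'v::ab_group_add) conf_mod \<Rightarrow> ('r, 'w::ab_group_add) conf_mod \<Rightarrow> ('r, 'v \<times> 'w) conf_mod"
  where "direct_sum V W \<equiv> twisted_sum V W (\<lambda>q w. 0, \<lambda>a w. 0)"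

definition trivial_ext ::
  "('r, 'v::ab_group_add) conf_mod \<Rightarrow> ('r, 'e::ab_group_add) conf_mod \<Rightarrow>
   ('r, 'w::ab_group_add) conf_mod \<Rightarrow> ('v \<Rightarrow> 'e) \<Rightarrow> ('e \<Rightarrow> 'w) \<Rightarrow> bool"
  where "trivial_ext V E W \<iota> \<pi> \<longleftrightarrow> ext_equiv E \<iota> \<pi> (direct_sum V W) incl snd"

definition ext_cocycle ::
  "('r::ab_group_add) lie_conf \<Rightarrow> ('r, 'v::ab_group_add) conf_mod \<Rightarrow> ('r, 'w::ab_group_add) conf_mod \<Rightarrow>
   (complex poly \<Rightarrow> 'w \<Rightarrow> 'v) \<times> ('r \<Rightarrow> 'w \<Rightarrow> 'v poly) \<Rightarrow> bool"
  where "ext_cocycle R V W z \<longleftrightarrow>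
    (\<forall>k w. fst z [:k:] w = 0) \<and> extension R V (twisted_sum V W z) W incl snd"

definition trivial_cocycle ::
  "('r, 'v::ab_group_add) conf_mod \<Rightarrow> ('r, 'w::ab_group_add) conf_mod \<Rightarrow>
   (complex poly \<Rightarrow> 'w \<Rightarrow> 'v) \<times> ('r \<Rightarrow> 'w \<Rightarrow> 'v poly) \<Rightarrow> bool"
  where "trivial_cocycle V W z \<longleftrightarrow> trivial_ext V (twisted_sum V W z) W incl snd"

definition cocycle_scale ::
  "('r, 'v::ab_group_add) conf_mod \<Rightarrow> complex \<Rightarrow>
   (complex poly \<Rightarrow> 'w \<Rightarrow> 'v) \<times> ('r \<Rightarrow> 'w \<Rightarrow> 'v poly) \<Rightarrow>
   (complex poly \<Rightarrow> 'w \<Rightarrow> 'v) \<times> ('r \<Rightarrow> 'w \<Rightarrow> 'v poly)"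
  where "cocycle_scale V k = (\<lambda>(\<delta>, \<gamma>).
    (\<lambda>q w. smul V [:k:] (\<delta> q w), \<lambda>a w. map_poly (smul V [:k:]) (\<gamma> a w)))"

text \<open>
  The space Ext(W, V) of cocycles modulo trivial cocycles has dimension \<open>n\<close>: there are cocycles
  \<open>z 0, \<dots>, z (n - 1)\<close> whose classes are linearly independent and span the quotient.
\<close>

definition Ext_dim ::
  "('r::ab_group_add) lie_conf \<Rightarrow> ('r, 'w::ab_group_add) conf_mod \<Rightarrow> ('r, 'v::ab_group_add) conf_mod \<Rightarrow>
   nat \<Rightarrow> bool"
  where "Ext_dim R W V n \<longleftrightarrow> (\<exists>z.
    (\<forall>i<n. ext_cocycle R V W (z i)) \<and>
    (\<forall>k. trivial_cocycle V W (\<Sum>i<n. cocycle_scale V (k i) (z i)) \<longrightarrow> (\<forall>i<n. k i = 0)) \<and>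
    (\<forall>y. ext_cocycle R V W y \<longrightarrow>
      (\<exists>k. trivial_cocycle V W (y - (\<Sum>i<n. cocycle_scale V (k i) (z i))))))"

text \<open>
  The first variable (the derivation, or \<open>x\<close>) is the inner one, lambda is the outer one.
\<close>

type_synonym bipoly = "complex poly poly"

abbreviation vx :: bipoly where "vx \<equiv> [:[:0, 1:]:]"
abbreviation vl :: bipoly where "vl \<equiv> [:0, 1:]"
abbreviation cst :: "complex \<Rightarrow> bipoly" where "cst k \<equiv> [:[:k:]:]"

text \<open>\<open>bact s f v\<close> is \<open>f\<close> applied to \<open>v\<close>, the first variable acting as the derivation.\<close>

definition bact :: "(complex poly \<Rightarrow> 'v::ab_group_add \<Rightarrow> 'v) \<Rightarrow> bipoly \<Rightarrow> 'v \<Rightarrow> 'v poly"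
  where "bact s f v = map_poly (\<lambda>q. s q v) f"

definition shift :: "complex \<Rightarrow> bipoly \<Rightarrow> bipoly"
  where "shift \<beta> F = map_poly (\<lambda>q. pcompose q [:\<beta>, 1:]) F"

definition Q_poly :: "complex \<Rightarrow> complex \<Rightarrow> complex \<Rightarrow> bipoly"
  where "Q_poly a c d =
   (if a = 1 then cst c * (vx + 2 * vl)
    else if a = 0 then cst c * (vx + 2 * vl) * (vx + vl) * vl + cst d * (vx + 2 * vl) * vx
    else if a = - 1 then cst c * (vx + 2 * vl) * vx ^ 2 + cst d * (vx + 2 * vl) * (vx + vl) * vx * vl
    else if a = - 4 then cst c * (vx + 2 * vl) * (vx + vl) ^ 3 * vl ^ 3
    else if a = - 6 then
      cst c * (vx + 2 * vl) * (11 * (vx + vl) ^ 4 * vl ^ 4 + 2 * (vx + vl) ^ 3 * vx ^ 2 * vl ^ 3)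
    else 0)"

definition free_basis :: "(complex poly \<Rightarrow> 'v::ab_group_add \<Rightarrow> 'v) \<Rightarrow> 'v set \<Rightarrow> bool"
  where "free_basis s S \<longleftrightarrow> \<not> module.dependent s S \<and> module.span s S = UNIV"

definition rank_two_type_II ::
  "('r::ab_group_add) lie_conf \<Rightarrow> 'r \<Rightarrow> 'r \<Rightarrow> complex \<Rightarrow> complex \<Rightarrow> complex \<Rightarrow> bool"
  where "rank_two_type_II R A B a c d \<longleftrightarrow>
    lie_conformal_algebra R \<and> A \<noteq> B \<and> free_basis (smul R) {A, B} \<and>
    bracket R A A = bact (smul R) (vx + 2 * vl) A + bact (smul R) (Q_poly a c d) B \<and>
    bracket R A B = bact (smul R) (vx + cst a * vl) B \<and>
    bracket R B B = 0 \<and>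
    a \<in> {1, 0, - 1, - 4, - 6}"

definition rank_one_module ::
  "('r::ab_group_add) lie_conf \<Rightarrow> 'r \<Rightarrow> 'r \<Rightarrow> ('r, 'v::ab_group_add) conf_mod \<Rightarrow> 'v \<Rightarrow>
   complex \<Rightarrow> complex \<Rightarrow> bool"
  where "rank_one_module R A B V v \<alpha> \<beta> \<longleftrightarrow>
    conformal_module R V \<and> free_basis (smul V) {v} \<and>
    action V A v = bact (smul V) (vx + cst \<alpha> * vl + cst \<beta>) v \<and>
    action V B v = 0"

text \<open>
  The direct sum of the free modules generated by \<open>v\<close> and \<open>v'\<close>, with the action of \<open>A\<close> and \<open>B\<close>
  on the generator \<open>v'\<close> modified by \<open>f\<close> and \<open>g\<close>.
\<close>

definition standard_ext ::
  "('r::ab_group_add) lie_conf \<Rightarrow> 'r \<Rightarrow> 'r \<Rightarrow>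
   ('r, 'v::ab_group_add) conf_mod \<Rightarrow> 'v \<Rightarrow> complex \<Rightarrow> complex \<Rightarrow>
   ('r, 'w::ab_group_add) conf_mod \<Rightarrow> 'w \<Rightarrow> complex \<Rightarrow> complex \<Rightarrow>
   bipoly \<Rightarrow> bipoly \<Rightarrow> ('r, 'v \<times> 'w) conf_mod \<Rightarrow> bool"
  where "standard_ext R A B V v \<alpha> \<beta> V' v' \<alpha>' \<beta>' f g M \<longleftrightarrow>
    extension R V M V' incl snd \<and>
    smul M = smul (direct_sum V V') \<and>
    action M A (v, 0) = bact (smul M) (vx + cst \<alpha> * vl + cst \<beta>) (v, 0) \<and>
    action M B (v, 0) = 0 \<and>
    action M A (0, v') =
      bact (smul M) (vx + cst \<alpha>' * vl + cst \<beta>') (0, v') + bact (smul M) f (v, 0) \<and>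
    action M B (0, v') = bact (smul M) g (v, 0)"

definition vir2 :: "complex \<Rightarrow> bipoly"
  where "vir2 s = cst s * vl ^ 2 * (2 * vx + vl)"

definition vir3 :: "complex \<Rightarrow> bipoly"
  where "vir3 s = cst s * vx * vl ^ 2 * (vx + vl)"

definition vir4 :: "complex \<Rightarrow> complex \<Rightarrow> bipoly"
  where "vir4 \<alpha> s = cst s * vl ^ 2 * (4 * vx ^ 3 + 6 * vx ^ 2 * vl - vx * vl ^ 2 + cst \<alpha> * vl ^ 3)"

definition vir5 :: "complex \<Rightarrow> bipoly"
  where "vir5 s = cst s *
    (vx ^ 4 * vl ^ 2 - 10 * vx ^ 2 * vl ^ 4 - 17 * vx * vl ^ 5 - 8 * vl ^ 6)"

definition vir6 :: "complex \<Rightarrow> complex \<Rightarrow> bipoly"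
  where "vir6 \<alpha> s = cst s *
    (vx ^ 4 * vl ^ 3 - cst (2 * \<alpha> + 3) * vx ^ 3 * vl ^ 4 - cst (3 * \<alpha>) * vx ^ 2 * vl ^ 5
     - cst (3 * \<alpha> + 1) * vx * vl ^ 6 - cst (\<alpha> + 9 / 28) * vl ^ 7)"

abbreviation r19 :: complex where "r19 \<equiv> complex_of_real (sqrt 19)"
abbreviation r22 :: complex where "r22 \<equiv> complex_of_real (sqrt 22)"

text \<open>
  \<open>ext_list a c d \<alpha> \<alpha>' n F G\<close>: the pair \<open>(F, G)\<close> occurs in the list for the algebra with
  parameters \<open>a, c, d\<close> and the modules with parameters \<open>\<alpha>\<close> (submodule) and \<open>\<alpha>'\<close> (quotient),
  in a case where the dimension of Ext is \<open>n\<close>. The number \<open>\<epsilon>\<close> is the sign in front of the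
  square root.

  Three entries differ from the printed list, whose pairs there are not cocycles.
  In \<open>a4_ix\<close> two coefficients of \<open>F\<close> are \<open>-54/133\<close> and \<open>-127/1862\<close>
  (printed \<open>-54/113\<close> and \<open>127/1862\<close>); in \<open>a6_vii\<close> and \<open>a6_viii\<close> the
  relative sign of \<open>F\<close> and \<open>G\<close> is reversed (printed \<open>G = t\<close> and
  \<open>G = t (x + \<lambda>/7)\<close> with the same \<open>F\<close>).
\<close>

inductive ext_list ::
  "complex \<Rightarrow> complex \<Rightarrow> complex \<Rightarrow> complex \<Rightarrow> complex \<Rightarrow> nat \<Rightarrow> bipoly \<Rightarrow> bipoly \<Rightarrow> bool"
where
  a1_i: "(s0, s1) \<noteq> (0, 0) \<Longrightarrow>
    ext_list 1 c d \<alpha> \<alpha> 2 (cst s0 + cst s1 * vl) 0"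
| a1_ii: "t \<noteq> 0 \<Longrightarrow>
    ext_list 1 c d \<alpha> (\<alpha> + 1) 1 (cst (c * t / \<alpha>) * vx) (cst t * vl)"
| a1_iii: "\<alpha> \<noteq> - 1 \<Longrightarrow> s \<noteq> 0 \<Longrightarrow>
    ext_list 1 c d \<alpha> (\<alpha> + 2) 1 (vir2 s) 0"
| a1_iv: "(s, t) \<noteq> (0, 0) \<Longrightarrow>
    ext_list 1 c d (- 1) 1 2
      (vir2 s - cst (c * t) * (vx ^ 2 - vl ^ 2)) (cst t * (vx * vl + vl ^ 2))"
| a1_v: "s \<noteq> 0 \<Longrightarrow>
    ext_list 1 c d \<alpha> (\<alpha> + 3) 1 (vir3 s) 0"
| a1_vi: "s \<noteq> 0 \<Longrightarrow>
    ext_list 1 c d \<alpha> (\<alpha> + 4) 1 (vir4 \<alpha> s) 0"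
| a1_vii: "s \<noteq> 0 \<Longrightarrow>
    ext_list 1 c d (- 4) 1 1 (vir5 s) 0"
| a1_viii: "\<epsilon> \<in> {1, - 1} \<Longrightarrow> \<alpha> = - (5 / 2) + \<epsilon> * r19 / 2 \<Longrightarrow> \<alpha>' = 7 / 2 + \<epsilon> * r19 / 2 \<Longrightarrow> s \<noteq> 0 \<Longrightarrow>
    ext_list 1 c d \<alpha> \<alpha>' 1 (vir6 \<alpha> s) 0"

| a0_i: "(s0, s1) \<noteq> (0, 0) \<Longrightarrow>
    ext_list 0 c d \<alpha> \<alpha> 2 (cst s0 + cst s1 * vl) 0"
| a0_ii: "t \<noteq> 0 \<Longrightarrow>
    ext_list 0 c d \<alpha> (\<alpha> + 1) 1
      (- cst (c * t / \<alpha>) * vx * vl - cst (d * t / \<alpha>) * vx) (cst t)"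
| a0_iii: "\<alpha> \<noteq> - 1 \<Longrightarrow> s \<noteq> 0 \<Longrightarrow>
    ext_list 0 c d \<alpha> (\<alpha> + 2) 1 (vir2 s) 0"
| a0_iv: "(s, t) \<noteq> (0, 0) \<Longrightarrow>
    ext_list 0 c d (- 1) 1 2
      (vir2 s + cst (c * t) * vx ^ 2 * vl + cst (d * t) * (vx ^ 2 - vl ^ 2)) (cst t * (vx + vl))"
| a0_v: "s \<noteq> 0 \<Longrightarrow>
    ext_list 0 c d \<alpha> (\<alpha> + 3) 1 (vir3 s) 0"
| a0_vi: "s \<noteq> 0 \<Longrightarrow>
    ext_list 0 c d \<alpha> (\<alpha> + 4) 1 (vir4 \<alpha> s) 0"
| a0_vii: "s \<noteq> 0 \<Longrightarrow>
    ext_list 0 c d (- 4) 1 1 (vir5 s) 0"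
| a0_viii: "\<epsilon> \<in> {1, - 1} \<Longrightarrow> \<alpha> = - (5 / 2) + \<epsilon> * r19 / 2 \<Longrightarrow> \<alpha>' = 7 / 2 + \<epsilon> * r19 / 2 \<Longrightarrow> s \<noteq> 0 \<Longrightarrow>
    ext_list 0 c d \<alpha> \<alpha>' 1 (vir6 \<alpha> s) 0"

| am1_i: "(s0, s1) \<noteq> (0, 0) \<Longrightarrow>
    ext_list (- 1) c d \<alpha> \<alpha> 2 (cst s0 + cst s1 * vl) 0"
| am1_ii: "\<alpha> \<noteq> - (1 / 2) \<Longrightarrow> s \<noteq> 0 \<Longrightarrow>
    ext_list (- 1) c d \<alpha> (\<alpha> + 2) 1 (vir2 s) 0"
| am1_iii: "(s, t) \<noteq> (0, 0) \<Longrightarrow>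
    ext_list (- 1) c d (- (1 / 2)) (3 / 2) 2
      (vir2 s - cst (2 * d * t) * vx ^ 2 * vl - cst (c * t) * (2 * vx ^ 2 - vl ^ 2)) (cst t)"
| am1_iv: "\<alpha> \<noteq> - 1 \<Longrightarrow> s \<noteq> 0 \<Longrightarrow>
    ext_list (- 1) c d \<alpha> (\<alpha> + 3) 1 (vir3 s) 0"
| am1_v: "(s, t) \<noteq> (0, 0) \<Longrightarrow>
    ext_list (- 1) c d (- 1) 2 2
      (vir3 s - cst (d * t / 4) * (2 * vx ^ 3 * vl + vl ^ 4)
        - cst (c * t / 2) * (vx ^ 3 - 2 * vx * vl ^ 2 - 2 * vl ^ 3))
      (cst t * (vx + cst (1 / 2) * vl))"
| am1_vi: "s \<noteq> 0 \<Longrightarrow>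
    ext_list (- 1) c d \<alpha> (\<alpha> + 4) 1 (vir4 \<alpha> s) 0"
| am1_vii: "s \<noteq> 0 \<Longrightarrow>
    ext_list (- 1) c d (- 4) 1 1 (vir5 s) 0"
| am1_viii: "\<epsilon> \<in> {1, - 1} \<Longrightarrow> \<alpha> = - (5 / 2) + \<epsilon> * r19 / 2 \<Longrightarrow> \<alpha>' = 7 / 2 + \<epsilon> * r19 / 2 \<Longrightarrow> s \<noteq> 0 \<Longrightarrow>
    ext_list (- 1) c d \<alpha> \<alpha>' 1 (vir6 \<alpha> s) 0"

| a4_i: "(s0, s1) \<noteq> (0, 0) \<Longrightarrow>
    ext_list (- 4) c d \<alpha> \<alpha> 2 (cst s0 + cst s1 * vl) 0"
| a4_ii: "s \<noteq> 0 \<Longrightarrow>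
    ext_list (- 4) c d \<alpha> (\<alpha> + 2) 1 (vir2 s) 0"
| a4_iii: "s \<noteq> 0 \<Longrightarrow>
    ext_list (- 4) c d \<alpha> (\<alpha> + 3) 1 (vir3 s) 0"
| a4_iv: "s \<noteq> 0 \<Longrightarrow>
    ext_list (- 4) c d \<alpha> (\<alpha> + 4) 1 (vir4 \<alpha> s) 0"
| a4_v: "\<alpha> \<notin> {- 2, - 4} \<Longrightarrow> t \<noteq> 0 \<Longrightarrow> D = \<alpha> * (\<alpha> + 2) * (\<alpha> + 4) \<Longrightarrow>
    ext_list (- 4) c d \<alpha> (\<alpha> + 5) 1
      (- cst (3 / D * c * t) * vx ^ 3 * vl ^ 3
       + cst (9 * (\<alpha> + 1) / (2 * D) * c * t) * vx ^ 2 * vl ^ 4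
       - cst (9 * (\<alpha> + 1) * (2 * \<alpha> + 1) / (10 * D) * c * t) * vx * vl ^ 5
       + cst ((\<alpha> + 1) * (2 * \<alpha> + 1) / (10 * (\<alpha> + 2) * (\<alpha> + 4)) * c * t) * vl ^ 6)
      (cst t)"
| a4_vi: "t \<noteq> 0 \<Longrightarrow>
    ext_list (- 4) c d (- 2) 3 1
      (cst (3 / 8 * c * t) * vx ^ 4 * vl ^ 2 - cst (3 / 2 * c * t) * vx ^ 2 * vl ^ 4
       - cst (57 / 40 * c * t) * vx * vl ^ 5 - cst (2 / 5 * c * t) * vl ^ 6)
      (cst t)"
| a4_vii: "s \<noteq> 0 \<Longrightarrow>
    ext_list (- 4) c d (- 4) 1 1 (vir5 s) 0"
| a4_viii: "\<alpha> \<notin> {- (5 / 2), - (5 / 2) + r19 / 2, - (5 / 2) - r19 / 2} \<Longrightarrow> t \<noteq> 0 \<Longrightarrow>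
    N = (2 * \<alpha> + 5) * (2 * \<alpha> ^ 2 + 10 * \<alpha> + 3) \<Longrightarrow>
    ext_list (- 4) c d \<alpha> (\<alpha> + 6) 1
      (- cst (3 / N * c * t) * vx ^ 4 * vl ^ 3
       + cst (3 * (2 * \<alpha> + 3) / N * c * t) * vx ^ 3 * vl ^ 4
       - cst (9 * (\<alpha> + 1) * (2 * \<alpha> + 3) / (5 * N) * c * t) * vx ^ 2 * vl ^ 5
       + cst ((\<alpha> + 1) * (2 * \<alpha> + 1) * (2 * \<alpha> + 3) / (5 * N) * c * t) * vx * vl ^ 6
       - cst (\<alpha> * (\<alpha> + 1) * (2 * \<alpha> + 1) * (2 * \<alpha> + 3) / (70 * N) * c * t) * vl ^ 7)
      (cst t * (vx - cst (\<alpha> / 5) * vl))"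
| a4_ix: "t \<noteq> 0 \<Longrightarrow>
    ext_list (- 4) c d (- (5 / 2)) (7 / 2) 1
      (cst (36 / 665 * c * t) * vx ^ 5 * vl ^ 2 - cst (54 / 133 * c * t) * vx ^ 3 * vl ^ 4
       - cst (387 / 665 * c * t) * vx ^ 2 * vl ^ 5 - cst (218 / 665 * c * t) * vx * vl ^ 6
       - cst (127 / 1862 * c * t) * vl ^ 7)
      (cst t * (vx + cst (1 / 2) * vl))"
| a4_x: "\<epsilon> \<in> {1, - 1} \<Longrightarrow> \<alpha> = - (5 / 2) + \<epsilon> * r19 / 2 \<Longrightarrow> \<alpha>' = 7 / 2 + \<epsilon> * r19 / 2 \<Longrightarrow> s \<noteq> 0 \<Longrightarrow>
    ext_list (- 4) c d \<alpha> \<alpha>' 1 (vir6 \<alpha> s) 0"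
| a4_xi: "t \<noteq> 0 \<Longrightarrow>
    ext_list (- 4) c d (- 6) 1 1
      (cst (1 / 35 * c * t) * vx ^ 5 * vl ^ 3 + cst (2 / 7 * c * t) * vx ^ 4 * vl ^ 4
       + cst (36 / 35 * c * t) * vx ^ 3 * vl ^ 5 + cst (12 / 7 * c * t) * vx ^ 2 * vl ^ 6
       + cst (66 / 49 * c * t) * vx * vl ^ 7 + cst (99 / 245 * c * t) * vl ^ 8)
      (cst t * (vx ^ 2 + cst (11 / 5) * vx * vl + cst (6 / 5) * vl ^ 2))"

| a6_i: "(s0, s1) \<noteq> (0, 0) \<Longrightarrow>
    ext_list (- 6) c d \<alpha> \<alpha> 2 (cst s0 + cst s1 * vl) 0"
| a6_ii: "s \<noteq> 0 \<Longrightarrow>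
    ext_list (- 6) c d \<alpha> (\<alpha> + 2) 1 (vir2 s) 0"
| a6_iii: "s \<noteq> 0 \<Longrightarrow>
    ext_list (- 6) c d \<alpha> (\<alpha> + 3) 1 (vir3 s) 0"
| a6_iv: "s \<noteq> 0 \<Longrightarrow>
    ext_list (- 6) c d \<alpha> (\<alpha> + 4) 1 (vir4 \<alpha> s) 0"
| a6_v: "s \<noteq> 0 \<Longrightarrow>
    ext_list (- 6) c d (- 4) 1 1 (vir5 s) 0"
| a6_vi: "\<epsilon> \<in> {1, - 1} \<Longrightarrow> \<alpha> = - (5 / 2) + \<epsilon> * r19 / 2 \<Longrightarrow> \<alpha>' = 7 / 2 + \<epsilon> * r19 / 2 \<Longrightarrow> s \<noteq> 0 \<Longrightarrow>
    ext_list (- 6) c d \<alpha> \<alpha>' 1 (vir6 \<alpha> s) 0"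
| a6_vii: "\<epsilon> \<in> {1, - 1} \<Longrightarrow> \<alpha> = - 3 + \<epsilon> * r22 / 2 \<Longrightarrow> \<alpha>' = 4 + \<epsilon> * r22 / 2 \<Longrightarrow> t \<noteq> 0 \<Longrightarrow>
    ext_list (- 6) c d \<alpha> \<alpha>' 1
      (- cst (40 / (7 * (\<alpha> + 3)) * c * t) * vx ^ 5 * vl ^ 3
       + cst (100 * (\<alpha> + 2) / (7 * (\<alpha> + 3)) * c * t) * vx ^ 4 * vl ^ 4
       + cst (40 * (5 * \<alpha> + 1) / (7 * (\<alpha> + 3)) * c * t) * vx ^ 3 * vl ^ 5
       + cst (20 * (16 * \<alpha> + 11) / (7 * (\<alpha> + 3)) * c * t) * vx ^ 2 * vl ^ 6
       + cst (10 * (154 * \<alpha> + 101) / (49 * (\<alpha> + 3)) * c * t) * vx * vl ^ 7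
       + cst ((823 * \<alpha> + 539) / (98 * (\<alpha> + 3)) * c * t) * vl ^ 8)
      (- cst t)"
| a6_viii: "t \<noteq> 0 \<Longrightarrow>
    ext_list (- 6) c d (- 1) 7 1
      (- cst (2 / 7 * c * t) * vx ^ 6 * vl ^ 3 + cst (9 / 7 * c * t) * vx ^ 5 * vl ^ 4
       - cst (9 / 7 * c * t) * vx ^ 4 * vl ^ 5 + cst (2 / 7 * c * t) * vx ^ 3 * vl ^ 6)
      (- cst t * (vx + cst (1 / 7) * vl))"
| a6_ix: "t \<noteq> 0 \<Longrightarrow>
    ext_list (- 6) c d (- 6) 2 1
      (- cst (2 / 7 * c * t) * vx ^ 6 * vl ^ 3 - cst (3 * c * t) * vx ^ 5 * vl ^ 4
       - cst (12 * c * t) * vx ^ 4 * vl ^ 5 - cst (24 * c * t) * vx ^ 3 * vl ^ 6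
       - cst (180 / 7 * c * t) * vx ^ 2 * vl ^ 7 - cst (99 / 7 * c * t) * vx * vl ^ 8
       - cst (22 / 7 * c * t) * vl ^ 9)
      (cst t * (vx + cst (6 / 7) * vl))"

end

theory Submission
  imports Defs
begin

text \<open>
  A lift of \<open>v'\<close> to an extension yields a pair \<open>(f, g)\<close>, and the module axiom on the generators
  is equivalent to two functional equations for \<open>f\<close> and \<open>g\<close>; changing the lift adds a coboundary
  to \<open>f\<close>. If \<open>\<beta> \<noteq> \<beta>'\<close>, putting one variable to \<open>0\<close> shows that every cocycle is a coboundary. If
  \<open>\<beta> = \<beta>'\<close>, the equations are homogeneous after a shift of \<open>\<partial>\<close>. Comparing the coefficients that
  are linear in one variable (an Euler operator) shows that \<open>f\<close> may be taken homogeneous of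
  degree \<open>\<alpha>' - \<alpha> + 1\<close> and that \<open>g\<close> is homogeneous of degree \<open>\<alpha>' - \<alpha> + a - 1\<close>. Modulo coboundaries, the
  terms of \<open>f\<close> of degree two and three in \<open>\<lambda>\<close> determine the others; the compatibility
  of these determinations gives a quadratic equation for \<open>\<alpha>\<close> in degree \<open>6\<close> and \<open>7\<close>, whence the
  square roots of \<open>19\<close> and \<open>22\<close>, and excludes large degrees.
\<close>

section \<open>Coefficients of polynomial functions\<close>

text \<open>The equation for \<open>g\<close> does not contain \<open>f\<close> and is solved by
  itself; for \<open>a\<close> \<le> 0 and \<alpha> \<noteq> 0 its solutions have degree at most 2.
  The obstacle is to decide which of them occur, that is, for which \<alpha> the product of
  \<open>Q\<close> and \<open>g\<close> lies in the image of the linear operator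
  \<open>dvir\<close>. As \<alpha> and the degree are parameters, this is decided by relations
  between single coefficients: a suitable combination of them involves \<open>f\<close> only through
  a factor such as \<open>vir_obstr\<close>, while \<open>Q\<close> and \<open>g\<close> contribute
  a multiple of the leading coefficient of \<open>g\<close>. Once a particular solution has been
  subtracted, a cocycle with zero \<open>g\<close> remains, and the equation for it contains
  \<alpha> and \<alpha>' but not \<open>a\<close>, \<open>c\<close>, \<open>d\<close>. Hence the
  five algebras share one classification of such cocycles and differ in the pairs (\<alpha>,
  \<alpha>') that admit a nonzero \<open>g\<close>. The case \<open>a\<close> = 1 is reduced to
  \<open>a\<close> = 0 by dividing \<open>g\<close> by \<lambda>. The transfer to modules rests on
  freeness: every extension splits over the polynomials in the derivation, so it has coordinates in
  which only \<open>f\<close> and \<open>g\<close> are left.\<close>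

definition ev :: "bipoly \<Rightarrow> complex \<Rightarrow> complex \<Rightarrow> complex"
  where "ev f z x = poly (poly f [:x:]) z"

lemma ev_simps:
  "ev 0 z x = 0" "ev 1 z x = 1" "ev [:[:k:]:] z x = k" "ev [:[:0, 1:]:] z x = z"
  "ev [:0, 1:] z x = x" "ev (numeral w) z x = numeral w"
  "ev (f + g) z x = ev f z x + ev g z x" "ev (f - g) z x = ev f z x - ev g z x"
  "ev (- f) z x = - ev f z x" "ev (f * g) z x = ev f z x * ev g z x" "ev (f ^ n) z x = ev f z x ^ n"
  by (simp_all add: ev_def numeral_poly)

lemma ev_pCons: "ev (pCons q f) z x = poly q z + x * ev f z x"
  by (simp add: ev_def)

text \<open>Polynomials are nested, and identities become available after the variables have been
  replaced by complex constants. Those constants, embedded by \<open>h\<close>, are infinitely many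
  elements of the coefficient domain, so a nonzero difference would have too many roots.\<close>

lemma poly_eqI_consts:
  fixes P P' :: "'a::{idom, ring_char_0} poly" and h :: "complex \<Rightarrow> 'a"
  assumes "inj h" and "\<And>y. poly P (h y) = poly P' (h y)"
  shows "P = P'"
proof (rule ccontr)
  assume "P \<noteq> P'"
  then have "finite {x. poly (P - P') x = 0}"
    using poly_roots_finite[of "P - P'"] by simp
  moreover have "range h \<subseteq> {x. poly (P - P') x = 0}"
    using assms(2) by auto
  ultimately have "finite (range h)" by (rule rev_finite_subset)
  then have "finite (UNIV :: complex set)"
    using \<open>inj h\<close> by (rule finite_imageD)
  then show False by (simp add: infinite_UNIV_char_0)
qed

lemma ev_eqI:
  assumes "\<And>z x. ev f z x = ev g z x" shows "f = g"
proof (rule poly_eqI_consts[of "\<lambda>x. [:x:]"])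
  show "poly f [:x:] = poly g [:x:]" for x
    using assms[of _ x] by (intro poly_eqI_consts[of "\<lambda>z. z"]) (auto simp: ev_def)
qed (auto intro: injI)

text \<open>\<open>tri F c\<close>: \<open>c p s r\<close> is the coefficient of \<open>z\<^sup>p x\<^sup>s y\<^sup>r\<close> in the polynomial function \<open>F\<close>.\<close>

definition tri :: "(complex \<Rightarrow> complex \<Rightarrow> complex \<Rightarrow> complex) \<Rightarrow> (nat \<Rightarrow> nat \<Rightarrow> nat \<Rightarrow> complex) \<Rightarrow> bool"
  where "tri F c \<longleftrightarrow> (\<exists>P :: complex poly poly poly.
    (\<forall>z x y. F z x y = poly (poly (poly P [:[:y:]:]) [:x:]) z) \<and>
    (\<forall>p s r. c p s r = coeff (coeff (coeff P r) s) p))"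

text \<open>This is the comparison of coefficients: both sides of a functional equation are expanded
  by the \<open>tri\<close> rules below, and their coefficient arrays must then agree.\<close>

lemma tri_unique:
  assumes "tri F c" "tri F c'" shows "c p s r = c' p s r"
proof -
  from assms obtain P P' :: "complex poly poly poly" where
    P: "\<And>z x y. F z x y = poly (poly (poly P [:[:y:]:]) [:x:]) z"
      "\<And>p s r. c p s r = coeff (coeff (coeff P r) s) p" and
    P': "\<And>z x y. F z x y = poly (poly (poly P' [:[:y:]:]) [:x:]) z"
      "\<And>p s r. c' p s r = coeff (coeff (coeff P' r) s) p"
    unfolding tri_def by metis
  have "P = P'"
  proof (rule poly_eqI_consts[of "\<lambda>y. [:[:y:]:]"])
    show "poly P [:[:y:]:] = poly P' [:[:y:]:]" for y
      by (rule ev_eqI) (simp add: ev_def flip: P P')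
  qed (auto intro: injI)
  then show ?thesis by (simp add: P P')
qed

lemma tri_cong:
  assumes "tri F c" "\<And>z x y. F' z x y = F z x y" "\<And>p s r. c' p s r = c p s r"
  shows "tri F' c'"
  using assms unfolding tri_def by simp

lemma tri_0: "tri (\<lambda>z x y. 0) (\<lambda>p s r. 0)"
  unfolding tri_def by (rule exI[of _ 0]) simp

lemma tri_add: "tri F c \<Longrightarrow> tri G d \<Longrightarrow> tri (\<lambda>z x y. F z x y + G z x y) (\<lambda>p s r. c p s r + d p s r)"
  unfolding tri_def
  apply (elim exE conjE)
  subgoal for P Q by (rule exI[of _ "P + Q"]) simp
  done

lemma tri_diff: "tri F c \<Longrightarrow> tri G d \<Longrightarrow> tri (\<lambda>z x y. F z x y - G z x y) (\<lambda>p s r. c p s r - d p s r)"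
  unfolding tri_def
  apply (elim exE conjE)
  subgoal for P Q by (rule exI[of _ "P - Q"]) simp
  done

lemma tri_scale: "tri F c \<Longrightarrow> tri (\<lambda>z x y. k * F z x y) (\<lambda>p s r. k * c p s r)"
  unfolding tri_def
  apply (elim exE conjE)
  subgoal for P by (rule exI[of _ "smult [:[:k:]:] P"]) simp
  done

lemma tri_z: "tri F c \<Longrightarrow> tri (\<lambda>z x y. z * F z x y) (\<lambda>p s r. if p = 0 then 0 else c (p - 1) s r)"
  unfolding tri_def
  apply (elim exE conjE)
  subgoal for P by (rule exI[of _ "smult [:[:0, 1:]:] P"]) (auto simp: coeff_pCons split: nat.splits)
  done

lemma tri_x: "tri F c \<Longrightarrow> tri (\<lambda>z x y. x * F z x y) (\<lambda>p s r. if s = 0 then 0 else c p (s - 1) r)"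
  unfolding tri_def
  apply (elim exE conjE)
  subgoal for P by (rule exI[of _ "smult [:0, 1:] P"]) (auto simp: coeff_pCons split: nat.splits)
  done

lemma tri_y: "tri F c \<Longrightarrow> tri (\<lambda>z x y. y * F z x y) (\<lambda>p s r. if r = 0 then 0 else c p s (r - 1))"
  unfolding tri_def
  apply (elim exE conjE)
  subgoal for P by (rule exI[of _ "pCons 0 P"]) (auto simp: coeff_pCons split: nat.splits)
  done

lemma tri_const: "tri (\<lambda>z x y. k) (\<lambda>p s r. if p = 0 \<and> s = 0 \<and> r = 0 then k else 0)"
  unfolding tri_def
  by (rule exI[of _ "[:[:[:k:]:]:]"]) (auto simp: coeff_pCons split: nat.splits)

lemma tri_x_pow: "tri F c \<Longrightarrow> tri (\<lambda>z x y. x ^ i * F z x y) (\<lambda>p s r. if s < i then 0 else c p (s - i) r)"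
proof (induction i)
  case (Suc i)
  show ?case
    by (rule tri_cong[OF tri_x[OF Suc.IH[OF Suc.prems]]]) (auto simp: mult.assoc)
qed simp

lemma tri_y_pow: "tri F c \<Longrightarrow> tri (\<lambda>z x y. y ^ i * F z x y) (\<lambda>p s r. if r < i then 0 else c p s (r - i))"
proof (induction i)
  case (Suc i)
  show ?case
    by (rule tri_cong[OF tri_y[OF Suc.IH[OF Suc.prems]]]) (auto simp: mult.assoc)
qed simp

lemma tri_poly_z: "tri (\<lambda>z x y. poly q z) (\<lambda>p s r. if s = 0 \<and> r = 0 then coeff q p else 0)"
  unfolding tri_def
  by (rule exI[of _ "[:[:q:]:]"]) (auto simp: coeff_pCons split: nat.splits)

text \<open>Binomial expansion of the powers of z + x. The induction follows Horner's scheme, and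
  its step is Pascal's rule.\<close>

lemma tri_poly_zx:
  "tri (\<lambda>z x y. poly q (z + x)) (\<lambda>p s r. if r = 0 then of_nat (p + s choose s) * coeff q (p + s) else 0)"
proof (induction q)
  case 0
  show ?case by (rule tri_cong[OF tri_0]) auto
next
  case (pCons k q)
  show ?case
  proof (rule tri_cong[OF tri_add[OF tri_add[OF tri_const[of k] tri_z[OF pCons.IH]] tri_x[OF pCons.IH]]])
    fix p s r
    show "(if r = 0 then of_nat (p + s choose s) * coeff (pCons k q) (p + s) else 0) =
      (if p = 0 \<and> s = 0 \<and> r = 0 then k else 0) +
      (if p = 0 then 0 else if r = 0 then of_nat (p - 1 + s choose s) * coeff q (p - 1 + s) else 0) +
      (if s = 0 then 0 else if r = 0 then of_nat (p + (s - 1) choose (s - 1)) * coeff q (p + (s - 1)) else 0)"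
      by (cases p; cases s) (auto simp: algebra_simps)
  qed (simp add: algebra_simps)
qed

lemma tri_poly_zy:
  "tri (\<lambda>z x y. poly q (z + y)) (\<lambda>p s r. if s = 0 then of_nat (p + r choose r) * coeff q (p + r) else 0)"
proof (induction q)
  case 0
  show ?case by (rule tri_cong[OF tri_0]) auto
next
  case (pCons k q)
  show ?case
  proof (rule tri_cong[OF tri_add[OF tri_add[OF tri_const[of k] tri_z[OF pCons.IH]] tri_y[OF pCons.IH]]])
    fix p s r
    show "(if s = 0 then of_nat (p + r choose r) * coeff (pCons k q) (p + r) else 0) =
      (if p = 0 \<and> s = 0 \<and> r = 0 then k else 0) +
      (if p = 0 then 0 else if s = 0 then of_nat (p - 1 + r choose r) * coeff q (p - 1 + r) else 0) +
      (if r = 0 then 0 else if s = 0 then of_nat (p + (r - 1) choose (r - 1)) * coeff q (p + (r - 1)) else 0)"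
      by (cases p; cases r) (auto simp: algebra_simps)
  qed (simp add: algebra_simps)
qed

abbreviation cf :: "bipoly \<Rightarrow> nat \<Rightarrow> nat \<Rightarrow> complex"
  where "cf f i j \<equiv> coeff (coeff f i) j"

lemma tri_ev_x: "tri (\<lambda>z x y. ev f z x) (\<lambda>p s r. if r = 0 then cf f s p else 0)"
  unfolding tri_def ev_def
  by (rule exI[of _ "[:f:]"]) (auto simp: coeff_pCons split: nat.splits)

lemma tri_ev_y: "tri (\<lambda>z x y. ev f z y) (\<lambda>p s r. if s = 0 then cf f r p else 0)"
proof (induction f)
  case 0
  show ?case by (rule tri_cong[OF tri_0]) (auto simp: ev_simps)
next
  case (pCons q f)
  show ?case
    by (rule tri_cong[OF tri_add[OF tri_poly_z[of q] tri_y[OF pCons.IH]]])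
      (auto simp: ev_pCons coeff_pCons split: nat.splits)
qed

lemma tri_ev_zx_y:
  "tri (\<lambda>z x y. ev f (z + x) y) (\<lambda>p s r. of_nat (p + s choose s) * cf f r (p + s))"
proof (induction f)
  case 0
  show ?case by (rule tri_cong[OF tri_0]) (auto simp: ev_simps)
next
  case (pCons q f)
  show ?case
    by (rule tri_cong[OF tri_add[OF tri_poly_zx[of q] tri_y[OF pCons.IH]]])
      (auto simp: ev_pCons coeff_pCons split: nat.splits)
qed

lemma tri_ev_zy_x:
  "tri (\<lambda>z x y. ev f (z + y) x) (\<lambda>p s r. of_nat (p + r choose r) * cf f s (p + r))"
proof (induction f)
  case 0
  show ?case by (rule tri_cong[OF tri_0]) (auto simp: ev_simps)
next
  case (pCons q f)
  show ?case
    by (rule tri_cong[OF tri_add[OF tri_poly_zy[of q] tri_x[OF pCons.IH]]])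
      (auto simp: ev_pCons coeff_pCons split: nat.splits)
qed

lemma tri_ev_xy:
  "tri (\<lambda>z x y. ev f z (x + y)) (\<lambda>p s r. of_nat (s + r choose r) * cf f (s + r) p)"
proof (induction f)
  case 0
  show ?case by (rule tri_cong[OF tri_0]) (auto simp: ev_simps)
next
  case (pCons q f)
  show ?case
  proof (rule tri_cong[OF tri_add[OF tri_add[OF tri_poly_z[of q] tri_x[OF pCons.IH]] tri_y[OF pCons.IH]]])
    fix p s r
    show "of_nat (s + r choose r) * cf (pCons q f) (s + r) p =
      (if s = 0 \<and> r = 0 then coeff q p else 0) +
      (if s = 0 then 0 else of_nat (s - 1 + r choose r) * cf f (s - 1 + r) p) +
      (if r = 0 then 0 else of_nat (s + (r - 1) choose (r - 1)) * cf f (s + (r - 1)) p)"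
      by (cases s; cases r) (auto simp: algebra_simps)
  qed (simp add: ev_pCons algebra_simps)
qed

section \<open>The cocycle condition for the Virasoro generator\<close>

text \<open>
  With \<open>\<beta> = \<beta>' = 0\<close>, the defect of the module axiom for \<open>A\<close>, \<open>A\<close> and the lift of \<open>v'\<close>, up to the
  contribution of \<open>Q\<close>.
\<close>

definition dvir :: "complex \<Rightarrow> complex \<Rightarrow> bipoly \<Rightarrow> complex \<Rightarrow> complex \<Rightarrow> complex \<Rightarrow> complex"
  where "dvir \<alpha> \<alpha>' f z x y =
    (z + x + \<alpha>' * y) * ev f z x + (z + \<alpha> * x) * ev f (z + x) y
    - (z + y + \<alpha>' * x) * ev f z y - (z + \<alpha> * y) * ev f (z + y) x - (x - y) * ev f z (x + y)"

lemma dvir_add: "dvir \<alpha> \<alpha>' (f + g) z x y = dvir \<alpha> \<alpha>' f z x y + dvir \<alpha> \<alpha>' g z x y"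
  by (simp add: dvir_def ev_simps algebra_simps)

lemma dvir_diff: "dvir \<alpha> \<alpha>' (f - g) z x y = dvir \<alpha> \<alpha>' f z x y - dvir \<alpha> \<alpha>' g z x y"
  by (simp add: dvir_def ev_simps algebra_simps)

lemma dvir_scale: "dvir \<alpha> \<alpha>' (cst k * f) z x y = k * dvir \<alpha> \<alpha>' f z x y"
  unfolding dvir_def ev_simps by (simp only: algebra_simps)

text \<open>Up to its last term, \<open>dvir\<close> is the difference of two halves exchanged by
  swapping x and y. These are the coefficients of the half (z + x + \<alpha>' y) f(z, x) + (z +
  \<alpha> x) f(z + x, y).\<close>

definition half_coeff :: "complex \<Rightarrow> complex \<Rightarrow> bipoly \<Rightarrow> nat \<Rightarrow> nat \<Rightarrow> nat \<Rightarrow> complex"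
  where "half_coeff \<alpha> \<alpha>' f p s r =
    (if r = 0 then (if p = 0 then 0 else cf f s (p - 1)) + (if s = 0 then 0 else cf f (s - 1) p) else 0)
    + (if r = 1 then \<alpha>' * cf f s p else 0)
    + (if p = 0 then 0 else of_nat (p - 1 + s choose s) * cf f r (p - 1 + s))
    + \<alpha> * (if s = 0 then 0 else of_nat (p + (s - 1) choose (s - 1)) * cf f r (p + (s - 1)))"

lemma tri_dvir:
  "tri (dvir \<alpha> \<alpha>' f) (\<lambda>p s r. half_coeff \<alpha> \<alpha>' f p s r - half_coeff \<alpha> \<alpha>' f p r s
    - ((if s = 0 then 0 else of_nat (s - 1 + r choose r) * cf f (s - 1 + r) p)
       - (if r = 0 then 0 else of_nat (s + (r - 1) choose (r - 1)) * cf f (s + (r - 1)) p)))"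
proof -
  note x = tri_ev_x[of f] and y = tri_ev_y[of f]
    and zx = tri_ev_zx_y[of f] and zy = tri_ev_zy_x[of f] and xy = tri_ev_xy[of f]
  note l = tri_add[OF tri_add[OF tri_add[OF tri_z[OF x] tri_x[OF x]] tri_scale[OF tri_y[OF x], of \<alpha>']]
    tri_add[OF tri_z[OF zx] tri_scale[OF tri_x[OF zx], of \<alpha>]]]
  note r = tri_add[OF tri_add[OF tri_add[OF tri_z[OF y] tri_y[OF y]] tri_scale[OF tri_x[OF y], of \<alpha>']]
    tri_add[OF tri_z[OF zy] tri_scale[OF tri_y[OF zy], of \<alpha>]]]
  show ?thesis
    by (rule tri_cong[OF tri_diff[OF tri_diff[OF l r] tri_diff[OF tri_x[OF xy] tri_y[OF xy]]]])
      (auto simp: dvir_def half_coeff_def algebra_simps)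
qed

text \<open>For \<open>s > 0\<close>, the coefficient of \<open>z\<^sup>j\<^sup>+\<^sup>1\<^sup>-\<^sup>s x\<^sup>s\<close> in \<open>(z + \<alpha> x) (z + x)\<^sup>j\<close>.\<close>

definition wt :: "complex \<Rightarrow> nat \<Rightarrow> nat \<Rightarrow> complex"
  where "wt \<alpha> j s = of_nat (j choose s) + \<alpha> * of_nat (j choose (s - 1))"

text \<open>The terms with f(z, x) have degree at most 1 in y, so only (z + \<alpha> x) f(z + x, y)
  is left. Here and below \<open>m\<close> is the total degree of the part of \<open>f\<close>
  concerned; the equation itself is then read in degree m + 1.\<close>

lemma half_coeff_wt:
  assumes "r \<noteq> 0" "r \<noteq> 1" "s \<noteq> 0" "r + s \<le> m + 1"
  shows "half_coeff \<alpha> \<alpha>' f (m + 1 - r - s) s r = wt \<alpha> (m - r) s * cf f r (m - r)"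
proof (cases "m + 1 - r - s")
  case 0
  then have "m - r = s - 1" using assms by auto
  then show ?thesis using assms 0 by (simp add: half_coeff_def wt_def binomial_eq_0)
next
  case (Suc p)
  obtain t where t: "s = Suc t" using assms not0_implies_Suc by blast
  have "m - r = Suc (p + t)" using Suc t by simp
  then show ?thesis using assms(1,2) unfolding Suc unfolding t by (simp add: half_coeff_def wt_def algebra_simps)
qed

lemma half_coeff_wt1:
  assumes "s \<noteq> 0" "s \<le> m"
  shows "half_coeff \<alpha> \<alpha>' f (m - s) s 1 = \<alpha>' * cf f s (m - s) + wt \<alpha> (m - 1) s * cf f 1 (m - 1)"
proof (cases "m - s")
  case 0
  then have "m = s" using assms by auto
  then show ?thesis using assms 0 by (simp add: half_coeff_def wt_def binomial_eq_0)
next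
  case (Suc p)
  obtain t where t: "s = Suc t" using assms not0_implies_Suc by blast
  have "m - 1 = Suc (p + t)" using Suc t by simp
  then show ?thesis unfolding Suc unfolding t by (simp add: half_coeff_def wt_def algebra_simps)
qed

context
  fixes \<alpha> \<alpha>' :: complex and f :: bipoly and H q
  assumes dvir: "\<And>z x y. dvir \<alpha> \<alpha>' f z x y = H z x y" and triH: "tri H q"
begin

lemma dvir_coeff:
  "half_coeff \<alpha> \<alpha>' f p s r - half_coeff \<alpha> \<alpha>' f p r s
    - ((if s = 0 then 0 else of_nat (s - 1 + r choose r) * cf f (s - 1 + r) p)
       - (if r = 0 then 0 else of_nat (s + (r - 1) choose (r - 1)) * cf f (s + (r - 1)) p)) = q p s r"
  by (rule tri_unique[OF tri_dvir]) (rule tri_cong[OF triH dvir refl])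

lemma rel_rs:
  assumes "2 \<le> r" "2 \<le> s" "r + s \<le> m + 1"
  shows "wt \<alpha> (m - r) s * cf f r (m - r) - wt \<alpha> (m - s) r * cf f s (m - s)
    - (of_nat (r + s - 1 choose r) - of_nat (r + s - 1 choose s)) * cf f (r + s - 1) (m + 1 - r - s)
    = q (m + 1 - r - s) s r"
proof -
  have "s + (r - 1) choose (r - 1) = s + (r - 1) choose s"
    using binomial_symmetric[of "r - 1" "s + (r - 1)"] by simp
  moreover have "s - 1 + r = r + s - 1" "s + (r - 1) = r + s - 1" "m + 1 - r - s = m + 1 - s - r"
    using assms by auto
  ultimately show ?thesis
    using dvir_coeff[of "m + 1 - r - s" s r] half_coeff_wt[of r s m \<alpha> \<alpha>' f] half_coeff_wt[of s r m \<alpha> \<alpha>' f] assms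
    by (simp add: algebra_simps)
qed

text \<open>The factor in front of \<open>cf f s (m - s)\<close> vanishes exactly in the critical
  degree m = \<alpha>' - \<alpha> + 1. In any other degree, with zero source, the coefficient linear
  in \<lambda> determines the higher ones.\<close>

lemma rel_1s:
  assumes "2 \<le> s" "s \<le> m"
  shows "(\<alpha>' - \<alpha> + 1 - of_nat m) * cf f s (m - s) + wt \<alpha> (m - 1) s * cf f 1 (m - 1) = q (m - s) s 1"
proof -
  have "half_coeff \<alpha> \<alpha>' f (m - s) 1 s = wt \<alpha> (m - s) 1 * cf f s (m - s)"
    using half_coeff_wt[of s 1 m \<alpha> \<alpha>' f] assms by simp
  then show ?thesis
    using dvir_coeff[of "m - s" s 1] half_coeff_wt1[of s m \<alpha> \<alpha>' f] assms
    by (simp add: wt_def of_nat_diff algebra_simps)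
qed

lemma rel_0s:
  assumes "2 \<le> s" "s \<le> m + 1"
  shows "wt \<alpha> m s * cf f 0 m = q (m + 1 - s) s 0"
proof (cases "m + 1 - s")
  case 0
  then have "m = s - 1" using assms by auto
  then show ?thesis using dvir_coeff[of 0 s 0] assms 0
    by (simp add: half_coeff_def wt_def binomial_eq_0)
next
  case (Suc p)
  define t where "t = s - 2"
  have t: "s = Suc (Suc t)" using assms(1) unfolding t_def by arith
  have "m = Suc (Suc (p + t))" using Suc t by simp
  then show ?thesis using dvir_coeff[of "Suc p" s 0] unfolding Suc unfolding t
    by (simp add: half_coeff_def wt_def algebra_simps)
qed

lemma rel_01: "(of_nat m + \<alpha> - \<alpha>') * cf f 0 m = q m 1 0"
  using dvir_coeff[of m 1 0] by (cases m) (simp_all add: half_coeff_def algebra_simps)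

end

section \<open>Coboundaries, and cocycles outside the critical degree\<close>

text \<open>The change of \<open>f\<close> when \<open>\<phi> v\<close> is added to the lift of \<open>v'\<close>.\<close>

definition cob :: "complex \<Rightarrow> complex \<Rightarrow> complex poly \<Rightarrow> bipoly"
  where "cob \<alpha> \<alpha>' \<phi> = (vx + cst \<alpha> * vl) * pcompose (map_poly (\<lambda>k. [:k:]) \<phi>) (vx + vl)
    - (vx + cst \<alpha>' * vl) * [:\<phi>:]"

lemma poly_poly_map_const: "poly (poly (map_poly (\<lambda>k. [:k:]) \<phi>) w) z = poly \<phi> (poly w z)"
  by (induction \<phi>) (simp_all add: map_poly_pCons)

lemma ev_cob:
  "ev (cob \<alpha> \<alpha>' \<phi>) z x = (z + \<alpha> * x) * poly \<phi> (z + x) - (z + \<alpha>' * x) * poly \<phi> z"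
proof -
  have "ev (pcompose (map_poly (\<lambda>k. [:k:]) \<phi>) (vx + vl)) z x = poly \<phi> (z + x)"
    by (simp add: ev_def poly_pcompose poly_poly_map_const add.commute)
  moreover have "ev [:\<phi>:] z x = poly \<phi> z" by (simp add: ev_def)
  ultimately show ?thesis unfolding cob_def ev_simps by simp
qed

lemma cob_add: "cob \<alpha> \<alpha>' (\<phi> + \<psi>) = cob \<alpha> \<alpha>' \<phi> + cob \<alpha> \<alpha>' \<psi>"
  by (rule ev_eqI) (simp add: ev_cob ev_simps algebra_simps)

lemma cob_0: "cob \<alpha> \<alpha>' 0 = 0"
  by (rule ev_eqI) (simp add: ev_cob ev_simps)

lemma dvir_cob: "dvir \<alpha> \<alpha>' (cob \<alpha> \<alpha>' \<phi>) z x y = 0"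
  by (simp add: dvir_def ev_cob algebra_simps)

lemma cf_cob:
  "cf (cob \<alpha> \<alpha>' \<phi>) s p =
    (if p = 0 then 0 else of_nat (p - 1 + s choose s) * coeff \<phi> (p - 1 + s))
    + \<alpha> * (if s = 0 then 0 else of_nat (p + (s - 1) choose (s - 1)) * coeff \<phi> (p + (s - 1)))
    - (if p = 0 then 0 else if s = 0 then coeff \<phi> (p - 1) else 0)
    - \<alpha>' * (if s = 0 then 0 else if s = 1 then coeff \<phi> p else 0)"
proof -
  note zx = tri_poly_zx[of \<phi>] and z = tri_poly_z[of \<phi>]
  note t = tri_diff[OF tri_diff[OF tri_add[OF tri_z[OF zx] tri_scale[OF tri_x[OF zx], of \<alpha>]] tri_z[OF z]]
    tri_scale[OF tri_x[OF z], of \<alpha>']]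
  show ?thesis
    using tri_unique[OF tri_ev_x[of "cob \<alpha> \<alpha>' \<phi>"] tri_cong[OF t _ refl], where p = p and s = s and r = 0]
    by (simp add: ev_cob mult.assoc distrib_right)
qed

text \<open>In each degree a coboundary has one free parameter: it shifts all coefficients with
  \<open>s\<close> \<ge> 2 by a common multiple of the weights.\<close>

lemma cf_cob_wt:
  assumes "2 \<le> s" "s \<le> m"
  shows "cf (cob \<alpha> \<alpha>' \<phi>) s (m - s) = wt \<alpha> (m - 1) s * coeff \<phi> (m - 1)"
proof (cases "m - s")
  case 0
  then have "m = s" using assms by auto
  then show ?thesis using assms 0 by (simp add: cf_cob wt_def binomial_eq_0)
next
  case (Suc p)
  define t where "t = s - 2"
  have t: "s = Suc (Suc t)" using assms(1) unfolding t_def by arith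
  have "m - 1 = Suc (Suc (p + t))" using Suc t by simp
  then show ?thesis unfolding Suc unfolding t by (simp add: cf_cob wt_def algebra_simps)
qed

lemma cf_cob_0: "cf (cob \<alpha> \<alpha>' \<phi>) 0 p = 0"
  by (simp add: cf_cob)

lemma cf_cob_1: "cf (cob \<alpha> \<alpha>' \<phi>) 1 p = (of_nat p + \<alpha> - \<alpha>') * coeff \<phi> p"
  by (cases p) (simp_all add: cf_cob algebra_simps)

lemma wt_top: "wt \<alpha> s (Suc s) = \<alpha>"
  by (simp add: wt_def binomial_eq_0)

text \<open>
  The coefficients of \<open>f\<close> of total degree other than \<open>\<alpha>' - \<alpha> + 1\<close> are those of a coboundary
  because the linear part of the cocycle condition in one of the variables is an Euler
  operator.
\<close>

lemma dvir_offdegree: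
  assumes d: "\<And>z x y. dvir \<alpha> \<alpha>' f z x y = 0" and "\<alpha> \<noteq> 0"
  obtains \<phi> where
    "\<And>s p. of_nat (s + p) \<noteq> \<alpha>' - \<alpha> + 1 \<Longrightarrow> (s = 0 \<Longrightarrow> p = 0 \<Longrightarrow> \<alpha> \<noteq> \<alpha>') \<Longrightarrow>
      cf f s p = cf (cob \<alpha> \<alpha>' \<phi>) s p"
    "\<And>s p. of_nat (s + p) = \<alpha>' - \<alpha> + 1 \<Longrightarrow> cf (cob \<alpha> \<alpha>' \<phi>) s p = 0"
proof -
  define N where "N = degree (coeff f 1)"
  \<comment> \<open>This inverts \<open>cf_cob_1\<close>. Where the denominator is zero the quotient
    is 0 by convention; thus \<phi> has no term of degree \<alpha>' - \<alpha>, and its coboundary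
    none of the critical degree.\<close>
  define \<phi> where "\<phi> = (\<Sum>j\<le>N. monom (cf f 1 j / (of_nat j - (\<alpha>' - \<alpha>))) j)"
  have \<phi>: "coeff \<phi> j = cf f 1 j / (of_nat j - (\<alpha>' - \<alpha>))" for j
    by (cases "j \<le> N") (auto simp: \<phi>_def coeff_sum coeff_monom N_def coeff_eq_0)
  show ?thesis
  proof (rule that[of \<phi>])
    fix s p :: nat
    assume ne: "of_nat (s + p) \<noteq> \<alpha>' - \<alpha> + 1" and ne0: "s = 0 \<Longrightarrow> p = 0 \<Longrightarrow> \<alpha> \<noteq> \<alpha>'"
    consider "s = 0" "p = 0" | "s = 0" "p \<noteq> 0" | "s = 1" | "2 \<le> s" by linarith
    then show "cf f s p = cf (cob \<alpha> \<alpha>' \<phi>) s p"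
    proof cases
      case 1
      then show ?thesis using rel_01[OF d tri_0, of 0] ne0 by (simp add: cf_cob_0)
    next
      case 2
      then show ?thesis using rel_0s[OF d tri_0, of "Suc p" p] \<open>\<alpha> \<noteq> 0\<close> by (simp add: cf_cob_0 wt_top)
    next
      case 3
      then have "of_nat p + \<alpha> - \<alpha>' \<noteq> 0" using ne by (auto simp: algebra_simps)
      with 3 show ?thesis by (simp add: cf_cob_1[simplified] \<phi> field_simps)
    next
      case 4
      define m where "m = s + p"
      have m: "p = m - s" "s \<le> m" "m = Suc (m - 1)" using 4 by (auto simp: m_def)
      have *: "of_nat (m - 1) - (\<alpha>' - \<alpha>) \<noteq> 0"
        using ne m(3) unfolding m_def[symmetric] by (metis add_diff_cancel_right' add.commute eq_iff_diff_eq_0 of_nat_Suc)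
      have "(\<alpha>' - \<alpha> + 1 - of_nat m) * cf f s (m - s) + wt \<alpha> (m - 1) s * cf f 1 (m - 1) = 0"
        using rel_1s[OF d tri_0 4 m(2)] .
      moreover have "of_nat m = of_nat (m - 1) + (1::complex)" using m(3) by (metis add.commute of_nat_Suc)
      ultimately have "wt \<alpha> (m - 1) s * cf f 1 (m - 1) = (of_nat (m - 1) - (\<alpha>' - \<alpha>)) * cf f s (m - s)"
        by (simp add: algebra_simps)
      then show ?thesis
        unfolding m(1) cf_cob_wt[OF 4 m(2)] \<phi> using * by (simp add: field_simps)
    qed
  next
    fix s p :: nat
    assume "of_nat (s + p) = \<alpha>' - \<alpha> + 1"
    then have e: "of_nat s + of_nat p - 1 = \<alpha>' - \<alpha>" by simp
    have 0: "coeff \<phi> j = 0" if "of_nat j = \<alpha>' - \<alpha>" for j using that by (simp add: \<phi>)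
    consider "s = 0" | "s = 1" | "2 \<le> s" by linarith
    then show "cf (cob \<alpha> \<alpha>' \<phi>) s p = 0"
    proof cases
      case 3
      have "coeff \<phi> (s + p - 1) = 0" using e 3 by (intro 0) (simp add: of_nat_diff)
      then show ?thesis using cf_cob_wt[OF 3, of "s + p" \<alpha> \<alpha>' \<phi>] by simp
    qed (use e 0[of p] in \<open>auto simp: cf_cob_0 cf_cob_1[simplified]\<close>)
  qed
qed

text \<open>In the critical degree n + 1 the coefficients at \<lambda>^0 and \<lambda>^1 vanish
  because the top weight is \<alpha> \<noteq> 0. From \<lambda>^4 on, the relation for the pair (2,
  i - 1) determines the coefficient at \<lambda>^i, with the factor i (i - 3) / 2. This leaves
  \<lambda>^2 and \<lambda>^3 as the free coefficients.\<close>

lemma dvir_degree_zero: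
  assumes d: "\<And>z x y. dvir \<alpha> (\<alpha> + of_nat n) f z x y = 0" and "\<alpha> \<noteq> 0" and "n \<noteq> 0"
    and 2: "cf f 2 (n - 1) = 0" and 3: "2 \<le> n \<Longrightarrow> cf f 3 (n - 2) = 0"
  shows "i \<le> n + 1 \<Longrightarrow> cf f i (n + 1 - i) = 0"
proof (induction i rule: less_induct)
  case (less i)
  consider "i = 0" | "i = 1" | "i = 2" | "i = 3" | "4 \<le> i" by linarith
  then show ?case
  proof cases
    case 1
    then show ?thesis using rel_0s[OF d tri_0, of "n + 2" "n + 1"] wt_top[of \<alpha> "n + 1"] \<open>\<alpha> \<noteq> 0\<close> by simp
  next
    case c: 2
    then show ?thesis using rel_1s[OF d tri_0, of "n + 1" "n + 1"] wt_top[of \<alpha> n] \<open>\<alpha> \<noteq> 0\<close> \<open>n \<noteq> 0\<close> by simp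
  next
    case c: 3
    then show ?thesis using 2 by (simp add: numeral_2_eq_2)
  next
    case c: 4
    then show ?thesis using 3 less.prems by (simp add: numeral_3_eq_3 numeral_2_eq_2)
  next
    case 5
    then obtain j where i: "i = Suc j" "3 \<le> j" by (metis Suc_le_D Suc_le_mono eval_nat_numeral(2) semiring_norm(26) semiring_norm(27) semiring_norm(28))
    have "cf f j (n + 1 - j) = 0" using less.IH[of j] less.prems i by simp
    moreover have "cf f 2 (n + 1 - 2) = 0" using 2 by (simp add: numeral_2_eq_2)
    ultimately have "(of_nat (Suc j choose 2) - of_nat (Suc j choose j)) * cf f i (n + 1 - i) = (0::complex)"
      using rel_rs[OF d tri_0, of 2 j "n + 1"] less.prems i by simp
    \<comment> \<open>For j = 2 the two binomial coefficients agree; this is why the coefficient at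
      \<lambda>^3 is not determined.\<close>
    moreover have "Suc j choose 2 \<noteq> Suc j choose j"
    proof -
      have "Suc j choose j = Suc j" by (simp add: binomial_Suc_n)
      moreover have "Suc j choose 2 > Suc j"
        using \<open>3 \<le> j\<close> by (induction j rule: dec_induct) (simp_all add: numeral_2_eq_2 numeral_3_eq_3)
      ultimately show ?thesis by simp
    qed
    ultimately show ?thesis
      by (metis eq_iff_diff_eq_0 mult_eq_0_iff of_nat_eq_iff)
  qed
qed

lemma dvir_cob_if:
  assumes d: "\<And>z x y. dvir \<alpha> (\<alpha> + of_nat n) f z x y = 0" and "\<alpha> \<noteq> 0" and "n \<noteq> 0"
    and "cf f 2 (n - 1) = 0" and "2 \<le> n \<Longrightarrow> cf f 3 (n - 2) = 0"
  obtains \<phi> where "f = cob \<alpha> (\<alpha> + of_nat n) \<phi>"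
proof -
  note z = dvir_degree_zero[OF assms]
  obtain \<phi> where \<phi>:
    "\<And>s p. of_nat (s + p) \<noteq> of_nat n + (1::complex) \<Longrightarrow> (s = 0 \<Longrightarrow> p = 0 \<Longrightarrow> n \<noteq> 0) \<Longrightarrow>
      cf f s p = cf (cob \<alpha> (\<alpha> + of_nat n) \<phi>) s p"
    "\<And>s p. of_nat (s + p) = of_nat n + (1::complex) \<Longrightarrow> cf (cob \<alpha> (\<alpha> + of_nat n) \<phi>) s p = 0"
    using dvir_offdegree[OF d \<open>\<alpha> \<noteq> 0\<close>] by auto
  have "cf f s p = cf (cob \<alpha> (\<alpha> + of_nat n) \<phi>) s p" for s p
  proof (cases "s + p = n + 1")
    case True
    then have "of_nat (s + p) = of_nat n + (1::complex)" by simp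
    moreover have "p = n + 1 - s" "s \<le> n + 1" using True by auto
    ultimately show ?thesis using z[of s] \<phi>(2)[of s p] by simp
  next
    case False
    then have "of_nat (s + p) \<noteq> of_nat n + (1::complex)"
      by (metis of_nat_1 of_nat_add of_nat_eq_iff)
    then show ?thesis using \<phi>(1)[of s p] \<open>n \<noteq> 0\<close> by blast
  qed
  then have "f = cob \<alpha> (\<alpha> + of_nat n) \<phi>" by (intro poly_eqI) auto
  then show ?thesis by (rule that)
qed

text \<open>A critical degree exists here only if \<alpha>' = \<alpha> - 1, and then it is 0; the
  constant term is killed by \<open>rel_01\<close>.\<close>

lemma dvir_non_nat:
  assumes d: "\<And>z x y. dvir \<alpha> \<alpha>' f z x y = 0" and "\<alpha> \<noteq> 0" and "\<alpha>' - \<alpha> \<notin> \<nat>"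
  obtains \<phi> where "f = cob \<alpha> \<alpha>' \<phi>"
proof -
  obtain \<phi> where \<phi>:
    "\<And>s p. of_nat (s + p) \<noteq> \<alpha>' - \<alpha> + 1 \<Longrightarrow> (s = 0 \<Longrightarrow> p = 0 \<Longrightarrow> \<alpha> \<noteq> \<alpha>') \<Longrightarrow>
      cf f s p = cf (cob \<alpha> \<alpha>' \<phi>) s p"
    "\<And>s p. of_nat (s + p) = \<alpha>' - \<alpha> + 1 \<Longrightarrow> cf (cob \<alpha> \<alpha>' \<phi>) s p = 0"
    using dvir_offdegree[OF d \<open>\<alpha> \<noteq> 0\<close>] by blast
  have "\<alpha> \<noteq> \<alpha>'" using assms(3) by auto
  have "cf f s p = cf (cob \<alpha> \<alpha>' \<phi>) s p" for s p
  proof (cases "of_nat (s + p) = \<alpha>' - \<alpha> + 1")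
    case True
    have "s + p = 0"
    proof (rule ccontr)
      assume "s + p \<noteq> 0"
      then have "of_nat (s + p - 1) = of_nat (s + p) - (1::complex)" by (subst of_nat_diff) auto
      then have "\<alpha>' - \<alpha> = of_nat (s + p - 1)" using True by simp
      then show False using assms(3) by (metis of_nat_in_Nats)
    qed
    moreover have "cf f 0 0 = 0" using rel_01[OF d tri_0, of 0] \<open>\<alpha> \<noteq> \<alpha>'\<close> by simp
    ultimately show ?thesis using \<phi>(2)[OF True] by simp
  qed (use \<phi>(1)[of s p] \<open>\<alpha> \<noteq> \<alpha>'\<close> in blast)
  then have "f = cob \<alpha> \<alpha>' \<phi>" by (intro poly_eqI) auto
  then show ?thesis by (rule that)
qed

text \<open>The critical degree is 1, and in degree 0 the relation \<open>rel_01\<close> degenerates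
  as well. So one coefficient survives in each of the two degrees.\<close>

lemma dvir_equal:
  assumes d: "\<And>z x y. dvir \<alpha> \<alpha> f z x y = 0" and "\<alpha> \<noteq> 0"
  obtains s0 s1 \<phi> where "f = cst s0 + cst s1 * vl + cob \<alpha> \<alpha> \<phi>"
proof -
  obtain \<phi> where \<phi>:
    "\<And>s p. of_nat (s + p) \<noteq> (1::complex) \<Longrightarrow> (s = 0 \<Longrightarrow> p = 0 \<Longrightarrow> False) \<Longrightarrow>
      cf f s p = cf (cob \<alpha> \<alpha> \<phi>) s p"
    "\<And>s p. of_nat (s + p) = (1::complex) \<Longrightarrow> cf (cob \<alpha> \<alpha> \<phi>) s p = 0"
    using dvir_offdegree[OF d \<open>\<alpha> \<noteq> 0\<close>] by auto
  have a0: "cf f 0 1 = 0" using rel_0s[OF d tri_0, of 2 1] \<open>\<alpha> \<noteq> 0\<close> wt_top[of \<alpha> 1] by (simp add: numeral_2_eq_2)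
  have "cf f s p = cf (cst (cf f 0 0) + cst (cf f 1 0) * vl + cob \<alpha> \<alpha> \<phi>) s p" for s p
  proof -
    consider "s = 0" "p = 0" | "s = 0" "p = 1" | "s = 1" "p = 0" | "s + p \<ge> 2" by linarith
    then show ?thesis
    proof cases
      case 4
      then have "of_nat (s + p) \<noteq> (1::complex)" by (metis Suc_n_not_le_n numeral_2_eq_2 of_nat_eq_1_iff One_nat_def)
      then show ?thesis using \<phi>(1)[of s p] 4 by (cases s; cases p; cases "s - 1") (auto simp: coeff_pCons split: nat.splits)
    qed (use a0 \<phi>(2)[of 0 1] \<phi>(2)[of 1 0] in \<open>auto simp: cf_cob_0\<close>)
  qed
  then have "f = cst (cf f 0 0) + cst (cf f 1 0) * vl + cob \<alpha> \<alpha> \<phi>" by (intro poly_eqI) blast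
  then show ?thesis by (rule that)
qed

section \<open>Obstructions in the critical degree\<close>

lemma of_nat_choose:
  "of_nat (k choose 2) = (of_nat k * (of_nat k - 1) / 2 :: complex)"
  "of_nat (k choose 3) = (of_nat k * (of_nat k - 1) * (of_nat k - 2) / 6 :: complex)"
  "of_nat (k choose 4) = (of_nat k * (of_nat k - 1) * (of_nat k - 2) * (of_nat k - 3) / 24 :: complex)"
  "of_nat (k choose 5) = (of_nat k * (of_nat k - 1) * (of_nat k - 2) * (of_nat k - 3) * (of_nat k - 4) / 120 :: complex)"
  "of_nat (k choose 6) = (of_nat k * (of_nat k - 1) * (of_nat k - 2) * (of_nat k - 3) * (of_nat k - 4) * (of_nat k - 5) / 720 :: complex)"
  by (simp_all add: binomial_gbinomial gbinomial_prod_rev eval_nat_numeral prod.atLeast0_lessThan_Suc)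

lemma wt_numeral:
  "wt \<alpha> j 2 = of_nat j * (of_nat j - 1) / 2 + \<alpha> * of_nat j"
  "wt \<alpha> j 3 = of_nat j * (of_nat j - 1) * (of_nat j - 2) / 6 + \<alpha> * (of_nat j * (of_nat j - 1) / 2)"
  "wt \<alpha> j 4 = of_nat j * (of_nat j - 1) * (of_nat j - 2) * (of_nat j - 3) / 24
    + \<alpha> * (of_nat j * (of_nat j - 1) * (of_nat j - 2) / 6)"
  "wt \<alpha> j 5 = of_nat j * (of_nat j - 1) * (of_nat j - 2) * (of_nat j - 3) * (of_nat j - 4) / 120
    + \<alpha> * (of_nat j * (of_nat j - 1) * (of_nat j - 2) * (of_nat j - 3) / 24)"
  "wt \<alpha> j 6 = of_nat j * (of_nat j - 1) * (of_nat j - 2) * (of_nat j - 3) * (of_nat j - 4) * (of_nat j - 5) / 720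
    + \<alpha> * (of_nat j * (of_nat j - 1) * (of_nat j - 2) * (of_nat j - 3) * (of_nat j - 4) / 120)"
  by (simp_all add: wt_def of_nat_choose)

lemma choose_numeral:
  "4 choose 2 = (6::nat)" "4 choose 3 = (4::nat)" "5 choose 2 = (10::nat)" "5 choose 4 = (5::nat)"
  "6 choose 2 = (15::nat)" "6 choose 5 = (6::nat)" "6 choose 3 = (20::nat)" "6 choose 4 = (15::nat)"
  "8 choose 3 = (56::nat)" "8 choose 6 = (28::nat)" "7 choose 2 = (21::nat)" "7 choose 6 = (7::nat)"
  "8 choose 2 = (28::nat)" "8 choose 7 = (8::nat)" "8 choose 4 = (70::nat)" "8 choose 5 = (56::nat)"
  by (simp_all add: eval_nat_numeral)

text \<open>Completing the square, 4 \<open>vir_obstr n \<alpha>\<close> = (2 \<alpha> + n - 1)^2 -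
  (3 n + 1). For n = 5, 6, 7, 8 the number 3 n + 1 is 16, 19, 22, 25: the zeros are rational for 5
  and 8, and involve the square roots of 19 and 22 for 6 and 7.\<close>

definition vir_obstr :: "nat \<Rightarrow> complex \<Rightarrow> complex"
  where "vir_obstr n \<alpha> = \<alpha> ^ 2 + (of_nat n - 1) * \<alpha> + of_nat n * (of_nat n - 5) / 4"

text \<open>
  The coefficient of degree \<open>6\<close> in the second variable is determined in two ways by those
  of degree \<open>2\<close> and \<open>3\<close>; \<open>vir_obstr\<close> is the resulting obstruction.
\<close>

lemma dvir_level5:
  assumes d: "\<And>z x y. dvir \<alpha> \<alpha>' f z x y = H z x y" and q: "tri H q" and n: "5 \<le> n"
    and "q (n - 3) 3 2 = 0" "q (n - 4) 4 2 = 0" "q (n - 5) 5 2 = 0"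
  shows "- (of_nat n - 2) * (of_nat n - 3) * (of_nat n - 4) * vir_obstr n \<alpha> *
    (wt \<alpha> n 3 * cf f 2 (n - 1) - wt \<alpha> n 2 * cf f 3 (n - 2)) = 18 * of_nat n * q (n - 5) 4 3"
proof -
  define N :: complex where "N = of_nat n"
  define a where "a i = cf f i (n + 1 - i)" for i
  have e: "wt \<alpha> (n + 1 - r) s * a r - wt \<alpha> (n + 1 - s) r * a s
      - (of_nat (r + s - 1 choose r) - of_nat (r + s - 1 choose s)) * a (r + s - 1)
      = q (n + 2 - r - s) s r" if "2 \<le> r" "2 \<le> s" "r + s \<le> n + 2" for r s
    using rel_rs[OF d q, of r s "n + 1"] that by (simp add: a_def)
  have N: "of_nat (n + 1 - r) = N + 1 - of_nat r" if "r \<le> 6" for r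
    using that n by (simp add: N_def of_nat_diff)
  note w = wt_numeral N choose_numeral
  \<comment> \<open>By the hypotheses on \<open>q\<close> the source does not enter the pairs (2,
    3), (2, 4), (2, 5), which give \<open>a 4\<close>, \<open>a 5\<close>, \<open>a 6\<close> in
    turn. The pair (3, 4) gives \<open>a 6\<close> a second time and is the one place where the
    source may enter.\<close>
  have e4: "2 * a 4 = wt \<alpha> (n + 1 - 2) 3 * a 2 - wt \<alpha> (n + 1 - 3) 2 * a 3"
    using e[of 2 3] n assms(4) by (simp add: choose_numeral algebra_simps)
  have e5: "5 * a 5 = wt \<alpha> (n + 1 - 2) 4 * a 2 - wt \<alpha> (n + 1 - 4) 2 * a 4"
    using e[of 2 4] n assms(5) by (simp add: choose_numeral algebra_simps)
  have e6: "9 * a 6 = wt \<alpha> (n + 1 - 2) 5 * a 2 - wt \<alpha> (n + 1 - 5) 2 * a 5"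
    using e[of 2 5] n assms(6) by (simp add: choose_numeral algebra_simps)
  have e34: "q (n - 5) 4 3 = wt \<alpha> (n + 1 - 3) 4 * a 3 - wt \<alpha> (n + 1 - 4) 3 * a 4 - 5 * a 6"
    using e[of 3 4] n by (simp add: choose_numeral algebra_simps)
  have a4: "a 4 = (wt \<alpha> (n + 1 - 2) 3 * a 2 - wt \<alpha> (n + 1 - 3) 2 * a 3) / 2" unfolding e4[symmetric] by simp
  have a5: "a 5 = (wt \<alpha> (n + 1 - 2) 4 * a 2 - wt \<alpha> (n + 1 - 4) 2 * a 4) / 5" unfolding e5[symmetric] by simp
  have a6: "a 6 = (wt \<alpha> (n + 1 - 2) 5 * a 2 - wt \<alpha> (n + 1 - 5) 2 * a 5) / 9" unfolding e6[symmetric] by simp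
  have a23: "cf f 2 (n - 1) = a 2" "cf f 3 (n - 2) = a 3" "wt \<alpha> n s = wt \<alpha> (n + 1 - 1) s" for s
    using n by (auto simp: a_def numeral_2_eq_2 numeral_3_eq_3)
  define x2 x3 where "x2 = a 2" and "x3 = a 3"
  show ?thesis
    unfolding a23 e34 a6 a5 a4 vir_obstr_def x2_def[symmetric] x3_def[symmetric]
    apply (simp only: N_def[symmetric] w N[of 1] N[of 2] N[of 3] N[of 4] N[of 5])
    apply (simp only: of_nat_numeral of_nat_1)
    by (simp add: field_simps eval_nat_numeral)
qed

text \<open>On a zero of \<open>vir_obstr\<close> the two determinations of the coefficient at
  \<lambda>^6 agree. The next test used is at \<lambda>^8, reached by the pairs (2, 7) and (3, 6);
  both exist from n = 7 on.\<close>

lemma dvir_level8: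
  assumes d: "\<And>z x y. dvir \<alpha> \<alpha>' f z x y = 0" and n: "7 \<le> n"
    and vir_obstr: "vir_obstr n \<alpha> = 0" and "cf f 2 (n - 1) = 0"
  shows "cf f 3 (n - 2) = 0"
proof -
  define N :: complex where "N = of_nat n"
  define a where "a i = cf f i (n + 1 - i)" for i
  have e: "wt \<alpha> (n + 1 - r) s * a r - wt \<alpha> (n + 1 - s) r * a s
      - (of_nat (r + s - 1 choose r) - of_nat (r + s - 1 choose s)) * a (r + s - 1)
      = 0" if "2 \<le> r" "2 \<le> s" "r + s \<le> n + 2" for r s
    using rel_rs[OF d tri_0, of r s "n + 1"] that by (simp add: a_def)
  have N: "of_nat (n + 1 - r) = N + 1 - of_nat r" if "r \<le> 7" for r
    using that n by (simp add: N_def of_nat_diff)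
  have a2: "a 2 = 0" using assms(4) by (simp add: a_def numeral_2_eq_2)
  have e4: "2 * a 4 = - wt \<alpha> (n + 1 - 3) 2 * a 3"
    using e[of 2 3] n a2 by (simp add: choose_numeral algebra_simps)
  have e5: "5 * a 5 = - wt \<alpha> (n + 1 - 4) 2 * a 4"
    using e[of 2 4] n a2 by (simp add: choose_numeral algebra_simps)
  have e6: "9 * a 6 = - wt \<alpha> (n + 1 - 5) 2 * a 5"
    using e[of 2 5] n a2 by (simp add: choose_numeral algebra_simps)
  have e7: "14 * a 7 = - wt \<alpha> (n + 1 - 6) 2 * a 6"
    using e[of 2 6] n a2 by (simp add: choose_numeral algebra_simps)
  have e8: "20 * a 8 = - wt \<alpha> (n + 1 - 7) 2 * a 7"
    using e[of 2 7] n a2 by (simp add: choose_numeral algebra_simps)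
  have a4: "a 4 = - wt \<alpha> (n + 1 - 3) 2 * a 3 / 2" unfolding e4[symmetric] by simp
  have a5: "a 5 = - wt \<alpha> (n + 1 - 4) 2 * a 4 / 5" unfolding e5[symmetric] by simp
  have a6: "a 6 = - wt \<alpha> (n + 1 - 5) 2 * a 5 / 9" unfolding e6[symmetric] by simp
  have a7: "a 7 = - wt \<alpha> (n + 1 - 6) 2 * a 6 / 14" unfolding e7[symmetric] by simp
  have a8: "a 8 = - wt \<alpha> (n + 1 - 7) 2 * a 7 / 20" unfolding e8[symmetric] by simp
  have e36: "wt \<alpha> (n + 1 - 3) 6 * a 3 - wt \<alpha> (n + 1 - 6) 3 * a 6 - 28 * a 8 = 0"
    using e[of 3 6] n by (simp add: choose_numeral algebra_simps)
  \<comment> \<open>The condition \<open>vir_obstr n \<alpha> = 0\<close> reads v^2 = 3 N + 1, a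
    curve on which N and \<alpha> are polynomials in v. After substitution the identity below is one
    between polynomials in v and the coefficient \<open>x3\<close>; moreover v \<noteq> 0, as 3 N +
    1 \<noteq> 0.\<close>
  define v where "v = 2 * \<alpha> + N - 1"
  have N_v: "N = (v ^ 2 - 1) / 3" and al: "\<alpha> = (v + 1 - N) / 2"
    using vir_obstr by (simp_all add: vir_obstr_def v_def N_def power2_eq_square field_simps)
  define x3 where "x3 = a 3"
  have "N * (N - 1) * (N - 2) * (N - 3) * (N - 4) * (N - 5) * (N - 6) * v * a 3 =
    - 28800 * (wt \<alpha> (n + 1 - 3) 6 * a 3 - wt \<alpha> (n + 1 - 6) 3 * a 6 - 28 * a 8)"
    unfolding a8 a7 a6 a5 a4 x3_def[symmetric]
    apply (simp only: wt_numeral N[of 3] N[of 4] N[of 5] N[of 6] N[of 7])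
    apply (simp only: of_nat_numeral al N_v)
    by (simp add: field_simps eval_nat_numeral)
  then have "N * (N - 1) * (N - 2) * (N - 3) * (N - 4) * (N - 5) * (N - 6) * v * a 3 = 0"
    unfolding e36 by simp
  moreover have "N - of_nat j \<noteq> 0" if "j < n" for j using that by (simp add: N_def)
  from this[of 0] this[of 1] this[of 2] this[of 3] this[of 4] this[of 5] this[of 6] n
  have "N * (N - 1) * (N - 2) * (N - 3) * (N - 4) * (N - 5) * (N - 6) \<noteq> 0"
    by simp
  moreover have "v \<noteq> 0"
  proof
    assume "v = 0"
    then have "of_nat (3 * n + 1) = (0::complex)" using N_v by (simp add: N_def field_simps)
    then show False unfolding of_nat_eq_0_iff by simp
  qed
  ultimately have "a 3 = 0" by simp
  then show ?thesis by (simp add: a_def numeral_3_eq_3 numeral_2_eq_2)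
qed

lemma wt_2: "wt \<alpha> n 2 = of_nat n * (of_nat n - 1 + 2 * \<alpha>) / 2"
  by (simp add: wt_numeral field_simps)

lemma wt_3: "wt \<alpha> n 3 = of_nat n * (of_nat n - 1) * (of_nat n - 2 + 3 * \<alpha>) / 6"
  by (simp add: wt_numeral field_simps)

text \<open>The two weights are the effect of a coboundary on the two free coefficients, so the
  determinant of the hypothesis is an invariant of the class, and when it vanishes one coboundary
  accounts for both coefficients. The weights have no common zero because 3 (n - 1 + 2 \<alpha>) - 2
  (n - 2 + 3 \<alpha>) = n + 1.\<close>

lemma wt_2_3_proportional:
  assumes "2 \<le> n" "wt \<alpha> n 3 * a2 = wt \<alpha> n 2 * a3"
  obtains k where "a2 = wt \<alpha> n 2 * k" "a3 = wt \<alpha> n 3 * k"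
proof (cases "wt \<alpha> n 2 = 0")
  case False
  then show ?thesis using that[of "a2 / wt \<alpha> n 2"] assms by (simp add: field_simps)
next
  case True
  have n: "of_nat n \<noteq> (0::complex)" "of_nat n - 1 \<noteq> (0::complex)"
    using assms(1) by (auto simp: of_nat_eq_1_iff)
  have "wt \<alpha> n 3 \<noteq> 0"
  proof
    assume "wt \<alpha> n 3 = 0"
    then have "of_nat n - 2 + 3 * \<alpha> = 0" using n by (simp add: wt_3)
    moreover have "of_nat n - 1 + 2 * \<alpha> = 0" using True n by (simp add: wt_2)
    moreover have "of_nat (n + 1) = 3 * (of_nat n - 1 + 2 * \<alpha>) - 2 * (of_nat n - 2 + 3 * \<alpha>)"
      by (simp add: algebra_simps)
    ultimately have "of_nat (n + 1) = (0::complex)" by simp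
    then show False unfolding of_nat_eq_0_iff by simp
  qed
  then show ?thesis using that[of "a3 / wt \<alpha> n 3"] assms True by (simp add: field_simps)
qed

lemma cob_monom_wt:
  assumes "1 \<le> n"
  shows "cf (cob \<alpha> \<alpha>' (monom k n)) 2 (n - 1) = wt \<alpha> n 2 * k"
    and "2 \<le> n \<Longrightarrow> cf (cob \<alpha> \<alpha>' (monom k n)) 3 (n - 2) = wt \<alpha> n 3 * k"
  using cf_cob_wt[of 2 "n + 1" \<alpha> \<alpha>' "monom k n"] cf_cob_wt[of 3 "n + 1" \<alpha> \<alpha>' "monom k n"] assms
  by (simp_all add: numeral_2_eq_2 numeral_3_eq_3)

text \<open>A class is recognised by its two free coefficients. The monomial of degree n is the one
  whose coboundary lies in the critical degree, and \<open>k\<close> is its coefficient.\<close>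

lemma dvir_modulo_cob:
  assumes d: "\<And>z x y. dvir \<alpha> (\<alpha> + of_nat n) f z x y = 0" and "\<alpha> \<noteq> 0" and "1 \<le> n"
    and w: "\<And>z x y. dvir \<alpha> (\<alpha> + of_nat n) w z x y = 0"
    and 2: "cf f 2 (n - 1) = cf w 2 (n - 1) + wt \<alpha> n 2 * k"
    and 3: "2 \<le> n \<Longrightarrow> cf f 3 (n - 2) = cf w 3 (n - 2) + wt \<alpha> n 3 * k"
  obtains \<phi> where "f = w + cob \<alpha> (\<alpha> + of_nat n) \<phi>"
proof -
  let ?c = "cob \<alpha> (\<alpha> + of_nat n)"
  obtain \<phi> where "f - w - ?c (monom k n) = ?c \<phi>"
  proof (rule dvir_cob_if[of \<alpha> n "f - w - ?c (monom k n)"])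
    show "dvir \<alpha> (\<alpha> + of_nat n) (f - w - ?c (monom k n)) z x y = 0" for z x y
      by (simp add: dvir_diff d w dvir_cob)
  next
    show "cf (f - w - ?c (monom k n)) 2 (n - 1) = 0" using 2 cob_monom_wt(1)[OF \<open>1 \<le> n\<close>] by simp
    show "cf (f - w - ?c (monom k n)) 3 (n - 2) = 0" if "2 \<le> n"
      using 3 cob_monom_wt(2)[OF \<open>1 \<le> n\<close>] that by simp
  qed (use assms in auto)
  then have "f = w + ?c (\<phi> + monom k n)" by (simp add: cob_add algebra_simps)
  then show ?thesis by (rule that)
qed

text \<open>For n = 1 only the coefficient at \<lambda>^2 is present, with weight \<alpha>. Off the
  zeros of \<open>vir_obstr\<close> the test at \<lambda>^6 makes the two free coefficients
  proportional to the weights. On a zero with n \<ge> 7 the weight at \<lambda>^2 is nonzero, so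
  that coefficient can be removed first, and the test at \<lambda>^8 removes the other.\<close>

lemma dvir_trivial:
  assumes d: "\<And>z x y. dvir \<alpha> (\<alpha> + of_nat n) f z x y = 0" and "\<alpha> \<noteq> 0"
    and n: "n = 1 \<or> 7 \<le> n \<or> 5 \<le> n \<and> vir_obstr n \<alpha> \<noteq> 0"
  obtains \<phi> where "f = cob \<alpha> (\<alpha> + of_nat n) \<phi>"
proof -
  have w0: "dvir \<alpha> (\<alpha> + of_nat n) 0 z x y = 0" for z x y by (simp add: dvir_def ev_simps)
  obtain k where k: "cf f 2 (n - 1) = wt \<alpha> n 2 * k" "2 \<le> n \<Longrightarrow> cf f 3 (n - 2) = wt \<alpha> n 3 * k"
  proof -
    consider "n = 1" | "5 \<le> n" "vir_obstr n \<alpha> \<noteq> 0" | "7 \<le> n" "vir_obstr n \<alpha> = 0" using n by force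
    then show ?thesis
    proof cases
      case 1
      then show ?thesis using that[of "cf f 2 0 / \<alpha>"] \<open>\<alpha> \<noteq> 0\<close> by (simp add: wt_2)
    next
      case 2
      have "of_nat n - of_nat j \<noteq> (0::complex)" if "j < 5" for j using that 2 by simp
      from this[of 2] this[of 3] this[of 4]
      have "- (of_nat n - 2) * (of_nat n - 3) * (of_nat n - 4) * vir_obstr n \<alpha> \<noteq> (0::complex)" using 2 by simp
      then have "wt \<alpha> n 3 * cf f 2 (n - 1) = wt \<alpha> n 2 * cf f 3 (n - 2)"
        using dvir_level5[OF d tri_0 2(1)] by (simp del: mult_minus_left)
      moreover have "2 \<le> n" using 2 by simp
      ultimately show ?thesis using wt_2_3_proportional that by metis
    next
      case 3
      let ?k = "cf f 2 (n - 1) / wt \<alpha> n 2"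
      have "wt \<alpha> n 2 \<noteq> 0"
      proof
        assume "wt \<alpha> n 2 = 0"
        then have "of_nat n - 1 + 2 * \<alpha> = 0" using 3 by (simp add: wt_2)
        moreover have "\<alpha> = (of_nat n - 1 + 2 * \<alpha>) / 2 + (1 - of_nat n) / 2" by (simp add: field_simps)
        ultimately have a: "\<alpha> = (1 - of_nat n) / 2" by simp
        have "of_nat (3 * n + 1) = (0::complex)"
          using 3(2) unfolding vir_obstr_def a by (simp add: field_simps power2_eq_square)
        then show False unfolding of_nat_eq_0_iff by simp
      qed
      then have k: "cf f 2 (n - 1) = wt \<alpha> n 2 * ?k" by simp
      let ?f = "f - cob \<alpha> (\<alpha> + of_nat n) (monom ?k n)"
      have "cf ?f 3 (n - 2) = 0"
      proof (rule dvir_level8)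
        show "dvir \<alpha> (\<alpha> + of_nat n) ?f z x y = 0" for z x y by (simp add: d dvir_cob dvir_diff)
        have "cf (cob \<alpha> (\<alpha> + of_nat n) (monom ?k n)) 2 (n - 1) = cf f 2 (n - 1)"
          using 3(1) k cob_monom_wt(1)[of n] by simp
        then show "cf ?f 2 (n - 1) = 0" by simp
      qed (use 3 in auto)
      then have "cf f 3 (n - 2) = wt \<alpha> n 3 * ?k" using 3(1) by (simp add: cob_monom_wt(2) del: times_divide_eq_right)
      then show ?thesis using k that by blast
    qed
  qed
  obtain \<phi> where "f = 0 + cob \<alpha> (\<alpha> + of_nat n) \<phi>"
    by (rule dvir_modulo_cob[OF d \<open>\<alpha> \<noteq> 0\<close> _ w0, where k = k]) (use k n in auto)
  then show ?thesis using that by simp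
qed

section \<open>The explicit cocycles for \<alpha>' - \<alpha> = 2, ..., 6\<close>

lemma dvir_vir2: "dvir \<alpha> (\<alpha> + of_nat 2) (vir2 s) z x y = 0"
  unfolding dvir_def vir2_def ev_simps of_nat_numeral by (simp add: algebra_simps eval_nat_numeral)

lemma dvir_vir3: "dvir \<alpha> (\<alpha> + of_nat 3) (vir3 s) z x y = 0"
  unfolding dvir_def vir3_def ev_simps of_nat_numeral by (simp add: algebra_simps eval_nat_numeral)

lemma dvir_vir4: "dvir \<alpha> (\<alpha> + of_nat 4) (vir4 \<alpha> s) z x y = 0"
  unfolding dvir_def vir4_def ev_simps of_nat_numeral by (simp add: algebra_simps eval_nat_numeral)

lemma dvir_vir5: "dvir (- 4) (- 4 + of_nat 5) (vir5 s) z x y = 0"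
  unfolding dvir_def vir5_def ev_simps of_nat_numeral by (simp add: algebra_simps eval_nat_numeral)

text \<open>For general \<alpha> the polynomial fails to be a cocycle by a multiple of the
  obstruction; the long factor is the quotient.\<close>

lemma dvir_vir6:
  assumes "vir_obstr 6 \<alpha> = 0"
  shows "dvir \<alpha> (\<alpha> + of_nat 6) (vir6 \<alpha> s) z x y = 0"
proof -
  have "dvir \<alpha> (\<alpha> + of_nat 6) (vir6 \<alpha> s) z x y = s * vir_obstr 6 \<alpha> *
    (6 * z ^ 2 * x ^ 4 * y ^ 2 - 6 * z ^ 2 * x ^ 2 * y ^ 4 + 6 * z * x ^ 5 * y ^ 2
     + 6 * z * x ^ 4 * y ^ 3 - 6 * z * x ^ 3 * y ^ 4 - 6 * z * x ^ 2 * y ^ 5 + 3 * x ^ 6 * y ^ 2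
     + 3 * x ^ 5 * y ^ 3 - 3 * x ^ 3 * y ^ 5 - 3 * x ^ 2 * y ^ 6)"
    unfolding dvir_def vir6_def ev_simps of_nat_numeral vir_obstr_def by (simp add: field_simps eval_nat_numeral)
  then show ?thesis using assms by simp
qed

lemmas bipoly_numeral_simps = numeral_poly eval_nat_numeral

lemma cf_vir:
  "cf (vir2 s) 2 1 = 2 * s" "cf (vir2 s) 3 0 = s"
  "cf (vir3 s) 2 2 = s" "cf (vir3 s) 3 1 = s"
  "cf (vir4 \<alpha> s) 2 3 = 4 * s" "cf (vir4 \<alpha> s) 3 2 = 6 * s"
  "cf (vir5 s) 2 4 = s" "cf (vir5 s) 3 3 = 0"
  "cf (vir6 \<alpha> s) 2 5 = 0" "cf (vir6 \<alpha> s) 3 4 = s"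
  by (simp_all add: vir2_def vir3_def vir4_def vir5_def vir6_def bipoly_numeral_simps)

lemma wt_small:
  "wt \<alpha> 2 2 = 1 + 2 * \<alpha>" "wt \<alpha> 2 3 = \<alpha>" "wt \<alpha> 3 2 = 3 + 3 * \<alpha>" "wt \<alpha> 3 3 = 1 + 3 * \<alpha>"
  "wt \<alpha> 4 2 = 6 + 4 * \<alpha>" "wt \<alpha> 4 3 = 4 + 6 * \<alpha>" "wt \<alpha> 5 2 = 10 + 5 * \<alpha>" "wt \<alpha> 5 3 = 10 + 10 * \<alpha>"
  "wt \<alpha> 6 2 = 15 + 6 * \<alpha>" "wt \<alpha> 6 3 = 20 + 15 * \<alpha>"
  by (simp_all add: wt_numeral)

text \<open>This and the next four lemmas solve two linear equations for \<open>?s\<close> and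
  \<open>?k\<close>: the coefficients of \<open>f\<close> at \<lambda>^2 and \<lambda>^3 are those
  of the explicit cocycle plus the weights times \<open>?k\<close>. For n = 2, 3, 4 the determinants
  are -1, -2, -20 whatever \<alpha> is; for n = 6 it is -(15 + 6 \<alpha>), which is nonzero on the
  zeros of \<open>vir_obstr\<close>.\<close>

lemma dvir_class2:
  assumes d: "\<And>z x y. dvir \<alpha> (\<alpha> + of_nat 2) f z x y = 0" and "\<alpha> \<noteq> 0"
  obtains s \<phi> where "f = vir2 s + cob \<alpha> (\<alpha> + of_nat 2) \<phi>"
proof -
  let ?k = "cf f 2 1 - 2 * cf f 3 0"
  let ?s = "cf f 3 0 - \<alpha> * ?k"
  obtain \<phi> where "f = vir2 ?s + cob \<alpha> (\<alpha> + of_nat 2) \<phi>"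
    by (rule dvir_modulo_cob[OF assms _ dvir_vir2, where k = ?k, of ?s])
      (auto simp: cf_vir[simplified] wt_small field_simps)
  then show ?thesis by (rule that)
qed

lemma dvir_class3:
  assumes d: "\<And>z x y. dvir \<alpha> (\<alpha> + of_nat 3) f z x y = 0" and "\<alpha> \<noteq> 0"
  obtains s \<phi> where "f = vir3 s + cob \<alpha> (\<alpha> + of_nat 3) \<phi>"
proof -
  let ?k = "(cf f 2 2 - cf f 3 1) / 2"
  let ?s = "cf f 2 2 - (3 + 3 * \<alpha>) * ?k"
  obtain \<phi> where "f = vir3 ?s + cob \<alpha> (\<alpha> + of_nat 3) \<phi>"
    by (rule dvir_modulo_cob[OF assms _ dvir_vir3, where k = ?k, of ?s])
      (auto simp: cf_vir[simplified] wt_small field_simps)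
  then show ?thesis by (rule that)
qed

lemma dvir_class4:
  assumes d: "\<And>z x y. dvir \<alpha> (\<alpha> + of_nat 4) f z x y = 0" and "\<alpha> \<noteq> 0"
  obtains s \<phi> where "f = vir4 \<alpha> s + cob \<alpha> (\<alpha> + of_nat 4) \<phi>"
proof -
  let ?k = "(3 * cf f 2 3 - 2 * cf f 3 2) / 10"
  let ?s = "(cf f 2 3 - (6 + 4 * \<alpha>) * ?k) / 4"
  obtain \<phi> where "f = vir4 \<alpha> ?s + cob \<alpha> (\<alpha> + of_nat 4) \<phi>"
    by (rule dvir_modulo_cob[OF assms _ dvir_vir4, where k = ?k, of ?s])
      (auto simp: cf_vir[simplified] wt_small field_simps)
  then show ?thesis by (rule that)
qed

lemma dvir_class5:
  assumes d: "\<And>z x y. dvir (- 4) (- 4 + of_nat 5) f z x y = 0"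
  obtains s \<phi> where "f = vir5 s + cob (- 4) (- 4 + of_nat 5) \<phi>"
proof -
  let ?k = "- cf f 3 3 / 30"
  let ?s = "cf f 2 4 + 10 * ?k"
  obtain \<phi> where "f = vir5 ?s + cob (- 4) (- 4 + of_nat 5) \<phi>"
    by (rule dvir_modulo_cob[OF d _ _ dvir_vir5, where k = ?k, of ?s])
      (auto simp: cf_vir[simplified] wt_small field_simps)
  then show ?thesis by (rule that)
qed

lemma vir_obstr_6_nonzero:
  assumes "vir_obstr 6 \<alpha> = 0" shows "15 + 6 * \<alpha> \<noteq> 0"
proof
  assume "15 + 6 * \<alpha> = 0"
  moreover have "\<alpha> = (15 + 6 * \<alpha>) / 6 - 5 / 2" by (simp add: field_simps)
  ultimately have a: "\<alpha> = - 5 / 2" by simp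
  show False using assms unfolding vir_obstr_def a by (simp add: power2_eq_square)
qed

lemma dvir_class6:
  assumes d: "\<And>z x y. dvir \<alpha> (\<alpha> + of_nat 6) f z x y = 0" and "\<alpha> \<noteq> 0" and vir_obstr: "vir_obstr 6 \<alpha> = 0"
  obtains s \<phi> where "f = vir6 \<alpha> s + cob \<alpha> (\<alpha> + of_nat 6) \<phi>"
proof -
  have nz: "15 + 6 * \<alpha> \<noteq> 0" using vir_obstr by (rule vir_obstr_6_nonzero)
  then have k: "(15 + 6 * \<alpha>) * (cf f 2 5 / (15 + 6 * \<alpha>)) = cf f 2 5" by simp
  let ?k = "cf f 2 5 / (15 + 6 * \<alpha>)"
  let ?s = "cf f 3 4 - (20 + 15 * \<alpha>) * ?k"
  obtain \<phi> where "f = vir6 \<alpha> ?s + cob \<alpha> (\<alpha> + of_nat 6) \<phi>"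
    by (rule dvir_modulo_cob[OF assms(1,2) _ dvir_vir6[OF vir_obstr], where k = ?k, of ?s])
      (use nz in \<open>auto simp: cf_vir[simplified] wt_small k\<close>)
  then show ?thesis by (rule that)
qed

text \<open>If an explicit cocycle is a coboundary, its coefficients at \<lambda>^2 and \<lambda>^3
  are a common multiple of the weights, and the nonzero determinants of the classification leave
  only s = 0. For \<alpha>' = \<alpha>, a coboundary has no coefficients at 1 and \<lambda>.\<close>

lemma vir_independent:
  assumes "\<alpha> \<noteq> 0"
  shows "cst s0 + cst s1 * vl = cob \<alpha> \<alpha> \<phi> \<Longrightarrow> s0 = 0 \<and> s1 = 0"
    and "vir2 s = cob \<alpha> \<alpha>' \<phi> \<Longrightarrow> s = 0"
    and "vir3 s = cob \<alpha> \<alpha>' \<phi> \<Longrightarrow> s = 0"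
    and "vir4 \<alpha> s = cob \<alpha> \<alpha>' \<phi> \<Longrightarrow> s = 0"
    and "vir5 s = cob (- 4) \<alpha>' \<phi> \<Longrightarrow> s = 0"
    and "vir_obstr 6 \<alpha> = 0 \<Longrightarrow> vir6 \<alpha> s = cob \<alpha> \<alpha>' \<phi> \<Longrightarrow> s = 0"
proof -
  have c2: "cf (cob \<alpha> \<alpha>' \<phi>) 2 p = wt \<alpha> q 2 * coeff \<phi> q" if "q = p + 1" for \<alpha> p q
    using cf_cob_wt[of 2 "p + 2" \<alpha> \<alpha>' \<phi>] that by simp
  have c3: "cf (cob \<alpha> \<alpha>' \<phi>) 3 p = wt \<alpha> q 3 * coeff \<phi> q" if "q = p + 2" for \<alpha> p q
    using cf_cob_wt[of 3 "p + 3" \<alpha> \<alpha>' \<phi>] that by (simp add: numeral_3_eq_3)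
  show "s0 = 0 \<and> s1 = 0" if "cst s0 + cst s1 * vl = cob \<alpha> \<alpha> \<phi>"
    using arg_cong[OF that, of "\<lambda>f. cf f 0 0"] arg_cong[OF that, of "\<lambda>f. cf f 1 0"]
    by (simp add: cf_cob_0 cf_cob_1[simplified])
  show "s = 0" if "vir2 s = cob \<alpha> \<alpha>' \<phi>"
  proof -
    have "2 * s = (1 + 2 * \<alpha>) * coeff \<phi> 2" "s = \<alpha> * coeff \<phi> 2"
      using c2[of 2 1 "\<alpha>"] c3[of 2 0 "\<alpha>"] cf_vir(1,2)[of s] that by (simp_all add: wt_small)
    then have "coeff \<phi> 2 = 0" by (simp add: algebra_simps)
    with \<open>s = \<alpha> * coeff \<phi> 2\<close> show ?thesis by simp
  qed
  show "s = 0" if "vir3 s = cob \<alpha> \<alpha>' \<phi>"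
  proof -
    have "s = (3 + 3 * \<alpha>) * coeff \<phi> 3" "s = (1 + 3 * \<alpha>) * coeff \<phi> 3"
      using c2[of 3 2 "\<alpha>"] c3[of 3 1 "\<alpha>"] cf_vir(3,4)[of s] that by (simp_all add: wt_small)
    then have "coeff \<phi> 3 = 0" by (simp add: algebra_simps)
    with \<open>s = (3 + 3 * \<alpha>) * coeff \<phi> 3\<close> show ?thesis by simp
  qed
  show "s = 0" if "vir4 \<alpha> s = cob \<alpha> \<alpha>' \<phi>"
  proof -
    have e: "4 * s = (6 + 4 * \<alpha>) * coeff \<phi> 4" "6 * s = (4 + 6 * \<alpha>) * coeff \<phi> 4"
      using c2[of 4 3 "\<alpha>"] c3[of 4 2 "\<alpha>"] cf_vir(5,6)[of \<alpha> s] that by (simp_all add: wt_small)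
    have "10 * coeff \<phi> 4 = 3 * ((6 + 4 * \<alpha>) * coeff \<phi> 4) - 2 * ((4 + 6 * \<alpha>) * coeff \<phi> 4)"
      by (simp add: algebra_simps)
    then have "coeff \<phi> 4 = 0" unfolding e[symmetric] by simp
    with e show ?thesis by simp
  qed
  show "s = 0" if "vir5 s = cob (- 4) \<alpha>' \<phi>"
    using c2[of 5 4 "- 4"] c3[of 5 3 "- 4"] cf_vir(7,8)[of s] that by (simp add: wt_small)
  show "s = 0" if "vir_obstr 6 \<alpha> = 0" "vir6 \<alpha> s = cob \<alpha> \<alpha>' \<phi>"
  proof -
    have "15 + 6 * \<alpha> \<noteq> 0" using that(1) by (rule vir_obstr_6_nonzero)
    then show ?thesis
      using c2[of 6 5 "\<alpha>"] c3[of 6 4 "\<alpha>"] cf_vir(9,10)[of \<alpha> s] that by (simp add: wt_small)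
  qed
qed

section \<open>The action of the second generator\<close>

text \<open>The module axiom for \<open>A\<close>, \<open>B\<close> and the lift of \<open>v'\<close>.\<close>

definition dgen :: "complex \<Rightarrow> complex \<Rightarrow> complex \<Rightarrow> bipoly \<Rightarrow> bool"
  where "dgen a \<alpha> \<alpha>' g \<longleftrightarrow> (\<forall>z x y. (z + \<alpha> * x) * ev g (z + x) y - (z + y + \<alpha>' * x) * ev g z y
    = ((a - 1) * x - y) * ev g z (x + y))"

lemma dgen_coeff:
  assumes "dgen a \<alpha> \<alpha>' g"
  shows "(if p = 0 then 0 else of_nat (p - 1 + s choose s) * cf g r (p - 1 + s))
    + \<alpha> * (if s = 0 then 0 else of_nat (p + (s - 1) choose (s - 1)) * cf g r (p + (s - 1)))
    - ((if p = 0 then 0 else if s = 0 then cf g r (p - 1) else 0)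
      + (if r = 0 then 0 else if s = 0 then cf g (r - 1) p else 0)
      + \<alpha>' * (if s = 0 then 0 else if s - 1 = 0 then cf g r p else 0))
    = (a - 1) * (if s = 0 then 0 else of_nat (s - 1 + r choose r) * cf g (s - 1 + r) p)
      - (if r = 0 then 0 else of_nat (s + (r - 1) choose (r - 1)) * cf g (s + (r - 1)) p)"
proof -
  note y = tri_ev_y[of g] and zx = tri_ev_zx_y[of g] and xy = tri_ev_xy[of g]
  note l = tri_diff[OF tri_add[OF tri_z[OF zx] tri_scale[OF tri_x[OF zx], of \<alpha>]]
    tri_add[OF tri_add[OF tri_z[OF y] tri_y[OF y]] tri_scale[OF tri_x[OF y], of \<alpha>']]]
  note r = tri_diff[OF tri_scale[OF tri_x[OF xy], of "a - 1"] tri_y[OF xy]]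
  show ?thesis
    using tri_unique[OF l tri_cong[OF r _ refl], where p = p and s = s and r = r] assms
    by (simp add: dgen_def algebra_simps)
qed

lemma dgen_euler:
  assumes "dgen a \<alpha> \<alpha>' g"
  shows "(of_nat (r + p) - (\<alpha>' - \<alpha> + a - 1)) * cf g r p = 0"
proof -
  have "(if p = 0 then 0 else of_nat p * cf g r p) = of_nat p * cf g r p" by simp
  moreover have "(if r = 0 then 0 else of_nat (1 + (r - 1) choose (r - 1)) * cf g (1 + (r - 1)) p) =
    of_nat r * cf g r p"
    by (cases r) (simp_all add: binomial_Suc_n)
  ultimately show ?thesis using dgen_coeff[OF assms, of p 1 r]
    by (cases p) (simp_all add: algebra_simps)
qed

text \<open>Every \<open>s\<close> gives a two-term recursion from \<lambda>^r to \<lambda>^(r + s -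
  1). The same power is reached along different paths, and their compatibility bounds the degree of
  \<open>g\<close>.\<close>

lemma dgen_rel:
  assumes "dgen a \<alpha> \<alpha>' g" "2 \<le> s" "r + s \<le> k + 1"
  shows "wt \<alpha> (k - r) s * cf g r (k - r) =
    ((a - 1) * of_nat (r + s - 1 choose r) - of_nat (r + s - 1 choose s)) * cf g (r + s - 1) (k + 1 - r - s)"
proof -
  define t where "t = s - 2"
  have t: "s = Suc (Suc t)" using assms(2) unfolding t_def by arith
  define p where "p = k + 1 - r - s"
  have k: "k - r = p + Suc t" using assms(3) unfolding t p_def by simp
  have 1: "(if r = 0 then 0 else of_nat (s + (r - 1) choose (r - 1)) * cf g (s + (r - 1)) p) =
    of_nat (r + s - 1 choose s) * cf g (r + s - 1) p"
  proof (cases r)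
    case (Suc q)
    have "s + q choose q = s + q choose s" using binomial_symmetric[of q "s + q"] by simp
    then show ?thesis using Suc by (simp add: add.commute)
  qed (simp add: t binomial_eq_0)
  have 2: "(if p = 0 then 0 else of_nat (p - 1 + s choose s) * cf g r (p - 1 + s)) =
    of_nat (k - r choose s) * cf g r (k - r)"
    by (cases p) (simp_all add: k t binomial_eq_0)
  have 3: "s - 1 + r = r + s - 1" "p + (s - 1) = k - r" using k t by auto
  show ?thesis
    using dgen_coeff[OF assms(1), of p s r] unfolding 1 2 3 unfolding p_def[symmetric] wt_def
    using t by (simp add: algebra_simps)
qed

lemma dgen_zero:
  assumes "dgen a \<alpha> \<alpha>' g" "\<alpha>' - \<alpha> + a - 1 \<notin> \<nat>" shows "g = 0"
proof (intro poly_eqI)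
  fix r p show "cf g r p = cf 0 r p"
    using dgen_euler[OF assms(1), of r p] assms(2) of_nat_in_Nats[of "r + p"]
    by (metis coeff_0 eq_iff_diff_eq_0 mult_eq_0_iff)
qed

lemma dgen_eqI:
  assumes "dgen a \<alpha> \<alpha>' g" "dgen a \<alpha> \<alpha>' h" "\<alpha>' - \<alpha> + a - 1 = of_nat k"
    and "\<And>r. r \<le> k \<Longrightarrow> cf g r (k - r) = cf h r (k - r)"
  shows "g = h"
proof (intro poly_eqI)
  fix r p show "cf g r p = cf h r p"
  proof (cases "r + p = k")
    case True
    then have "p = k - r" "r \<le> k" by auto
    then show ?thesis using assms(4) by simp
  next
    case False
    then have "of_nat (r + p) - (\<alpha>' - \<alpha> + a - 1) \<noteq> 0" unfolding assms(3) by (metis eq_iff_diff_eq_0 of_nat_eq_iff)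
    then show ?thesis using dgen_euler[OF assms(1), of r p] dgen_euler[OF assms(2), of r p] by simp
  qed
qed

lemma dgen_diff: "dgen a \<alpha> \<alpha>' g \<Longrightarrow> dgen a \<alpha> \<alpha>' h \<Longrightarrow> dgen a \<alpha> \<alpha>' (g - h)"
proof -
  assume g: "dgen a \<alpha> \<alpha>' g" and h: "dgen a \<alpha> \<alpha>' h"
  have "(z + \<alpha> * x) * ev (g - h) (z + x) y - (z + y + \<alpha>' * x) * ev (g - h) z y =
    ((z + \<alpha> * x) * ev g (z + x) y - (z + y + \<alpha>' * x) * ev g z y)
    - ((z + \<alpha> * x) * ev h (z + x) y - (z + y + \<alpha>' * x) * ev h z y)" for z x y
    by (simp add: ev_simps algebra_simps)
  then show ?thesis
    using g h unfolding dgen_def by (simp add: ev_simps right_diff_distrib)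
qed

lemma dgen_scale: "dgen a \<alpha> \<alpha>' g \<Longrightarrow> dgen a \<alpha> \<alpha>' (cst k * g)"
  unfolding dgen_def ev_simps by (metis (no_types, opaque_lifting) mult.left_commute right_diff_distrib)

lemma dgen_0: "dgen a \<alpha> \<alpha>' 0"
  by (simp add: dgen_def ev_simps)

context
  fixes b k :: nat and \<alpha> \<alpha>' :: complex and g :: bipoly
  assumes g: "dgen (- of_nat b) \<alpha> \<alpha>' g" and deg: "\<alpha>' - \<alpha> - of_nat b - 1 = of_nat k"
begin

text \<open>For \<open>a \<le> 0\<close> the leading coefficient determines \<open>g\<close>.\<close>

lemma dgen_lead:
  assumes "cf g 0 k = 0" shows "g = 0"
proof -
  have *: "cf g r (k - r) = 0" if "r \<le> k" for r
    using that
  proof (induction r)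
    case 0
    then show ?case using assms by simp
  next
    case (Suc r)
    have "((- of_nat b - 1) * of_nat (r + 1) - of_nat (r + 1 choose 2)) * cf g (Suc r) (k - Suc r) = 0"
      using dgen_rel[OF g, of 2 r k] Suc by simp
    moreover have "(- of_nat b - 1) * of_nat (r + 1) - of_nat (r + 1 choose 2) =
      (- of_nat ((b + 1) * (r + 1) + (r + 1 choose 2)) :: complex)"
      by (simp add: algebra_simps)
    moreover have "(b + 1) * (r + 1) + (r + 1 choose 2) \<noteq> 0" by simp
    ultimately show ?case by (metis mult_eq_0_iff neg_equal_0_iff_equal of_nat_eq_0_iff)
  qed
  show ?thesis by (rule dgen_eqI[OF g dgen_0]) (use deg * in auto)
qed

text \<open>Reaching \<lambda>^2 directly and through \<lambda>^1 gives the quadratic equation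
  \<open>E1\<close> for \<alpha>; for k \<ge> 3, reaching \<lambda>^3 in the same two ways gives
  \<open>E2\<close>. Their difference is K + 1 times a linear form, and with that form zero
  \<open>E1\<close> turns a positive integer into 0. For k = 2, \<open>E1\<close> reads \<alpha>
  (\<alpha> + b + 2) = 0 up to a constant.\<close>

lemma dgen_degree:
  assumes "g \<noteq> 0" and "\<alpha> \<noteq> 0"
  shows "k \<le> 1 \<or> k = 2 \<and> \<alpha> = - of_nat b - 2"
proof (rule ccontr)
  define K B x0 where "K = (of_nat k :: complex)" and "B = (of_nat b :: complex)" and "x0 = cf g 0 k"
  have x0: "x0 \<noteq> 0" using assms(1) dgen_lead by (auto simp: x0_def)
  assume "\<not> ?thesis"
  then have k2: "2 \<le> k" and ne: "k = 2 \<Longrightarrow> \<alpha> \<noteq> - B - 2" by (auto simp: B_def)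
  have K: "of_nat (k - 1) = K - 1" using k2 by (simp add: K_def of_nat_diff)
  have B: "- B - 1 \<noteq> 0" unfolding B_def by (metis add_uminus_conv_diff minus_add_distrib neg_equal_0_iff_equal of_nat_Suc of_nat_neq_0 add.commute)
  have KK: "K \<noteq> 0" "K - 1 \<noteq> 0" using k2 by (auto simp: K_def of_nat_eq_1_iff)
  define x1 x2 where "x1 = cf g 1 (k - 1)" and "x2 = cf g 2 (k - 2)"
  have 02: "wt \<alpha> k 2 * x0 = (- B - 1) * x1"
    using dgen_rel[OF g, of 2 0 k] k2 by (simp add: x0_def x1_def B_def)
  have 03: "wt \<alpha> k 3 * x0 = (- B - 1) * x2"
    using dgen_rel[OF g, of 3 0 k] k2 by (simp add: x0_def x2_def B_def numeral_3_eq_3 numeral_2_eq_2)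
  have 12: "wt \<alpha> (k - 1) 2 * x1 = (- 2 * B - 3) * x2"
    using dgen_rel[OF g, of 2 1 k] k2
    by (simp add: x1_def x2_def B_def numeral_3_eq_3 numeral_2_eq_2 algebra_simps)
  have "(- B - 1) * (wt \<alpha> (k - 1) 2 * x1) = wt \<alpha> (k - 1) 2 * wt \<alpha> k 2 * x0"
    using 02 by (simp add: mult.left_commute mult.assoc)
  moreover have "(- B - 1) * ((- 2 * B - 3) * x2) = (- 2 * B - 3) * wt \<alpha> k 3 * x0"
    using 03 by (simp add: mult.left_commute mult.assoc)
  ultimately have "wt \<alpha> (k - 1) 2 * wt \<alpha> k 2 * x0 = (- 2 * B - 3) * wt \<alpha> k 3 * x0"
    using 12 by metis
  then have "wt \<alpha> (k - 1) 2 * wt \<alpha> k 2 = (- 2 * B - 3) * wt \<alpha> k 3" using x0 by (metis mult_right_cancel)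
  moreover have "wt \<alpha> (k - 1) 2 * wt \<alpha> k 2 - (- 2 * B - 3) * wt \<alpha> k 3 =
    K * (K - 1) / 12 * (12 * \<alpha> ^ 2 + 12 * \<alpha> * (K + B) + (K - 2) * (3 * K + 3 + 4 * B))"
    unfolding wt_2 wt_3 K K_def[symmetric] by (simp add: field_simps eval_nat_numeral)
  ultimately have E1: "12 * \<alpha> ^ 2 + 12 * \<alpha> * (K + B) + (K - 2) * (3 * K + 3 + 4 * B) = 0"
    using KK by simp
  show False
  proof (cases "k = 2")
    case True
    then have "12 * (\<alpha> * (\<alpha> + (2 + B))) = 12 * \<alpha> ^ 2 + 12 * \<alpha> * (K + B) + (K - 2) * (3 * K + 3 + 4 * B)"
      by (simp add: K_def power2_eq_square algebra_simps)
    then have "\<alpha> * (\<alpha> + (2 + B)) = 0" using E1 by simp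
    then have "\<alpha> + (2 + B) = 0" using assms(2) by (metis mult_eq_0_iff)
    then have "\<alpha> = - B - 2" by (simp add: add_eq_0_iff2)
    then show False using ne True by blast
  next
    case False
    then have k3: "3 \<le> k" using k2 by simp
    define x3 where "x3 = cf g 3 (k - 3)"
    have "of_nat k \<noteq> (of_nat 2 :: complex)" using k3 unfolding of_nat_eq_iff by simp
    then have KKK: "K - 2 \<noteq> 0" by (simp add: K_def)
    have 04: "wt \<alpha> k 4 * x0 = (- B - 1) * x3"
      using dgen_rel[OF g, of 4 0 k] k3 by (simp add: x0_def x3_def B_def eval_nat_numeral)
    have 13: "wt \<alpha> (k - 1) 3 * x1 = (- 3 * B - 4) * x3"
      using dgen_rel[OF g, of 3 1 k] k3
      by (simp add: x1_def x3_def B_def eval_nat_numeral algebra_simps)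
    have "(- B - 1) * (wt \<alpha> (k - 1) 3 * x1) = wt \<alpha> (k - 1) 3 * wt \<alpha> k 2 * x0"
      using 02 by (simp add: mult.left_commute mult.assoc)
    moreover have "(- B - 1) * ((- 3 * B - 4) * x3) = (- 3 * B - 4) * wt \<alpha> k 4 * x0"
      using 04 by (simp add: mult.left_commute mult.assoc)
    ultimately have "wt \<alpha> (k - 1) 3 * wt \<alpha> k 2 * x0 = (- 3 * B - 4) * wt \<alpha> k 4 * x0"
      using 13 by metis
    then have "wt \<alpha> (k - 1) 3 * wt \<alpha> k 2 = (- 3 * B - 4) * wt \<alpha> k 4" using x0 by (metis mult_right_cancel)
    moreover have "wt \<alpha> (k - 1) 3 * wt \<alpha> k 2 - (- 3 * B - 4) * wt \<alpha> k 4 =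
      K * (K - 1) * (K - 2) / 24 *
        (12 * \<alpha> ^ 2 + \<alpha> * (10 * K - 2 + 12 * B) + (K - 3) * (2 * K + 2 + 3 * B))"
      unfolding wt_2 wt_3 wt_numeral(3) K K_def[symmetric] by (simp add: field_simps eval_nat_numeral)
    ultimately have E2: "12 * \<alpha> ^ 2 + \<alpha> * (10 * K - 2 + 12 * B) + (K - 3) * (2 * K + 2 + 3 * B) = 0"
      using KK KKK by simp
    have "(K + 1) * (2 * \<alpha> + K + B) = (12 * \<alpha> ^ 2 + 12 * \<alpha> * (K + B) + (K - 2) * (3 * K + 3 + 4 * B))
      - (12 * \<alpha> ^ 2 + \<alpha> * (10 * K - 2 + 12 * B) + (K - 3) * (2 * K + 2 + 3 * B))"
      by (simp add: algebra_simps)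
    then have "(K + 1) * (2 * \<alpha> + K + B) = 0" unfolding E1 E2 by simp
    moreover have "K + 1 \<noteq> 0" unfolding K_def by (metis of_nat_Suc of_nat_neq_0 add.commute)
    ultimately have l: "2 * \<alpha> + K + B = 0" by simp
    have "of_nat (2 * b * k + 3 * k + 3 * b * b + 8 * b + 6) =
      (2 * \<alpha> + K + B) * (6 * \<alpha> + 3 * (K + B))
      - (12 * \<alpha> ^ 2 + 12 * \<alpha> * (K + B) + (K - 2) * (3 * K + 3 + 4 * B))"
      unfolding of_nat_add of_nat_mult of_nat_numeral K_def[symmetric] B_def[symmetric]
      by (simp add: algebra_simps power2_eq_square)
    then have "of_nat (2 * b * k + 3 * k + 3 * b * b + 8 * b + 6) = (0::complex)"
      unfolding E1 l by simp
    then show False unfolding of_nat_eq_0_iff by simp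
  qed
qed

end

section \<open>Coupling the equations for f and g\<close>

text \<open>The polynomial \<open>Q\<close> enters through products x^i y^j g(z, x + y). Their
  coefficients make up the source \<open>q\<close> of the relations above.\<close>

definition qmon :: "bipoly \<Rightarrow> nat \<Rightarrow> nat \<Rightarrow> nat \<Rightarrow> nat \<Rightarrow> nat \<Rightarrow> complex"
  where "qmon g i j p s r = (if s < i \<or> r < j then 0
    else of_nat (s - i + (r - j) choose (r - j)) * cf g (s - i + (r - j)) p)"

lemma tri_qmon: "tri (\<lambda>z x y. x ^ i * (y ^ j * ev g z (x + y))) (qmon g i j)"
  by (rule tri_cong[OF tri_x_pow[OF tri_y_pow[OF tri_ev_xy]]]) (auto simp: qmon_def)

text \<open>The first argument of \<open>Q\<close> is - x - y because the derivation, moved out of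
  the bracket [A_x A] acting with parameter x + y, becomes minus that parameter.\<close>

definition coc :: "complex \<Rightarrow> complex \<Rightarrow> complex \<Rightarrow> complex \<Rightarrow> complex \<Rightarrow> bipoly \<Rightarrow> bipoly \<Rightarrow> bool"
  where "coc a c d \<alpha> \<alpha>' f g \<longleftrightarrow>
    (\<forall>z x y. dvir \<alpha> \<alpha>' f z x y = ev (Q_poly a c d) (- x - y) x * ev g z (x + y)) \<and> dgen a \<alpha> \<alpha>' g"

lemma coc_dvirD: "coc a c d \<alpha> \<alpha>' f 0 \<Longrightarrow> dvir \<alpha> \<alpha>' f z x y = 0"
  by (simp add: coc_def ev_simps)

lemma coc_dvirI: "(\<And>z x y. dvir \<alpha> \<alpha>' f z x y = 0) \<Longrightarrow> coc a c d \<alpha> \<alpha>' f 0"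
  by (simp add: coc_def ev_simps dgen_0)

lemma coc_diff_scale:
  assumes "coc a c d \<alpha> \<alpha>' f g" "coc a c d \<alpha> \<alpha>' f' g'" "g = cst t * g'"
  shows "dvir \<alpha> \<alpha>' (f - cst t * f') z x y = 0"
  using assms(1,2) unfolding assms(3) coc_def dvir_diff dvir_scale ev_simps by simp

section \<open>Bases of the space of cocycles\<close>

text \<open>
  The pairs \<open>b 0, \<dots>, b (n - 1)\<close> are a basis of the cocycles modulo coboundaries, and the list
  consists of their nonzero linear combinations.
\<close>

definition ext_basis ::
  "complex \<Rightarrow> complex \<Rightarrow> complex \<Rightarrow> complex \<Rightarrow> complex \<Rightarrow> nat \<Rightarrow> (nat \<Rightarrow> bipoly \<times> bipoly) \<Rightarrow> bool"
  where "ext_basis a c d \<alpha> \<alpha>' n b \<longleftrightarrow>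
    (\<forall>i<n. coc a c d \<alpha> \<alpha>' (fst (b i)) (snd (b i))) \<and>
    (\<forall>k \<phi>. (\<Sum>i<n. cst (k i) * fst (b i)) = cob \<alpha> \<alpha>' \<phi> \<and> (\<Sum>i<n. cst (k i) * snd (b i)) = 0
      \<longrightarrow> (\<forall>i<n. k i = 0)) \<and>
    (\<forall>f g. coc a c d \<alpha> \<alpha>' f g \<longrightarrow>
      (\<exists>k \<phi>. f = (\<Sum>i<n. cst (k i) * fst (b i)) + cob \<alpha> \<alpha>' \<phi> \<and> g = (\<Sum>i<n. cst (k i) * snd (b i)))) \<and>
    (\<forall>m F G. ext_list a c d \<alpha> \<alpha>' m F G \<longleftrightarrow>
      m = n \<and> (\<exists>k. (\<exists>i<n. k i \<noteq> 0) \<and>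
        F = (\<Sum>i<n. cst (k i) * fst (b i)) \<and> G = (\<Sum>i<n. cst (k i) * snd (b i))))"

lemma ext_basis_0I:
  assumes "\<And>f g. coc a c d \<alpha> \<alpha>' f g \<Longrightarrow> g = 0 \<and> (\<exists>\<phi>. f = cob \<alpha> \<alpha>' \<phi>)"
    and "\<And>m F G. \<not> ext_list a c d \<alpha> \<alpha>' m F G"
  shows "ext_basis a c d \<alpha> \<alpha>' 0 b"
  using assms unfolding ext_basis_def by simp

lemma ext_basis_1I:
  assumes "coc a c d \<alpha> \<alpha>' F0 G0"
    and "\<And>t \<phi>. cst t * F0 = cob \<alpha> \<alpha>' \<phi> \<Longrightarrow> cst t * G0 = 0 \<Longrightarrow> t = 0"
    and "\<And>f g. coc a c d \<alpha> \<alpha>' f g \<Longrightarrow> \<exists>t \<phi>. f = cst t * F0 + cob \<alpha> \<alpha>' \<phi> \<and> g = cst t * G0"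
    and "\<And>m F G. ext_list a c d \<alpha> \<alpha>' m F G \<longleftrightarrow> m = 1 \<and> (\<exists>t. t \<noteq> 0 \<and> F = cst t * F0 \<and> G = cst t * G0)"
  shows "ext_basis a c d \<alpha> \<alpha>' 1 (\<lambda>_. (F0, G0))"
proof -
  have *: "(\<Sum>i<1. f i) = f 0" for f :: "nat \<Rightarrow> bipoly" by (simp add: lessThan_Suc)
  have **: "(\<forall>i<1. P i) \<longleftrightarrow> P 0" "(\<exists>i<1. P i) \<longleftrightarrow> P 0" for P :: "nat \<Rightarrow> bool"
    by auto
  show ?thesis
    unfolding ext_basis_def * ** fst_conv snd_conv
  proof (intro conjI allI impI; (elim conjE)?)
    fix f g assume "coc a c d \<alpha> \<alpha>' f g"
    then obtain t \<phi> where "f = cst t * F0 + cob \<alpha> \<alpha>' \<phi>" "g = cst t * G0" using assms(3) by blast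
    then show "\<exists>k \<phi>. f = cst (k (0::nat)) * F0 + cob \<alpha> \<alpha>' \<phi> \<and> g = cst (k 0) * G0"
      by (intro exI[of _ "\<lambda>_. t"] exI[of _ \<phi>]) simp
  next
    fix m F G
    show "ext_list a c d \<alpha> \<alpha>' m F G \<longleftrightarrow> m = 1 \<and> (\<exists>k. k (0::nat) \<noteq> 0 \<and>
      F = cst (k 0) * F0 \<and> G = cst (k 0) * G0)"
      unfolding assms(4)
      apply (intro conj_cong refl iffI)
      subgoal by (elim exE conjE) (rule_tac x = "\<lambda>_. t" in exI, simp)
      subgoal by (elim exE conjE) (rule_tac x = "k 0" in exI, simp)
      done
  qed (use assms in blast)+
qed

lemma ext_basis_2I:
  assumes "coc a c d \<alpha> \<alpha>' F0 G0" "coc a c d \<alpha> \<alpha>' F1 G1"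
    and "\<And>s t \<phi>. cst s * F0 + cst t * F1 = cob \<alpha> \<alpha>' \<phi> \<Longrightarrow> cst s * G0 + cst t * G1 = 0 \<Longrightarrow> s = 0 \<and> t = 0"
    and "\<And>f g. coc a c d \<alpha> \<alpha>' f g \<Longrightarrow>
      \<exists>s t \<phi>. f = cst s * F0 + cst t * F1 + cob \<alpha> \<alpha>' \<phi> \<and> g = cst s * G0 + cst t * G1"
    and "\<And>m F G. ext_list a c d \<alpha> \<alpha>' m F G \<longleftrightarrow> m = 2 \<and>
      (\<exists>s t. (s, t) \<noteq> (0, 0) \<and> F = cst s * F0 + cst t * F1 \<and> G = cst s * G0 + cst t * G1)"
  shows "ext_basis a c d \<alpha> \<alpha>' 2 (\<lambda>i. if i = 0 then (F0, G0) else (F1, G1))"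
proof -
  have *: "(\<Sum>i<2. f i) = f 0 + f 1" for f :: "nat \<Rightarrow> bipoly" by (simp add: numeral_2_eq_2)
  have **: "(\<forall>i<2. P i) \<longleftrightarrow> P 0 \<and> P 1" "(\<exists>i<2. P i) \<longleftrightarrow> P 0 \<or> P 1" for P :: "nat \<Rightarrow> bool"
    by (auto simp: less_2_cases_iff)
  have s: "(if (0::nat) = 0 then u else v) = u" "(if (1::nat) = 0 then u else v) = v" for u v :: "bipoly \<times> bipoly"
    by simp_all
  show ?thesis
    unfolding ext_basis_def * ** s fst_conv snd_conv
  proof (intro conjI allI impI; (elim conjE)?)
    fix f g assume "coc a c d \<alpha> \<alpha>' f g"
    then obtain s t \<phi> where "f = cst s * F0 + cst t * F1 + cob \<alpha> \<alpha>' \<phi>" "g = cst s * G0 + cst t * G1"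
      using assms(4) by blast
    then show "\<exists>k \<phi>. f = cst (k (0::nat)) * F0 + cst (k 1) * F1 + cob \<alpha> \<alpha>' \<phi> \<and> g = cst (k 0) * G0 + cst (k 1) * G1"
      by (intro exI[of _ "\<lambda>i::nat. if i = 0 then s else t"] exI[of _ \<phi>]) simp
  next
    fix m F G
    show "ext_list a c d \<alpha> \<alpha>' m F G \<longleftrightarrow> m = 2 \<and> (\<exists>k. (k 0 \<noteq> 0 \<or> k 1 \<noteq> 0) \<and>
      F = cst (k (0::nat)) * F0 + cst (k 1) * F1 \<and> G = cst (k 0) * G0 + cst (k 1) * G1)"
      unfolding assms(5)
      apply (intro conj_cong refl iffI)
      subgoal by (elim exE conjE) (rule_tac x = "\<lambda>i. if i = 0 then s else t" in exI, simp)
      subgoal by (elim exE conjE) (rule_tac x = "k 0" in exI, rule_tac x = "k 1" in exI, simp)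
      done
  qed (use assms(1-3) in blast)+
qed

section \<open>Parameters at which g must vanish\<close>

text \<open>The entries with \<open>G = 0\<close>, which exist for every \<open>a\<close>.\<close>

definition vlist :: "complex \<Rightarrow> complex \<Rightarrow> nat \<Rightarrow> bipoly \<Rightarrow> bool"
  where "vlist \<alpha> \<alpha>' m F \<longleftrightarrow>
    \<alpha>' = \<alpha> \<and> m = 2 \<and> (\<exists>s0 s1. (s0, s1) \<noteq> (0, 0) \<and> F = cst s0 + cst s1 * vl) \<or>
    \<alpha>' = \<alpha> + 2 \<and> m = 1 \<and> (\<exists>s. s \<noteq> 0 \<and> F = vir2 s) \<or>
    \<alpha>' = \<alpha> + 3 \<and> m = 1 \<and> (\<exists>s. s \<noteq> 0 \<and> F = vir3 s) \<or>
    \<alpha>' = \<alpha> + 4 \<and> m = 1 \<and> (\<exists>s. s \<noteq> 0 \<and> F = vir4 \<alpha> s) \<or>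
    \<alpha>' = \<alpha> + 5 \<and> \<alpha> = - 4 \<and> m = 1 \<and> (\<exists>s. s \<noteq> 0 \<and> F = vir5 s) \<or>
    \<alpha>' = \<alpha> + 6 \<and> vir_obstr 6 \<alpha> = 0 \<and> m = 1 \<and> (\<exists>s. s \<noteq> 0 \<and> F = vir6 \<alpha> s)"

lemma vir_scale:
  "cst s * vir2 t = vir2 (s * t)" "cst s * vir3 t = vir3 (s * t)" "cst s * vir4 \<alpha> t = vir4 \<alpha> (s * t)"
  "cst s * vir5 t = vir5 (s * t)" "cst s * vir6 \<alpha> t = vir6 \<alpha> (s * t)"
  unfolding vir2_def vir3_def vir4_def vir5_def vir6_def
  by (rule ev_eqI; unfold ev_simps; simp only: mult.assoc)+

lemma dvir_linear: "dvir \<alpha> \<alpha> 1 z x y = 0" "dvir \<alpha> \<alpha> vl z x y = 0"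
  unfolding dvir_def ev_simps by (simp_all add: algebra_simps)

context
  fixes a c d \<alpha> \<alpha>' :: complex
  assumes \<alpha>: "\<alpha> \<noteq> 0"
    and gz: "\<And>f g. coc a c d \<alpha> \<alpha>' f g \<Longrightarrow> g = 0"
    and ext: "\<And>m F G. ext_list a c d \<alpha> \<alpha>' m F G \<longleftrightarrow> vlist \<alpha> \<alpha>' m F \<and> G = 0"
begin

lemma ext_basis_vir1:
  assumes "\<And>z x y s. dvir \<alpha> \<alpha>' (w s) z x y = 0" and "\<And>s. w s = cst s * w 1"
    and "\<And>s \<phi>. w s = cob \<alpha> \<alpha>' \<phi> \<Longrightarrow> s = 0"
    and "\<And>f. (\<And>z x y. dvir \<alpha> \<alpha>' f z x y = 0) \<Longrightarrow> \<exists>s \<phi>. f = w s + cob \<alpha> \<alpha>' \<phi>"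
    and "\<And>m F. vlist \<alpha> \<alpha>' m F \<longleftrightarrow> m = 1 \<and> (\<exists>s. s \<noteq> 0 \<and> F = w s)"
  shows "ext_basis a c d \<alpha> \<alpha>' 1 (\<lambda>_. (w 1, 0))"
proof (rule ext_basis_1I)
  show "coc a c d \<alpha> \<alpha>' (w 1) 0" by (rule coc_dvirI) (rule assms(1))
  show "t = 0" if "cst t * w 1 = cob \<alpha> \<alpha>' \<phi>" for t \<phi> using assms(3) that assms(2) by metis
  show "\<exists>t \<phi>. f = cst t * w 1 + cob \<alpha> \<alpha>' \<phi> \<and> g = cst t * 0" if "coc a c d \<alpha> \<alpha>' f g" for f g
    using assms(4)[of f] coc_dvirD that gz[OF that] assms(2) by (metis mult_zero_right)
  show "ext_list a c d \<alpha> \<alpha>' m F G \<longleftrightarrow> m = 1 \<and> (\<exists>t. t \<noteq> 0 \<and> F = cst t * w 1 \<and> G = cst t * 0)" for m F G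
    unfolding ext assms(5) by (simp only: assms(2)[symmetric] mult_zero_right) blast
qed

text \<open>Once \<open>g\<close> = 0 is forced, what is left depends on \<alpha> and \<alpha>'
  alone. For \<alpha>' - \<alpha> = 5 the obstruction is \<alpha> (\<alpha> + 4), whence the single
  value -4; from 7 on every cocycle is a coboundary.\<close>

lemma ext_basis_vir: "\<exists>n b. ext_basis a c d \<alpha> \<alpha>' n b"
proof -
  consider "\<alpha>' = \<alpha>" | "\<alpha>' = \<alpha> + of_nat 2" | "\<alpha>' = \<alpha> + of_nat 3" | "\<alpha>' = \<alpha> + of_nat 4"
    | "\<alpha>' = \<alpha> + of_nat 5" "\<alpha> = - 4" | "\<alpha>' = \<alpha> + of_nat 6" "vir_obstr 6 \<alpha> = 0"
    | "\<alpha>' - \<alpha> \<notin> \<nat>" | n where "\<alpha>' = \<alpha> + of_nat n" "n = 1 \<or> 7 \<le> n \<or> 5 \<le> n \<and> vir_obstr n \<alpha> \<noteq> 0"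
      "n = 5 \<Longrightarrow> \<alpha> \<noteq> - 4" "n = 6 \<Longrightarrow> vir_obstr 6 \<alpha> \<noteq> 0"
  proof (cases "\<alpha>' - \<alpha> \<in> \<nat>")
    case True
    then obtain n where n: "\<alpha>' = \<alpha> + of_nat n" unfolding Nats_def by (auto simp: algebra_simps)
    have vir_obstr: "vir_obstr 5 \<alpha> = \<alpha> * (\<alpha> + 4)" by (simp add: vir_obstr_def power2_eq_square algebra_simps)
    consider "n = 0" | "n = 1" | "n = 2" | "n = 3" | "n = 4" | "n = 5" | "n = 6" | "7 \<le> n" by linarith
    then show ?thesis
    proof cases
      case 6
      then show ?thesis using that(5) that(8)[of 5] n vir_obstr \<alpha> by (cases "\<alpha> = - 4") (auto simp: add_eq_0_iff2)
    next
      case 7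
      then show ?thesis using that(6) that(8)[of 6] n by (cases "vir_obstr 6 \<alpha> = 0") auto
    qed (use that n in auto)
  qed (use that in auto)
  then show ?thesis
  proof cases
    case 1
    have "ext_basis a c d \<alpha> \<alpha>' 2 (\<lambda>i. if i = 0 then (1, 0) else (vl, 0))"
    proof (rule ext_basis_2I)
      show "coc a c d \<alpha> \<alpha>' 1 0" unfolding 1 by (rule coc_dvirI) (rule dvir_linear)
      show "coc a c d \<alpha> \<alpha>' vl 0" unfolding 1 by (rule coc_dvirI) (rule dvir_linear)
      show "s = 0 \<and> t = 0" if "cst s * 1 + cst t * vl = cob \<alpha> \<alpha>' \<phi>" for s t \<phi>
        using vir_independent(1)[OF \<alpha>, of s t \<phi>] that 1 by simp
      show "\<exists>s t \<phi>. f = cst s * 1 + cst t * vl + cob \<alpha> \<alpha>' \<phi> \<and> g = cst s * 0 + cst t * 0"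
        if "coc a c d \<alpha> \<alpha>' f g" for f g
      proof -
        have "dvir \<alpha> \<alpha> f z x y = 0" for z x y using coc_dvirD that gz[OF that] 1 by metis
        then obtain s t \<phi> where "f = cst s + cst t * vl + cob \<alpha> \<alpha> \<phi>" using dvir_equal \<alpha> by blast
        then show ?thesis using gz[OF that] 1 by (metis add_0 mult.right_neutral mult_zero_right)
      qed
      show "ext_list a c d \<alpha> \<alpha>' m F G \<longleftrightarrow> m = 2 \<and>
        (\<exists>s t. (s, t) \<noteq> (0, 0) \<and> F = cst s * 1 + cst t * vl \<and> G = cst s * 0 + cst t * 0)" for m F G
        unfolding ext using 1 by (auto simp: vlist_def)
    qed
    then show ?thesis by blast
  next
    case 2
    have "ext_basis a c d \<alpha> \<alpha>' 1 (\<lambda>_. (vir2 1, 0))"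
    proof (rule ext_basis_vir1[of "vir2"])
      show "dvir \<alpha> \<alpha>' (vir2 s) z x y = 0" for z x y s unfolding 2 by (rule dvir_vir2)
      show "vir2 s = cst s * vir2 1" for s by (simp only: vir_scale mult_1_right)
      show "s = 0" if "vir2 s = cob \<alpha> \<alpha>' \<phi>" for s \<phi>
        using vir_independent(2)[OF \<alpha>, of s] that by blast
      show "\<exists>s \<phi>. f = vir2 s + cob \<alpha> \<alpha>' \<phi>" if "\<And>z x y. dvir \<alpha> \<alpha>' f z x y = 0" for f
        using that unfolding 2 by (metis dvir_class2[OF _ \<alpha>])
      show "vlist \<alpha> \<alpha>' m F \<longleftrightarrow> m = 1 \<and> (\<exists>s. s \<noteq> 0 \<and> F = vir2 s)" for m F
        unfolding vlist_def 2 using 2 by simp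
    qed
    then show ?thesis by blast
  next
    case 3
    have "ext_basis a c d \<alpha> \<alpha>' 1 (\<lambda>_. (vir3 1, 0))"
    proof (rule ext_basis_vir1[of "vir3"])
      show "dvir \<alpha> \<alpha>' (vir3 s) z x y = 0" for z x y s unfolding 3 by (rule dvir_vir3)
      show "vir3 s = cst s * vir3 1" for s by (simp only: vir_scale mult_1_right)
      show "s = 0" if "vir3 s = cob \<alpha> \<alpha>' \<phi>" for s \<phi>
        using vir_independent(3)[OF \<alpha>, of s] that by blast
      show "\<exists>s \<phi>. f = vir3 s + cob \<alpha> \<alpha>' \<phi>" if "\<And>z x y. dvir \<alpha> \<alpha>' f z x y = 0" for f
        using that unfolding 3 by (metis dvir_class3[OF _ \<alpha>])
      show "vlist \<alpha> \<alpha>' m F \<longleftrightarrow> m = 1 \<and> (\<exists>s. s \<noteq> 0 \<and> F = vir3 s)" for m F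
        unfolding vlist_def 3 using 3 by simp
    qed
    then show ?thesis by blast
  next
    case 4
    have "ext_basis a c d \<alpha> \<alpha>' 1 (\<lambda>_. (vir4 \<alpha> 1, 0))"
    proof (rule ext_basis_vir1[of "vir4 \<alpha>"])
      show "dvir \<alpha> \<alpha>' (vir4 \<alpha> s) z x y = 0" for z x y s unfolding 4 by (rule dvir_vir4)
      show "vir4 \<alpha> s = cst s * vir4 \<alpha> 1" for s by (simp only: vir_scale mult_1_right)
      show "s = 0" if "vir4 \<alpha> s = cob \<alpha> \<alpha>' \<phi>" for s \<phi>
        using vir_independent(4)[OF \<alpha>, of s] that by blast
      show "\<exists>s \<phi>. f = vir4 \<alpha> s + cob \<alpha> \<alpha>' \<phi>" if "\<And>z x y. dvir \<alpha> \<alpha>' f z x y = 0" for f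
        using that unfolding 4 by (metis dvir_class4[OF _ \<alpha>])
      show "vlist \<alpha> \<alpha>' m F \<longleftrightarrow> m = 1 \<and> (\<exists>s. s \<noteq> 0 \<and> F = vir4 \<alpha> s)" for m F
        unfolding vlist_def 4 using 4 by simp
    qed
    then show ?thesis by blast
  next
    case 5
    have "ext_basis a c d \<alpha> \<alpha>' 1 (\<lambda>_. (vir5 1, 0))"
    proof (rule ext_basis_vir1[of "vir5"])
      show "dvir \<alpha> \<alpha>' (vir5 s) z x y = 0" for z x y s unfolding 5(1) 5(2) by (rule dvir_vir5)
      show "vir5 s = cst s * vir5 1" for s by (simp only: vir_scale mult_1_right)
      show "s = 0" if "vir5 s = cob \<alpha> \<alpha>' \<phi>" for s \<phi>
        using vir_independent(5)[OF \<alpha>, of s] that 5(2) by simp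
      show "\<exists>s \<phi>. f = vir5 s + cob \<alpha> \<alpha>' \<phi>" if "\<And>z x y. dvir \<alpha> \<alpha>' f z x y = 0" for f
        using that unfolding 5(1) 5(2) by (metis dvir_class5)
      show "vlist \<alpha> \<alpha>' m F \<longleftrightarrow> m = 1 \<and> (\<exists>s. s \<noteq> 0 \<and> F = vir5 s)" for m F
        unfolding vlist_def 5(1) 5(2) using 5 by simp
    qed
    then show ?thesis by blast
  next
    case 6
    have "ext_basis a c d \<alpha> \<alpha>' 1 (\<lambda>_. (vir6 \<alpha> 1, 0))"
    proof (rule ext_basis_vir1[of "vir6 \<alpha>"])
      show "dvir \<alpha> \<alpha>' (vir6 \<alpha> s) z x y = 0" for z x y s unfolding 6(1) by (rule dvir_vir6[OF 6(2)])
      show "vir6 \<alpha> s = cst s * vir6 \<alpha> 1" for s by (simp only: vir_scale mult_1_right)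
      show "s = 0" if "vir6 \<alpha> s = cob \<alpha> \<alpha>' \<phi>" for s \<phi>
        using vir_independent(6)[OF \<alpha> 6(2)] that by blast
      show "\<exists>s \<phi>. f = vir6 \<alpha> s + cob \<alpha> \<alpha>' \<phi>" if "\<And>z x y. dvir \<alpha> \<alpha>' f z x y = 0" for f
        using that unfolding 6(1) by (metis dvir_class6[OF _ \<alpha> 6(2)])
      show "vlist \<alpha> \<alpha>' m F \<longleftrightarrow> m = 1 \<and> (\<exists>s. s \<noteq> 0 \<and> F = vir6 \<alpha> s)" for m F
        unfolding vlist_def 6(1) using 6 by simp
    qed
    then show ?thesis by blast
  next
    case 7
    have ne: "\<alpha>' \<noteq> \<alpha> + of_nat n" for n using 7 by (metis add_diff_cancel_left' of_nat_in_Nats)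
    have "\<not> vlist \<alpha> \<alpha>' m F" for m F
      using ne[of 0] ne[of 2] ne[of 3] ne[of 4] ne[of 5] ne[of 6] by (simp add: vlist_def)
    moreover have "\<exists>\<phi>. f = cob \<alpha> \<alpha>' \<phi>" if "coc a c d \<alpha> \<alpha>' f g" for f g
      using dvir_non_nat[OF _ \<alpha> 7, of f] coc_dvirD that gz[OF that] by metis
    ultimately have "ext_basis a c d \<alpha> \<alpha>' 0 (\<lambda>_. 0)" using gz by (intro ext_basis_0I) (auto simp: ext)
    then show ?thesis by blast
  next
    case (8 n)
    have ne: "\<alpha>' = \<alpha> + of_nat j \<Longrightarrow> n = j" for j using 8(1) by simp
    have "\<not> vlist \<alpha> \<alpha>' m F" for m F
      using ne[of 0] ne[of 2] ne[of 3] ne[of 4] ne[of 5] ne[of 6] 8(2,3,4) unfolding vlist_def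
      by auto
    moreover have "\<exists>\<phi>. f = cob \<alpha> \<alpha>' \<phi>" if "coc a c d \<alpha> \<alpha>' f g" for f g
    proof -
      have "dvir \<alpha> (\<alpha> + of_nat n) f z x y = 0" for z x y using coc_dvirD that gz[OF that] 8(1) by metis
      then show ?thesis using dvir_trivial[OF _ \<alpha> 8(2)] 8(1) by metis
    qed
    ultimately have "ext_basis a c d \<alpha> \<alpha>' 0 (\<lambda>_. 0)" using gz by (intro ext_basis_0I) (auto simp: ext)
    then show ?thesis by blast
  qed
qed

end

text \<open>A cocycle minus the multiple of (\<open>F0\<close>, \<open>G0\<close>) with the same
  second component has zero \<open>g\<close>; by assumption it is then a coboundary, so the
  dimension is 1.\<close>

lemma ext_basis_special1:
  assumes F0: "coc a c d \<alpha> \<alpha>' F0 G0" and "G0 \<noteq> 0"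
    and g: "\<And>f g. coc a c d \<alpha> \<alpha>' f g \<Longrightarrow> \<exists>t. g = cst t * G0"
    and v: "\<And>h. (\<And>z x y. dvir \<alpha> \<alpha>' h z x y = 0) \<Longrightarrow> \<exists>\<phi>. h = cob \<alpha> \<alpha>' \<phi>"
    and l: "\<And>m F G. ext_list a c d \<alpha> \<alpha>' m F G \<longleftrightarrow> m = 1 \<and> (\<exists>t. t \<noteq> 0 \<and> F = cst t * F0 \<and> G = cst t * G0)"
  shows "\<exists>n b. ext_basis a c d \<alpha> \<alpha>' n b"
proof -
  have "ext_basis a c d \<alpha> \<alpha>' 1 (\<lambda>_. (F0, G0))"
  proof (rule ext_basis_1I[OF F0 _ _ l])
    show "t = 0" if "cst t * G0 = 0" for t using that \<open>G0 \<noteq> 0\<close> by simp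
    fix f g assume fg: "coc a c d \<alpha> \<alpha>' f g"
    then obtain t where t: "g = cst t * G0" using g by blast
    then obtain \<phi> where "f - cst t * F0 = cob \<alpha> \<alpha>' \<phi>" using v coc_diff_scale[OF fg F0] by blast
    then show "\<exists>t \<phi>. f = cst t * F0 + cob \<alpha> \<alpha>' \<phi> \<and> g = cst t * G0"
      using t by (metis add.commute diff_add_cancel)
  qed
  then show ?thesis by blast
qed

text \<open>As before, except that one class \<open>w\<close> with zero \<open>g\<close> remains. It
  is independent of (\<open>F0\<close>, \<open>G0\<close>) because \<open>G0\<close> \<noteq>
  0.\<close>

lemma ext_basis_special2:
  assumes F0: "coc a c d \<alpha> \<alpha>' F0 G0" and "G0 \<noteq> 0"
    and g: "\<And>f g. coc a c d \<alpha> \<alpha>' f g \<Longrightarrow> \<exists>t. g = cst t * G0"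
    and w: "\<And>z x y. dvir \<alpha> \<alpha>' w z x y = 0" and w0: "\<And>s \<phi>. cst s * w = cob \<alpha> \<alpha>' \<phi> \<Longrightarrow> s = 0"
    and v: "\<And>h. (\<And>z x y. dvir \<alpha> \<alpha>' h z x y = 0) \<Longrightarrow> \<exists>s \<phi>. h = cst s * w + cob \<alpha> \<alpha>' \<phi>"
    and l: "\<And>m F G. ext_list a c d \<alpha> \<alpha>' m F G \<longleftrightarrow> m = 2 \<and>
      (\<exists>s t. (s, t) \<noteq> (0, 0) \<and> F = cst s * w + cst t * F0 \<and> G = cst t * G0)"
  shows "\<exists>n b. ext_basis a c d \<alpha> \<alpha>' n b"
proof -
  have "ext_basis a c d \<alpha> \<alpha>' 2 (\<lambda>i. if i = 0 then (w, 0) else (F0, G0))"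
  proof (rule ext_basis_2I)
    show "coc a c d \<alpha> \<alpha>' w 0" by (rule coc_dvirI) (rule w)
    show "s = 0 \<and> t = 0" if *: "cst s * w + cst t * F0 = cob \<alpha> \<alpha>' \<phi>" "cst s * 0 + cst t * G0 = 0" for s t \<phi>
    proof -
      have "t = 0" using that(2) \<open>G0 \<noteq> 0\<close> by simp
      then show ?thesis using * w0 by simp
    qed
    show "\<exists>s t \<phi>. f = cst s * w + cst t * F0 + cob \<alpha> \<alpha>' \<phi> \<and> g = cst s * 0 + cst t * G0"
      if fg: "coc a c d \<alpha> \<alpha>' f g" for f g
    proof -
      obtain t where t: "g = cst t * G0" using g[OF fg] by blast
      then obtain s \<phi> where "f - cst t * F0 = cst s * w + cob \<alpha> \<alpha>' \<phi>" using v coc_diff_scale[OF fg F0] by blast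
      then have "f = cst s * w + cst t * F0 + cob \<alpha> \<alpha>' \<phi>" by (simp add: algebra_simps)
      then show ?thesis using t by auto
    qed
  qed (use F0 l in auto)
  then show ?thesis by blast
qed

section \<open>Zeros of the obstruction; the algebras with a = 0 and a = 1\<close>

lemma r19_iff: "vir_obstr 6 \<alpha> = 0 \<longleftrightarrow> \<alpha> = - (5 / 2) + r19 / 2 \<or> \<alpha> = - (5 / 2) - r19 / 2"
proof -
  have "r19 ^ 2 = 19" by (simp flip: of_real_power)
  then have "vir_obstr 6 \<alpha> = (\<alpha> + 5 / 2) ^ 2 - (r19 / 2) ^ 2"
    by (simp add: vir_obstr_def power2_eq_square field_simps)
  then have "vir_obstr 6 \<alpha> = 0 \<longleftrightarrow> \<alpha> + 5 / 2 = r19 / 2 \<or> \<alpha> + 5 / 2 = - (r19 / 2)"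
    using power2_eq_iff[of "\<alpha> + 5 / 2" "r19 / 2"] by simp
  moreover have "\<alpha> + b = w \<longleftrightarrow> \<alpha> = - b + w" "- b + - w = - b - w" for b w :: complex
    by (auto simp: algebra_simps)
  ultimately show ?thesis by metis
qed

lemma r22_iff: "vir_obstr 7 \<alpha> = 0 \<longleftrightarrow> \<alpha> = - 3 + r22 / 2 \<or> \<alpha> = - 3 - r22 / 2"
proof -
  have "r22 ^ 2 = 22" by (simp flip: of_real_power)
  then have "vir_obstr 7 \<alpha> = (\<alpha> + 3) ^ 2 - (r22 / 2) ^ 2"
    by (simp add: vir_obstr_def power2_eq_square field_simps)
  then have "vir_obstr 7 \<alpha> = 0 \<longleftrightarrow> \<alpha> + 3 = r22 / 2 \<or> \<alpha> + 3 = - (r22 / 2)"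
    using power2_eq_iff[of "\<alpha> + 3" "r22 / 2"] by simp
  moreover have "\<alpha> + b = w \<longleftrightarrow> \<alpha> = - b + w" "- b + - w = - b - w" for b w :: complex
    by (auto simp: algebra_simps)
  ultimately show ?thesis by metis
qed

lemma Q_poly_simps:
  "Q_poly 1 c d = cst c * (vx + 2 * vl)"
  "Q_poly 0 c d = cst c * (vx + 2 * vl) * (vx + vl) * vl + cst d * (vx + 2 * vl) * vx"
  "Q_poly (- 1) c d = cst c * (vx + 2 * vl) * vx ^ 2 + cst d * (vx + 2 * vl) * (vx + vl) * vx * vl"
  "Q_poly (- 4) c d = cst c * (vx + 2 * vl) * (vx + vl) ^ 3 * vl ^ 3"
  "Q_poly (- 6) c d = cst c * (vx + 2 * vl) *
    (11 * (vx + vl) ^ 4 * vl ^ 4 + 2 * (vx + vl) ^ 3 * vx ^ 2 * vl ^ 3)"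
  unfolding Q_poly_def by simp_all

lemma ev_Q:
  "ev (Q_poly 1 c d) (- x - y) x = c * (x - y)"
  "ev (Q_poly 0 c d) (- x - y) x = c * (x * y ^ 2 - x ^ 2 * y) + d * (y ^ 2 - x ^ 2)"
  "ev (Q_poly (- 1) c d) (- x - y) x =
    c * (x ^ 3 + x ^ 2 * y - x * y ^ 2 - y ^ 3) + d * (x ^ 3 * y - x * y ^ 3)"
  "ev (Q_poly (- 4) c d) (- x - y) x = c * (x ^ 3 * y ^ 4 - x ^ 4 * y ^ 3)"
  "ev (Q_poly (- 6) c d) (- x - y) x =
    c * (2 * (x ^ 3 * y ^ 6) - 9 * (x ^ 4 * y ^ 5) + 9 * (x ^ 5 * y ^ 4) - 2 * (x ^ 6 * y ^ 3))"
  unfolding Q_poly_simps ev_simps by (simp_all add: algebra_simps eval_nat_numeral)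

lemma Q_poly_nonzero:
  "Q_poly 1 c d \<noteq> 0 \<Longrightarrow> c \<noteq> 0" "Q_poly 0 c d \<noteq> 0 \<Longrightarrow> (c, d) \<noteq> (0, 0)"
  "Q_poly (- 1) c d \<noteq> 0 \<Longrightarrow> (c, d) \<noteq> (0, 0)" "Q_poly (- 4) c d \<noteq> 0 \<Longrightarrow> c \<noteq> 0"
  "Q_poly (- 6) c d \<noteq> 0 \<Longrightarrow> c \<noteq> 0"
  unfolding Q_poly_simps by auto

lemma dgen_multiple:
  assumes "dgen (- of_nat b) \<alpha> \<alpha>' g" "dgen (- of_nat b) \<alpha> \<alpha>' h" "\<alpha>' - \<alpha> - of_nat b - 1 = of_nat k"
    and "cf h 0 k = 1"
  shows "g = cst (cf g 0 k) * h"
proof -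
  have "g - cst (cf g 0 k) * h = 0"
    by (rule dgen_lead[OF dgen_diff[OF assms(1) dgen_scale[OF assms(2)]] assms(3)]) (use assms(4) in simp)
  then show ?thesis by simp
qed

lemma dgen_nat:
  assumes "dgen (- of_nat b) \<alpha> \<alpha>' g" "g \<noteq> 0"
  obtains k where "\<alpha>' - \<alpha> - of_nat b - 1 = of_nat k"
proof -
  have "\<alpha>' - \<alpha> + - of_nat b - 1 \<in> \<nat>" using dgen_zero[OF assms(1)] assms(2) by blast
  then show ?thesis using that by (auto elim: Nats_cases)
qed

lemma cocD:
  assumes "coc a c d \<alpha> \<alpha>' f g"
  shows "dvir \<alpha> \<alpha>' f z x y = ev (Q_poly a c d) (- x - y) x * ev g z (x + y)" "dgen a \<alpha> \<alpha>' g"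
  using assms by (auto simp: coc_def)

lemma dgen_const: "dgen a \<alpha> (\<alpha> + 1 - a) (cst t)"
  unfolding dgen_def ev_simps by (simp add: algebra_simps)

lemma dgen_deg1:
  assumes "a \<noteq> 1"
  shows "dgen a \<alpha> (\<alpha> + 2 - a) (vx + cst (\<alpha> / (a - 1)) * vl)"
proof -
  have "a - 1 \<noteq> 0" using assms by simp
  then show ?thesis unfolding dgen_def ev_simps by (intro allI) (simp add: divide_simps, simp add: algebra_simps)
qed

lemma dgen_homogeneous:
  assumes "dgen (- of_nat b) \<alpha> \<alpha>' g" "\<alpha>' - \<alpha> - of_nat b - 1 = of_nat k" "r + p \<noteq> k"
  shows "cf g r p = 0"
proof -
  have "of_nat (r + p) - (\<alpha>' - \<alpha> + - of_nat b - 1) \<noteq> 0"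
    using assms(2,3) by (metis add_uminus_conv_diff eq_iff_diff_eq_0 of_nat_eq_iff)
  then show ?thesis using dgen_euler[OF assms(1), of r p] by simp
qed

lemma tri_0_imp: "tri F c \<Longrightarrow> (\<And>p s r. c p s r = 0) \<Longrightarrow> F z x y = 0"
  unfolding tri_def
  apply (elim exE conjE)
  subgoal for P
    apply (subgoal_tac "P = 0")
    subgoal by simp
    subgoal by (intro poly_eqI) simp
    done
  done

text \<open>At y = 0 the hypothesis says nothing pointwise; the coefficients, however, are merely
  shifted by the multiplication with y.\<close>

lemma tri_y_cancel:
  assumes "tri F c" "\<And>z x y. y * F z x y = 0" shows "F z x y = 0"
proof (rule tri_0_imp[OF assms(1)])
  fix p s r
  show "c p s r = 0"
    using tri_unique[OF tri_y[OF assms(1)] tri_cong[OF tri_0 assms(2) refl], where p = p and s = s and r = "Suc r"] by simp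
qed

text \<open>Two relations must agree on one coefficient of \<open>f\<close>: at \<lambda>^0 they see
  the part of \<open>Q\<close> with \<open>d\<close>, and at \<lambda>^1, in the critical degree,
  the part with \<open>c\<close>. If \<open>g\<close> has degree 1 they force \<alpha> = -1. If it
  has degree 2, where \<alpha> = -2 is already known, they annihilate both \<open>c\<close> and
  \<open>d\<close> times the leading coefficient.\<close>

lemma coc_0_dgen:
  assumes co: "coc 0 c d \<alpha> \<alpha>' f g" and "g \<noteq> 0" and cd: "(c, d) \<noteq> (0, 0)" and \<alpha>: "\<alpha> \<noteq> 0"
  shows "\<alpha>' = \<alpha> + 1 \<and> (\<exists>t. g = cst t) \<or> \<alpha> = - 1 \<and> \<alpha>' = 1 \<and> (\<exists>t. g = cst t * (vx + vl))"
proof -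
  have g: "dgen (- of_nat 0) \<alpha> \<alpha>' g" using co by (simp add: coc_def)
  obtain k where k: "\<alpha>' - \<alpha> - of_nat 0 - 1 = of_nat k" using dgen_nat[OF g \<open>g \<noteq> 0\<close>] .
  have nz: "cf g 0 k \<noteq> 0" using dgen_lead[OF g k] \<open>g \<noteq> 0\<close> by blast
  note q = tri_add[OF tri_scale[OF tri_diff[OF tri_qmon[of 1 2 g] tri_qmon[of 2 1 g]], of c]
    tri_scale[OF tri_diff[OF tri_qmon[of 0 2 g] tri_qmon[of 2 0 g]], of d]]
  have H: "dvir \<alpha> \<alpha>' f z x y = c * (x ^ 1 * (y ^ 2 * ev g z (x + y)) - x ^ 2 * (y ^ 1 * ev g z (x + y)))
    + d * (x ^ 0 * (y ^ 2 * ev g z (x + y)) - x ^ 2 * (y ^ 0 * ev g z (x + y)))" for z x y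
    unfolding cocD(1)[OF co] ev_Q by (simp add: algebra_simps)
  note hom = dgen_homogeneous[OF g k]
  consider "k = 0" | "k = 1" | "k = 2" "\<alpha> = - 2" using dgen_degree[OF g k \<open>g \<noteq> 0\<close> \<alpha>] by force
  then show ?thesis
  proof cases
    case 1
    then have "\<alpha>' = \<alpha> + 1" using k by (simp add: algebra_simps)
    then show ?thesis
      using dgen_multiple[OF g _ k, of "cst 1"] dgen_const[of 0 \<alpha> 1] 1 by auto
  next
    case 2
    have a': "\<alpha>' = \<alpha> + 2" using k 2 by (simp add: algebra_simps)
    have "\<alpha> * cf g 0 1 = - cf g (Suc 0) 0"
      using dgen_rel[OF g, of 2 0 1] by (simp add: wt_numeral binomial_eq_0)
    then have g1: "cf g (Suc 0) 0 = - \<alpha> * cf g 0 1" by simp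
    have "\<alpha> * cf f 0 2 = \<alpha> * (d * cf g 0 1)" "(1 + 2 * \<alpha>) * cf f 0 2 = - d * cf g 0 1"
      using rel_0s[OF H q, of 3 2] rel_0s[OF H q, of 2 2] 2 by (simp_all add: wt_small qmon_def g1 hom)
    then have "2 * (d * cf g 0 1 * (1 + \<alpha>)) = 0" using \<alpha> by (simp add: algebra_simps)
    then have "d * cf g 0 1 * (1 + \<alpha>) = 0" by simp
    moreover have "\<alpha> * cf f 1 2 = \<alpha> * (c * cf g 0 1)" "(1 + 2 * \<alpha>) * cf f 1 2 = - c * cf g 0 1"
      using rel_1s[OF H q, of 3 3] rel_1s[OF H q, of 2 3] a' 2 by (simp_all add: wt_small qmon_def g1 hom)
    then have "2 * (c * cf g 0 1 * (1 + \<alpha>)) = 0" using \<alpha> by (simp add: algebra_simps)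
    then have "c * cf g 0 1 * (1 + \<alpha>) = 0" by simp
    ultimately have "1 + \<alpha> = 0" using cd nz 2 by auto
    then have \<alpha>1: "\<alpha> = - 1" by (simp add: eq_neg_iff_add_eq_0 add.commute)
    have "dgen (- of_nat 0) \<alpha> \<alpha>' (vx + cst 1 * vl)"
      using dgen_deg1[of 0 \<alpha>] a' \<alpha>1 by simp
    from dgen_multiple[OF g this k] 2 \<alpha>1 a' show ?thesis by auto
  next
    case 3
    have a': "\<alpha>' = 1" using k 3 by (simp add: algebra_simps)
    have g1: "cf g (Suc 0) (Suc 0) = 3 * cf g 0 2"
      using dgen_rel[OF g, of 2 0 2] 3 by (simp add: wt_numeral binomial_eq_0)
    have lin: "w = 0" if "- 5 * F = - 3 * w" "- 3 * F = - w" for F w :: complex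
    proof -
      have w: "w = 3 * F" using that(2) by simp
      have "F = 0" using that(1) unfolding w by simp
      then show "w = 0" using w by simp
    qed
    have "- 5 * cf f 0 3 = - 3 * (d * cf g 0 2)" "- 3 * cf f 0 3 = - (d * cf g 0 2)"
      using rel_0s[OF H q, of 3 3] rel_0s[OF H q, of 2 3] 3 by (simp_all add: wt_small qmon_def g1 hom)
    then have "d * cf g 0 2 = 0" by (rule lin)
    moreover have "- 5 * cf f 1 3 = - 3 * (c * cf g 0 2)" "- 3 * cf f 1 3 = - (c * cf g 0 2)"
      using rel_1s[OF H q, of 3 4] rel_1s[OF H q, of 2 4] 3 a' by (simp_all add: wt_small qmon_def g1 hom)
    then have "c * cf g 0 2 = 0" by (rule lin)
    ultimately show ?thesis using cd nz 3 by auto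
  qed
qed

text \<open>For a = 1 the recursion from the leading coefficient breaks down, its first factor being
  a - 1 = 0. Instead \<open>g\<close> is divisible by \<lambda>, and c (x - y) (x + y) is the value
  of \<open>Q\<close> for a = 0 with parameters 0 and -c.\<close>

lemma coc_1_reduce:
  assumes co: "coc 1 c d \<alpha> \<alpha>' f g" and "c \<noteq> 0" and \<alpha>: "\<alpha> \<noteq> 0"
  obtains h where "g = vl * h" "coc 0 0 (- c) \<alpha> \<alpha>' f h"
proof -
  have g: "dgen 1 \<alpha> \<alpha>' g" using co by (simp add: coc_def)
  have c0: "coeff g 0 = 0"
  proof (rule poly_eqI)
    fix p
    show "cf g 0 p = coeff 0 p"
    proof (cases p)
      \<comment> \<open>The Euler relation permits a constant term only if \<alpha>' = \<alpha>. In
        that case the coefficient at x of the equation for \<open>f\<close> reduces to c times this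
        term being 0.\<close>
      case 0
      note q = tri_scale[OF tri_diff[OF tri_qmon[of 1 0 g] tri_qmon[of 0 1 g]], of c]
      have H: "dvir \<alpha> \<alpha>' f z x y = c * (x ^ 1 * (y ^ 0 * ev g z (x + y)) - x ^ 0 * (y ^ 1 * ev g z (x + y)))" for z x y
        unfolding cocD(1)[OF co] ev_Q by (simp add: algebra_simps)
      show ?thesis
        using rel_01[OF H q, of 0] dgen_euler[OF g, of 0 0] 0 \<open>c \<noteq> 0\<close> by (auto simp: qmon_def)
    next
      case (Suc j)
      have "\<alpha> * cf g 0 p = 0"
        using dgen_rel[OF g, of "Suc p" 0 p] Suc wt_top[of \<alpha> p] by (simp add: binomial_eq_0)
      then show ?thesis using \<alpha> by simp
    qed
  qed
  obtain h where h: "g = pCons 0 h" using c0 by (cases g) auto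
  have gh: "ev g z x = x * ev h z x" for z x by (simp add: h ev_pCons)
  have "dgen 0 \<alpha> \<alpha>' h"
  proof -
    let ?F = "\<lambda>z x y. z * ev h (z + x) y + \<alpha> * (x * ev h (z + x) y)
      - (z * ev h z y + y * ev h z y + \<alpha>' * (x * ev h z y)) + (x * ev h z (x + y) + y * ev h z (x + y))"
    note t = tri_ev_y[of h] and zx = tri_ev_zx_y[of h] and xy = tri_ev_xy[of h]
    note tF = tri_add[OF tri_diff[OF tri_add[OF tri_z[OF zx] tri_scale[OF tri_x[OF zx], of \<alpha>]]
      tri_add[OF tri_add[OF tri_z[OF t] tri_y[OF t]] tri_scale[OF tri_x[OF t], of \<alpha>']]]
      tri_add[OF tri_x[OF xy] tri_y[OF xy]]]
    have "y * ?F z x y = ((z + \<alpha> * x) * ev g (z + x) y - (z + y + \<alpha>' * x) * ev g z y)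
      - ((1 - 1) * x - y) * ev g z (x + y)" for z x y
      unfolding gh by (simp add: algebra_simps)
    then have "y * ?F z x y = 0" for z x y
      using g unfolding dgen_def by simp
    then have "?F z x y = 0" for z x y using tri_y_cancel[OF tF] by blast
    then show ?thesis unfolding dgen_def by (simp add: algebra_simps)
  qed
  then have "coc 0 0 (- c) \<alpha> \<alpha>' f h"
    unfolding coc_def cocD(1)[OF co] ev_Q gh by (simp add: algebra_simps power2_eq_square)
  then show ?thesis using that[of h] h by simp
qed

lemma coc_0_const:
  assumes "\<alpha> \<noteq> 0"
  shows "coc 0 c d \<alpha> (\<alpha> + 1) (- cst (c / \<alpha>) * vx * vl - cst (d / \<alpha>) * vx) 1"
proof -
  have "dgen 0 \<alpha> (\<alpha> + 1) 1" using dgen_const[of 0 \<alpha> 1] by (simp add: one_pCons)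
  then show ?thesis
    using assms unfolding coc_def dvir_def ev_Q ev_simps
    by (intro conjI allI) (simp_all add: field_simps power2_eq_square)
qed

lemma coc_0_linear:
  "coc 0 c d (- 1) 1 (cst c * vx ^ 2 * vl + cst d * (vx ^ 2 - vl ^ 2)) (vx + vl)"
proof -
  have "dgen 0 (- 1) 1 (vx + vl)" using dgen_deg1[of 0 "- 1"] by (simp add: one_pCons)
  then show ?thesis
    unfolding coc_def dvir_def ev_Q ev_simps
    by (intro conjI allI) (simp_all add: algebra_simps eval_nat_numeral)
qed

lemma coc_1_of_0:
  assumes "coc 0 0 (- c) \<alpha> \<alpha>' f h" shows "coc 1 c d \<alpha> \<alpha>' f (vl * h)"
  unfolding coc_def dgen_def
proof (intro conjI allI)
  fix z x y
  have *: "(z + \<alpha> * x) * ev h (z + x) y - (z + y + \<alpha>' * x) * ev h z y = (- x - y) * ev h z (x + y)"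
    using assms unfolding coc_def dgen_def by simp
  have "(z + \<alpha> * x) * ev (vl * h) (z + x) y - (z + y + \<alpha>' * x) * ev (vl * h) z y =
    y * ((z + \<alpha> * x) * ev h (z + x) y - (z + y + \<alpha>' * x) * ev h z y)"
    unfolding ev_simps by (simp add: algebra_simps)
  also have "\<dots> = ((1 - 1) * x - y) * ev (vl * h) z (x + y)"
    unfolding * ev_simps by (simp add: algebra_simps)
  finally show "(z + \<alpha> * x) * ev (vl * h) (z + x) y - (z + y + \<alpha>' * x) * ev (vl * h) z y =
    ((1 - 1) * x - y) * ev (vl * h) z (x + y)" .
  show "dvir \<alpha> \<alpha>' f z x y = ev (Q_poly 1 c d) (- x - y) x * ev (vl * h) z (x + y)"
    unfolding cocD(1)[OF assms] ev_Q ev_simps by (simp add: algebra_simps power2_eq_square)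
qed

lemma ext_list_viii:
  assumes "vir_obstr 6 \<alpha> = 0" "s \<noteq> 0"
  shows "ext_list 1 c d \<alpha> (\<alpha> + 6) 1 (vir6 \<alpha> s) 0" "ext_list 0 c d \<alpha> (\<alpha> + 6) 1 (vir6 \<alpha> s) 0"
    "ext_list (- 1) c d \<alpha> (\<alpha> + 6) 1 (vir6 \<alpha> s) 0" "ext_list (- 4) c d \<alpha> (\<alpha> + 6) 1 (vir6 \<alpha> s) 0"
    "ext_list (- 6) c d \<alpha> (\<alpha> + 6) 1 (vir6 \<alpha> s) 0"
proof -
  obtain \<epsilon> :: complex where e: "\<epsilon> \<in> {1, - 1}" "\<alpha> = - (5 / 2) + \<epsilon> * r19 / 2"
  proof -
    from assms(1) have "\<exists>\<epsilon>\<in>{1, - 1 :: complex}. \<alpha> = - (5 / 2) + \<epsilon> * r19 / 2"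
      unfolding r19_iff
    proof (elim disjE)
      assume "\<alpha> = - (5 / 2) + r19 / 2"
      then show ?thesis by (intro bexI[of _ 1]) auto
    next
      assume "\<alpha> = - (5 / 2) - r19 / 2"
      then show ?thesis by (intro bexI[of _ "- 1"]) auto
    qed
    then show ?thesis using that by blast
  qed
  then have e': "\<alpha> + 6 = 7 / 2 + \<epsilon> * r19 / 2" by simp
  note i = e e' assms(2)
  show "ext_list 1 c d \<alpha> (\<alpha> + 6) 1 (vir6 \<alpha> s) 0" "ext_list 0 c d \<alpha> (\<alpha> + 6) 1 (vir6 \<alpha> s) 0"
    "ext_list (- 1) c d \<alpha> (\<alpha> + 6) 1 (vir6 \<alpha> s) 0" "ext_list (- 4) c d \<alpha> (\<alpha> + 6) 1 (vir6 \<alpha> s) 0"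
    "ext_list (- 6) c d \<alpha> (\<alpha> + 6) 1 (vir6 \<alpha> s) 0"
    by (rule a1_viii[OF i] a0_viii[OF i] am1_viii[OF i] a4_x[OF i] a6_vi[OF i])+
qed

lemma r19_roots:
  "vir_obstr 6 (r19 / 2 - 5 / 2) = 0" "vir_obstr 6 (- (r19 / 2) - 5 / 2) = 0"
  by (simp_all add: r19_iff)

text \<open>When the list is inverted, this keeps \<alpha>' of the entries with the root of 19 apart
  from the values 1, 2, 7 and 3/2 of other entries.\<close>

lemma r19_distinct:
  assumes "(2 * q - 7) ^ 2 \<noteq> 19" shows "7 / 2 + r19 / 2 \<noteq> q" "7 / 2 - r19 / 2 \<noteq> q"
proof -
  have r: "r19 ^ 2 = 19" by (simp flip: of_real_power)
  show "7 / 2 + r19 / 2 \<noteq> q"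
  proof
    assume "7 / 2 + r19 / 2 = q"
    then have "2 * q - 7 = r19" by (auto simp: field_simps)
    then show False using assms r by metis
  qed
  show "7 / 2 - r19 / 2 \<noteq> q"
  proof
    assume "7 / 2 - r19 / 2 = q"
    then have "2 * q - 7 = - r19" by (auto simp: field_simps)
    then show False using assms r by simp
  qed
qed

lemmas r19_simps = r19_roots r19_distinct[of 1, simplified] r19_distinct[of 2, simplified]
  r19_distinct[of 7, simplified] r19_distinct[of "3 / 2", simplified]

text \<open>At the excluded parameters the dimension is 2, and the pairs with G = 0 appear there as
  the case t = 0 of an entry with two parameters.\<close>

lemma ext_list_vlist:
  assumes "vlist \<alpha> \<alpha>' m F"
  shows "\<not> (\<alpha> = - 1 \<and> \<alpha>' = 1) \<Longrightarrow> ext_list 1 c d \<alpha> \<alpha>' m F 0"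
    and "\<not> (\<alpha> = - 1 \<and> \<alpha>' = 1) \<Longrightarrow> ext_list 0 c d \<alpha> \<alpha>' m F 0"
    and "\<not> (\<alpha> = - (1 / 2) \<and> \<alpha>' = 3 / 2) \<Longrightarrow> \<not> (\<alpha> = - 1 \<and> \<alpha>' = 2) \<Longrightarrow> ext_list (- 1) c d \<alpha> \<alpha>' m F 0"
    and "ext_list (- 4) c d \<alpha> \<alpha>' m F 0"
    and "ext_list (- 6) c d \<alpha> \<alpha>' m F 0"
proof -
  have [simp]: "\<alpha> = - 1 \<Longrightarrow> \<alpha> + 2 = 1" "\<alpha> = - (1 / 2) \<Longrightarrow> \<alpha> + 2 = 3 / 2" "\<alpha> = - 1 \<Longrightarrow> \<alpha> + 3 = 2"
    by simp_all
  note d = assms[unfolded vlist_def]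
  show "ext_list 1 c d \<alpha> \<alpha>' m F 0" if that: "\<not> (\<alpha> = - 1 \<and> \<alpha>' = 1)"
    using d
  proof (elim disjE conjE exE)
    fix s0 s1 assume *: "\<alpha>' = \<alpha>" "m = 2" "(s0, s1) \<noteq> (0, 0)" "F = cst s0 + cst s1 * vl"
    show ?thesis unfolding *(1,2,4) by (rule a1_i, rule *(3))
  next
    fix s assume *: "\<alpha>' = \<alpha> + 2" "m = 1" "s \<noteq> 0" "F = vir2 s"
    show ?thesis unfolding *(1,2,4) by (rule a1_iii) (use * that in auto)
  next
    fix s assume *: "\<alpha>' = \<alpha> + 3" "m = 1" "s \<noteq> 0" "F = vir3 s"
    show ?thesis unfolding *(1,2,4) by (rule a1_v) (use *  in auto)
  next
    fix s assume *: "\<alpha>' = \<alpha> + 4" "m = 1" "s \<noteq> 0" "F = vir4 \<alpha> s"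
    show ?thesis unfolding *(1,2,4) by (rule a1_vi, rule *(3))
  next
    fix s assume *: "\<alpha>' = \<alpha> + 5" "\<alpha> = - 4" "m = 1" "s \<noteq> 0" "F = vir5 s"
    then show ?thesis using a1_vii[OF *(4)] by simp
  next
    fix s assume *: "\<alpha>' = \<alpha> + 6" "vir_obstr 6 \<alpha> = 0" "m = 1" "s \<noteq> 0" "F = vir6 \<alpha> s"
    show ?thesis unfolding *(1,3,5) by (rule ext_list_viii, rule *(2), rule *(4))
  qed
  show "ext_list 0 c d \<alpha> \<alpha>' m F 0" if that: "\<not> (\<alpha> = - 1 \<and> \<alpha>' = 1)"
    using d
  proof (elim disjE conjE exE)
    fix s0 s1 assume *: "\<alpha>' = \<alpha>" "m = 2" "(s0, s1) \<noteq> (0, 0)" "F = cst s0 + cst s1 * vl"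
    show ?thesis unfolding *(1,2,4) by (rule a0_i, rule *(3))
  next
    fix s assume *: "\<alpha>' = \<alpha> + 2" "m = 1" "s \<noteq> 0" "F = vir2 s"
    show ?thesis unfolding *(1,2,4) by (rule a0_iii) (use * that in auto)
  next
    fix s assume *: "\<alpha>' = \<alpha> + 3" "m = 1" "s \<noteq> 0" "F = vir3 s"
    show ?thesis unfolding *(1,2,4) by (rule a0_v) (use *  in auto)
  next
    fix s assume *: "\<alpha>' = \<alpha> + 4" "m = 1" "s \<noteq> 0" "F = vir4 \<alpha> s"
    show ?thesis unfolding *(1,2,4) by (rule a0_vi, rule *(3))
  next
    fix s assume *: "\<alpha>' = \<alpha> + 5" "\<alpha> = - 4" "m = 1" "s \<noteq> 0" "F = vir5 s"
    then show ?thesis using a0_vii[OF *(4)] by simp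
  next
    fix s assume *: "\<alpha>' = \<alpha> + 6" "vir_obstr 6 \<alpha> = 0" "m = 1" "s \<noteq> 0" "F = vir6 \<alpha> s"
    show ?thesis unfolding *(1,3,5) by (rule ext_list_viii, rule *(2), rule *(4))
  qed
  show "ext_list (- 1) c d \<alpha> \<alpha>' m F 0" if that: "\<not> (\<alpha> = - (1 / 2) \<and> \<alpha>' = 3 / 2)" "\<not> (\<alpha> = - 1 \<and> \<alpha>' = 2)"
    using d
  proof (elim disjE conjE exE)
    fix s0 s1 assume *: "\<alpha>' = \<alpha>" "m = 2" "(s0, s1) \<noteq> (0, 0)" "F = cst s0 + cst s1 * vl"
    show ?thesis unfolding *(1,2,4) by (rule am1_i, rule *(3))
  next
    fix s assume *: "\<alpha>' = \<alpha> + 2" "m = 1" "s \<noteq> 0" "F = vir2 s"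
    show ?thesis unfolding *(1,2,4) by (rule am1_ii) (use * that in auto)
  next
    fix s assume *: "\<alpha>' = \<alpha> + 3" "m = 1" "s \<noteq> 0" "F = vir3 s"
    show ?thesis unfolding *(1,2,4) by (rule am1_iv) (use * that in auto)
  next
    fix s assume *: "\<alpha>' = \<alpha> + 4" "m = 1" "s \<noteq> 0" "F = vir4 \<alpha> s"
    show ?thesis unfolding *(1,2,4) by (rule am1_vi, rule *(3))
  next
    fix s assume *: "\<alpha>' = \<alpha> + 5" "\<alpha> = - 4" "m = 1" "s \<noteq> 0" "F = vir5 s"
    then show ?thesis using am1_vii[OF *(4)] by simp
  next
    fix s assume *: "\<alpha>' = \<alpha> + 6" "vir_obstr 6 \<alpha> = 0" "m = 1" "s \<noteq> 0" "F = vir6 \<alpha> s"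
    show ?thesis unfolding *(1,3,5) by (rule ext_list_viii, rule *(2), rule *(4))
  qed
  show "ext_list (- 4) c d \<alpha> \<alpha>' m F 0"
    using d
  proof (elim disjE conjE exE)
    fix s0 s1 assume *: "\<alpha>' = \<alpha>" "m = 2" "(s0, s1) \<noteq> (0, 0)" "F = cst s0 + cst s1 * vl"
    show ?thesis unfolding *(1,2,4) by (rule a4_i, rule *(3))
  next
    fix s assume *: "\<alpha>' = \<alpha> + 2" "m = 1" "s \<noteq> 0" "F = vir2 s"
    show ?thesis unfolding *(1,2,4) by (rule a4_ii) (use *  in auto)
  next
    fix s assume *: "\<alpha>' = \<alpha> + 3" "m = 1" "s \<noteq> 0" "F = vir3 s"
    show ?thesis unfolding *(1,2,4) by (rule a4_iii) (use *  in auto)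
  next
    fix s assume *: "\<alpha>' = \<alpha> + 4" "m = 1" "s \<noteq> 0" "F = vir4 \<alpha> s"
    show ?thesis unfolding *(1,2,4) by (rule a4_iv, rule *(3))
  next
    fix s assume *: "\<alpha>' = \<alpha> + 5" "\<alpha> = - 4" "m = 1" "s \<noteq> 0" "F = vir5 s"
    then show ?thesis using a4_vii[OF *(4)] by simp
  next
    fix s assume *: "\<alpha>' = \<alpha> + 6" "vir_obstr 6 \<alpha> = 0" "m = 1" "s \<noteq> 0" "F = vir6 \<alpha> s"
    show ?thesis unfolding *(1,3,5) by (rule ext_list_viii, rule *(2), rule *(4))
  qed
  show "ext_list (- 6) c d \<alpha> \<alpha>' m F 0"
    using d
  proof (elim disjE conjE exE)
    fix s0 s1 assume *: "\<alpha>' = \<alpha>" "m = 2" "(s0, s1) \<noteq> (0, 0)" "F = cst s0 + cst s1 * vl"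
    show ?thesis unfolding *(1,2,4) by (rule a6_i, rule *(3))
  next
    fix s assume *: "\<alpha>' = \<alpha> + 2" "m = 1" "s \<noteq> 0" "F = vir2 s"
    show ?thesis unfolding *(1,2,4) by (rule a6_ii) (use *  in auto)
  next
    fix s assume *: "\<alpha>' = \<alpha> + 3" "m = 1" "s \<noteq> 0" "F = vir3 s"
    show ?thesis unfolding *(1,2,4) by (rule a6_iii) (use *  in auto)
  next
    fix s assume *: "\<alpha>' = \<alpha> + 4" "m = 1" "s \<noteq> 0" "F = vir4 \<alpha> s"
    show ?thesis unfolding *(1,2,4) by (rule a6_iv, rule *(3))
  next
    fix s assume *: "\<alpha>' = \<alpha> + 5" "\<alpha> = - 4" "m = 1" "s \<noteq> 0" "F = vir5 s"
    then show ?thesis using a6_v[OF *(4)] by simp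
  next
    fix s assume *: "\<alpha>' = \<alpha> + 6" "vir_obstr 6 \<alpha> = 0" "m = 1" "s \<noteq> 0" "F = vir6 \<alpha> s"
    show ?thesis unfolding *(1,3,5) by (rule ext_list_viii, rule *(2), rule *(4))
  qed
qed

text \<open>An inversion of the list for fixed parameters, in the shape demanded by
  \<open>ext_basis\<close>. The two exceptional cases are disjoint, since - 1 + 1 \<noteq>
  1.\<close>

lemma ext_list_0:
  "ext_list 0 c d \<alpha> \<alpha>' m F G \<longleftrightarrow>
    (if \<alpha>' = \<alpha> + 1 then m = 1 \<and> (\<exists>t. t \<noteq> 0 \<and> F = - cst (c * t / \<alpha>) * vx * vl - cst (d * t / \<alpha>) * vx \<and> G = cst t)
     else if \<alpha> = - 1 \<and> \<alpha>' = 1 then m = 2 \<and> (\<exists>s t. (s, t) \<noteq> (0, 0) \<and>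
       F = vir2 s + cst (c * t) * vx ^ 2 * vl + cst (d * t) * (vx ^ 2 - vl ^ 2) \<and> G = cst t * (vx + vl))
     else vlist \<alpha> \<alpha>' m F \<and> G = 0)" (is "_ \<longleftrightarrow> ?R")
proof
  assume "ext_list 0 c d \<alpha> \<alpha>' m F G"
  then show ?R
    by (cases rule: ext_list.cases) (auto simp: vlist_def r19_simps)
next
  assume R: ?R
  consider "\<alpha>' = \<alpha> + 1" | "\<alpha> = - 1" "\<alpha>' = 1" | "\<alpha>' \<noteq> \<alpha> + 1" "\<not> (\<alpha> = - 1 \<and> \<alpha>' = 1)" by blast
  then show "ext_list 0 c d \<alpha> \<alpha>' m F G"
  proof cases
    case 1
    show ?thesis using R unfolding 1 by (simp only: refl if_True) (elim conjE exE, hypsubst, rule a0_ii)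
  next
    case 2
    then have "\<alpha>' \<noteq> \<alpha> + 1" by simp
    then have "m = 2 \<and> (\<exists>s t. (s, t) \<noteq> (0, 0) \<and> F = vir2 s + cst (c * t) * vx ^ 2 * vl + cst (d * t) * (vx ^ 2 - vl ^ 2) \<and> G = cst t * (vx + vl))"
      using R 2 by (simp only: if_False if_True refl simp_thms)
    then show ?thesis unfolding 2 by (elim conjE exE) (hypsubst, rule a0_iv)
  next
    case 3
    then have "vlist \<alpha> \<alpha>' m F" "G = 0" using R by (simp_all only: if_False simp_thms)
    then show ?thesis using ext_list_vlist(2) 3(2) by metis
  qed
qed

lemma ext_list_1:
  "ext_list 1 c d \<alpha> \<alpha>' m F G \<longleftrightarrow>
    (if \<alpha>' = \<alpha> + 1 then m = 1 \<and> (\<exists>t. t \<noteq> 0 \<and> F = cst (c * t / \<alpha>) * vx \<and> G = cst t * vl)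
     else if \<alpha> = - 1 \<and> \<alpha>' = 1 then m = 2 \<and> (\<exists>s t. (s, t) \<noteq> (0, 0) \<and>
       F = vir2 s - cst (c * t) * (vx ^ 2 - vl ^ 2) \<and> G = cst t * (vx * vl + vl ^ 2))
     else vlist \<alpha> \<alpha>' m F \<and> G = 0)" (is "_ \<longleftrightarrow> ?R")
proof
  assume "ext_list 1 c d \<alpha> \<alpha>' m F G"
  then show ?R
    by (cases rule: ext_list.cases) (auto simp: vlist_def r19_simps)
next
  assume R: ?R
  consider "\<alpha>' = \<alpha> + 1" | "\<alpha> = - 1" "\<alpha>' = 1" | "\<alpha>' \<noteq> \<alpha> + 1" "\<not> (\<alpha> = - 1 \<and> \<alpha>' = 1)" by blast
  then show "ext_list 1 c d \<alpha> \<alpha>' m F G"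
  proof cases
    case 1
    show ?thesis using R unfolding 1 by (simp only: refl if_True) (elim conjE exE, hypsubst, rule a1_ii)
  next
    case 2
    then have "\<alpha>' \<noteq> \<alpha> + 1" by simp
    then have "m = 2 \<and> (\<exists>s t. (s, t) \<noteq> (0, 0) \<and> F = vir2 s - cst (c * t) * (vx ^ 2 - vl ^ 2) \<and> G = cst t * (vx * vl + vl ^ 2))"
      using R 2 by (simp only: if_False if_True refl simp_thms)
    then show ?thesis unfolding 2 by (elim conjE exE) (hypsubst, rule a1_iv)
  next
    case 3
    then have "vlist \<alpha> \<alpha>' m F" "G = 0" using R by (simp_all only: if_False simp_thms)
    then show ?thesis using ext_list_vlist(1) 3(2) by metis
  qed
qed

lemma dvir_trivial1: "(\<And>z x y. dvir \<alpha> (\<alpha> + 1) h z x y = 0) \<Longrightarrow> \<alpha> \<noteq> 0 \<Longrightarrow> \<exists>\<phi>. h = cob \<alpha> (\<alpha> + 1) \<phi>"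
  using dvir_trivial[of \<alpha> 1 h] by (metis of_nat_1)

lemma cst_times_1: "cst t * 1 = cst t"
  by simp

lemma vir_unit: "cst s * vir2 1 = vir2 s" "cst s * vir3 1 = vir3 s"
  by (simp_all only: vir_scale mult_1_right)

lemma ext_basis_a0:
  assumes \<alpha>: "\<alpha> \<noteq> 0" and cd: "(c, d) \<noteq> (0, 0)"
  shows "\<exists>n b. ext_basis 0 c d \<alpha> \<alpha>' n b"
proof -
  note g = coc_0_dgen[OF _ _ cd \<alpha>]
  consider "\<alpha>' = \<alpha> + 1" | "\<alpha> = - 1" "\<alpha>' = 1" | "\<alpha>' \<noteq> \<alpha> + 1" "\<not> (\<alpha> = - 1 \<and> \<alpha>' = 1)" by blast
  then show ?thesis
  proof cases
    case 1
    show ?thesis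
      unfolding 1
    proof (rule ext_basis_special1[OF coc_0_const[OF \<alpha>]])
      show "\<exists>t. g = cst t * 1" if "coc 0 c d \<alpha> (\<alpha> + 1) f g" for f g
      proof (cases "g = 0")
        case True
        then show ?thesis by (intro exI[of _ 0]) simp
      next
        case False
        then show ?thesis using g[OF that False] unfolding cst_times_1 by auto
      qed
      show "ext_list 0 c d \<alpha> (\<alpha> + 1) m F G \<longleftrightarrow> m = 1 \<and> (\<exists>t. t \<noteq> 0 \<and>
        F = cst t * (- cst (c / \<alpha>) * vx * vl - cst (d / \<alpha>) * vx) \<and> G = cst t * 1)" for m F G
      proof -
        have "- cst (c * t / \<alpha>) * vx * vl - cst (d * t / \<alpha>) * vx =
          cst t * (- cst (c / \<alpha>) * vx * vl - cst (d / \<alpha>) * vx)" for t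
          by (rule ev_eqI) (unfold ev_simps, simp add: algebra_simps)
        then show ?thesis unfolding ext_list_0 cst_times_1 by (simp only: if_True refl)
      qed
    qed (use dvir_trivial1[OF _ \<alpha>] in auto)
  next
    case 2
    show ?thesis
      unfolding 2
    proof (rule ext_basis_special2[OF coc_0_linear, of _ _ "vir2 1"])
      show "vx + vl \<noteq> 0" by simp
      show "\<exists>t. g = cst t * (vx + vl)" if "coc 0 c d (- 1) 1 f g" for f g
      proof (cases "g = 0")
        case True
        then show ?thesis by (intro exI[of _ 0]) simp
      next
        case False
        then show ?thesis using coc_0_dgen[OF that False cd] by auto
      qed
      show "dvir (- 1) 1 (vir2 1) z x y = 0" for z x y using dvir_vir2[of "- 1" 1] by simp
      show "s = 0" if "cst s * vir2 1 = cob (- 1) 1 \<phi>" for s \<phi>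
        using vir_independent(2)[of "- 1" s 1 \<phi>] that unfolding vir_unit by simp
      show "\<exists>s \<phi>. h = cst s * vir2 1 + cob (- 1) 1 \<phi>" if "\<And>z x y. dvir (- 1) 1 h z x y = 0" for h
      proof -
        have "dvir (- 1) (- 1 + of_nat 2) h z x y = 0" for z x y using that by simp
        then obtain s \<phi> where "h = vir2 s + cob (- 1) (- 1 + of_nat 2) \<phi>"
          using dvir_class2[of "- 1" h] by (metis neg_equal_0_iff_equal one_neq_zero)
        then show ?thesis unfolding vir_unit by auto
      qed
      show "ext_list 0 c d (- 1) 1 m F G \<longleftrightarrow> m = 2 \<and> (\<exists>s t. (s, t) \<noteq> (0, 0) \<and>
        F = cst s * vir2 1 + cst t * (cst c * vx ^ 2 * vl + cst d * (vx ^ 2 - vl ^ 2)) \<and> G = cst t * (vx + vl))" for m F G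
      proof -
        have "vir2 s + cst (c * t) * vx ^ 2 * vl + cst (d * t) * (vx ^ 2 - vl ^ 2) =
          vir2 s + cst t * (cst c * vx ^ 2 * vl + cst d * (vx ^ 2 - vl ^ 2))" for s t
          by (rule ev_eqI) (unfold ev_simps, simp add: algebra_simps)
        moreover have "(1 :: complex) \<noteq> - 1 + 1" by simp
        ultimately show ?thesis unfolding ext_list_0 vir_unit by (simp only: if_False if_True refl simp_thms)
      qed
    qed
  next
    case 3
    show ?thesis
    proof (rule ext_basis_vir[OF \<alpha>])
      show "g = 0" if "coc 0 c d \<alpha> \<alpha>' f g" for f g using g[OF that] 3 by blast
      show "ext_list 0 c d \<alpha> \<alpha>' m F G \<longleftrightarrow> vlist \<alpha> \<alpha>' m F \<and> G = 0" for m F G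
        unfolding ext_list_0 using 3 by (simp only: if_False simp_thms)
    qed
  qed
qed

lemma ext_basis_a1:
  assumes \<alpha>: "\<alpha> \<noteq> 0" and c: "c \<noteq> 0"
  shows "\<exists>n b. ext_basis 1 c d \<alpha> \<alpha>' n b"
proof -
  have g: "\<alpha>' = \<alpha> + 1 \<and> (\<exists>t. g = cst t * vl) \<or> \<alpha> = - 1 \<and> \<alpha>' = 1 \<and> (\<exists>t. g = cst t * (vl * (vx + vl)))"
    if fg: "coc 1 c d \<alpha> \<alpha>' f g" and "g \<noteq> 0" for f g
  proof -
    obtain h where h: "g = vl * h" "coc 0 0 (- c) \<alpha> \<alpha>' f h" using coc_1_reduce[OF fg c \<alpha>] .
    then have "h \<noteq> 0" using \<open>g \<noteq> 0\<close> by auto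
    moreover have "(0, - c) \<noteq> (0, 0)" using c by simp
    ultimately have "\<alpha>' = \<alpha> + 1 \<and> (\<exists>t. h = cst t) \<or> \<alpha> = - 1 \<and> \<alpha>' = 1 \<and> (\<exists>t. h = cst t * (vx + vl))"
      using coc_0_dgen[OF h(2)] \<alpha> by blast
    moreover have "vl * cst t = cst t * vl" "vl * (cst t * (vx + vl)) = cst t * (vl * (vx + vl))" for t
      by (rule mult.commute) (rule mult.left_commute)
    ultimately show ?thesis unfolding h(1) by metis
  qed
  consider "\<alpha>' = \<alpha> + 1" | "\<alpha> = - 1" "\<alpha>' = 1" | "\<alpha>' \<noteq> \<alpha> + 1" "\<not> (\<alpha> = - 1 \<and> \<alpha>' = 1)" by blast
  then show ?thesis
  proof cases
    case 1
    show ?thesis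
      unfolding 1
    proof (rule ext_basis_special1[OF coc_1_of_0[OF coc_0_const[OF \<alpha>]], unfolded mult_1_right])
      show "\<exists>t. g = cst t * vl" if "coc 1 c d \<alpha> (\<alpha> + 1) f g" for f g
      proof (cases "g = 0")
        case True
        then show ?thesis by (intro exI[of _ 0]) simp
      next
        case False
        then have "\<alpha> = - 1 \<Longrightarrow> \<alpha> + 1 \<noteq> (1::complex)" by simp
        then show ?thesis using g that False 1 by blast
      qed
      show "ext_list 1 c d \<alpha> (\<alpha> + 1) m F G \<longleftrightarrow> m = 1 \<and> (\<exists>t. t \<noteq> 0 \<and>
        F = cst t * (- cst (0 / \<alpha>) * vx * vl - cst (- c / \<alpha>) * vx) \<and> G = cst t * vl)" for m F G
      proof -
        have "cst (c * t / \<alpha>) * vx = cst t * (- cst (0 / \<alpha>) * vx * vl - cst (- c / \<alpha>) * vx)" for t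
          by (rule ev_eqI) (unfold ev_simps, simp add: algebra_simps)
        then show ?thesis unfolding ext_list_1 by (simp only: if_True refl)
      qed
    qed (use dvir_trivial1[OF _ \<alpha>] in auto)
  next
    case 2
    show ?thesis
      unfolding 2
    proof (rule ext_basis_special2[OF coc_1_of_0[OF coc_0_linear], of _ _ "vir2 1"])
      show "vl * (vx + vl) \<noteq> 0" by simp
      show "\<exists>t. g = cst t * (vl * (vx + vl))" if "coc 1 c d (- 1) 1 f g" for f g
      proof (cases "g = 0")
        case True
        then show ?thesis by (intro exI[of _ 0]) simp
      next
        case False
        moreover have "\<alpha>' \<noteq> \<alpha> + 1" using 2 by simp
        ultimately show ?thesis using g[of f g] that 2 by blast
      qed
      show "dvir (- 1) 1 (vir2 1) z x y = 0" for z x y using dvir_vir2[of "- 1" 1] by simp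
      show "s = 0" if "cst s * vir2 1 = cob (- 1) 1 \<phi>" for s \<phi>
        using vir_independent(2)[of "- 1" s 1 \<phi>] that unfolding vir_unit by simp
      show "\<exists>s \<phi>. h = cst s * vir2 1 + cob (- 1) 1 \<phi>" if "\<And>z x y. dvir (- 1) 1 h z x y = 0" for h
      proof -
        have "dvir (- 1) (- 1 + of_nat 2) h z x y = 0" for z x y using that by simp
        then obtain s \<phi> where "h = vir2 s + cob (- 1) (- 1 + of_nat 2) \<phi>"
          using dvir_class2[of "- 1" h] by (metis neg_equal_0_iff_equal one_neq_zero)
        then show ?thesis unfolding vir_unit by auto
      qed
      show "ext_list 1 c d (- 1) 1 m F G \<longleftrightarrow> m = 2 \<and> (\<exists>s t. (s, t) \<noteq> (0, 0) \<and>
        F = cst s * vir2 1 + cst t * (cst 0 * vx ^ 2 * vl + cst (- c) * (vx ^ 2 - vl ^ 2)) \<and>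
        G = cst t * (vl * (vx + vl)))" for m F G
      proof -
        have "vir2 s - cst (c * t) * (vx ^ 2 - vl ^ 2) =
          vir2 s + cst t * (cst 0 * vx ^ 2 * vl + cst (- c) * (vx ^ 2 - vl ^ 2))" for s t
          by (rule ev_eqI) (unfold ev_simps, simp add: algebra_simps)
        moreover have "cst t * (vx * vl + vl ^ 2) = cst t * (vl * (vx + vl))" for t
          by (rule ev_eqI) (unfold ev_simps, simp add: algebra_simps power2_eq_square)
        moreover have "(1 :: complex) \<noteq> - 1 + 1" by simp
        ultimately show ?thesis unfolding ext_list_1 vir_unit by (simp only: if_False if_True refl simp_thms)
      qed
    qed
  next
    case 3
    show ?thesis
    proof (rule ext_basis_vir[OF \<alpha>])
      show "g = 0" if "coc 1 c d \<alpha> \<alpha>' f g" for f g using g[OF that] 3 by blast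
      show "ext_list 1 c d \<alpha> \<alpha>' m F G \<longleftrightarrow> vlist \<alpha> \<alpha>' m F \<and> G = 0" for m F G
        unfolding ext_list_1 using 3 by (simp only: if_False simp_thms)
    qed
  qed
qed

section \<open>Explicit cocycles with nonzero g for a = -1, -4, -6\<close>

text \<open>The summand of an entry that is proportional to \<open>t\<close> is named after that
  entry, so that its linearity in \<open>t\<close>, stated in the accompanying \<open>scale\<close>
  lemma, can be used.\<close>

definition F_m1iii :: "complex \<Rightarrow> complex \<Rightarrow> complex \<Rightarrow> bipoly"
  where "F_m1iii c d t =
      - cst (2 * d * t) * vx ^ 2 * vl - cst (c * t) * (2 * vx ^ 2 - vl ^ 2)"

definition G_m1iii :: "complex \<Rightarrow> bipoly"
  where "G_m1iii t = cst t"

lemma scale_m1iii: "F_m1iii c d t = cst t * F_m1iii c d 1" "G_m1iii t = cst t * G_m1iii 1"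
  by (rule ev_eqI, unfold F_m1iii_def G_m1iii_def ev_simps, simp add: algebra_simps)+

definition F_m1v :: "complex \<Rightarrow> complex \<Rightarrow> complex \<Rightarrow> bipoly"
  where "F_m1v c d t =
      - cst (d * t / 4) * (2 * vx ^ 3 * vl + vl ^ 4)
      - cst (c * t / 2) * (vx ^ 3 - 2 * vx * vl ^ 2 - 2 * vl ^ 3)"

definition G_m1v :: "complex \<Rightarrow> bipoly"
  where "G_m1v t = cst t * (vx + cst (1 / 2) * vl)"

lemma scale_m1v: "F_m1v c d t = cst t * F_m1v c d 1" "G_m1v t = cst t * G_m1v 1"
  by (rule ev_eqI, unfold F_m1v_def G_m1v_def ev_simps, simp add: algebra_simps)+

definition F_a4v :: "complex \<Rightarrow> complex \<Rightarrow> complex \<Rightarrow> bipoly"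
  where "F_a4v \<alpha> c t =
      - cst (3 / (\<alpha> * (\<alpha> + 2) * (\<alpha> + 4)) * c * t) * vx ^ 3 * vl ^ 3
      + cst (9 * (\<alpha> + 1) / (2 * (\<alpha> * (\<alpha> + 2) * (\<alpha> + 4))) * c * t) * vx ^ 2 * vl ^ 4
      - cst (9 * (\<alpha> + 1) * (2 * \<alpha> + 1) / (10 * (\<alpha> * (\<alpha> + 2) * (\<alpha> + 4))) * c * t) * vx * vl ^ 5
      + cst ((\<alpha> + 1) * (2 * \<alpha> + 1) / (10 * (\<alpha> + 2) * (\<alpha> + 4)) * c * t) * vl ^ 6"

definition G_a4v :: "complex \<Rightarrow> bipoly"
  where "G_a4v t = cst t"

lemma scale_a4v: "F_a4v \<alpha> c t = cst t * F_a4v \<alpha> c 1" "G_a4v t = cst t * G_a4v 1"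
  by (rule ev_eqI, unfold F_a4v_def G_a4v_def ev_simps, simp add: algebra_simps)+

text \<open>The general representative \<open>F_a4v\<close> has no term in \<lambda>^2. At \<alpha>
  = -2 the weight \<open>wt \<alpha> 5 2\<close> vanishes, so a coboundary cannot remove that term;
  this is the source of the separate entry and of the denominator \<alpha> + 2.\<close>

definition F_a4vi :: "complex \<Rightarrow> complex \<Rightarrow> bipoly"
  where "F_a4vi c t =
      cst (3 / 8 * c * t) * vx ^ 4 * vl ^ 2 - cst (3 / 2 * c * t) * vx ^ 2 * vl ^ 4
      - cst (57 / 40 * c * t) * vx * vl ^ 5 - cst (2 / 5 * c * t) * vl ^ 6"

definition G_a4vi :: "complex \<Rightarrow> bipoly"
  where "G_a4vi t = cst t"

lemma scale_a4vi: "F_a4vi c t = cst t * F_a4vi c 1" "G_a4vi t = cst t * G_a4vi 1"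
  by (rule ev_eqI, unfold F_a4vi_def G_a4vi_def ev_simps, simp add: algebra_simps)+

definition F_a4viii :: "complex \<Rightarrow> complex \<Rightarrow> complex \<Rightarrow> bipoly"
  where "F_a4viii \<alpha> c t =
      - cst (3 / ((2 * \<alpha> + 5) * (2 * \<alpha> ^ 2 + 10 * \<alpha> + 3)) * c * t) * vx ^ 4 * vl ^ 3
      + cst (3 * (2 * \<alpha> + 3) / ((2 * \<alpha> + 5) * (2 * \<alpha> ^ 2 + 10 * \<alpha> + 3)) * c * t) * vx ^ 3 * vl ^ 4
      - cst (9 * (\<alpha> + 1) * (2 * \<alpha> + 3) / (5 * ((2 * \<alpha> + 5) * (2 * \<alpha> ^ 2 + 10 * \<alpha> + 3))) * c * t) * vx ^ 2 * vl ^ 5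
      + cst ((\<alpha> + 1) * (2 * \<alpha> + 1) * (2 * \<alpha> + 3) / (5 * ((2 * \<alpha> + 5) * (2 * \<alpha> ^ 2 + 10 * \<alpha> + 3))) * c * t) * vx * vl ^ 6
      - cst (\<alpha> * (\<alpha> + 1) * (2 * \<alpha> + 1) * (2 * \<alpha> + 3) / (70 * ((2 * \<alpha> + 5) * (2 * \<alpha> ^ 2 + 10 * \<alpha> + 3))) * c * t) * vl ^ 7"

definition G_a4viii :: "complex \<Rightarrow> complex \<Rightarrow> bipoly"
  where "G_a4viii \<alpha> t = cst t * (vx - cst (\<alpha> / 5) * vl)"

lemma scale_a4viii: "F_a4viii \<alpha> c t = cst t * F_a4viii \<alpha> c 1" "G_a4viii \<alpha> t = cst t * G_a4viii \<alpha> 1"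
  by (rule ev_eqI, unfold F_a4viii_def G_a4viii_def ev_simps, simp add: algebra_simps)+

text \<open>The exceptional value has the same origin: \<open>wt \<alpha> 6 2\<close> = 15 + 6
  \<alpha> vanishes at -5/2, and the term in \<lambda>^2 has to stay.\<close>

definition F_a4ix :: "complex \<Rightarrow> complex \<Rightarrow> bipoly"
  where "F_a4ix c t =
      cst (36 / 665 * c * t) * vx ^ 5 * vl ^ 2 - cst (54 / 133 * c * t) * vx ^ 3 * vl ^ 4
      - cst (387 / 665 * c * t) * vx ^ 2 * vl ^ 5 - cst (218 / 665 * c * t) * vx * vl ^ 6
      - cst (127 / 1862 * c * t) * vl ^ 7"

definition G_a4ix :: "complex \<Rightarrow> bipoly"
  where "G_a4ix t = cst t * (vx + cst (1 / 2) * vl)"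

lemma scale_a4ix: "F_a4ix c t = cst t * F_a4ix c 1" "G_a4ix t = cst t * G_a4ix 1"
  by (rule ev_eqI, unfold F_a4ix_def G_a4ix_def ev_simps, simp add: algebra_simps)+

text \<open>Among the algebras with \<open>a\<close> \<le> 0 this is the one case where
  \<open>g\<close> has degree 2: it is the value \<alpha> = - b - 2 of \<open>dgen_degree\<close>
  for b = 4.\<close>

definition F_a4xi :: "complex \<Rightarrow> complex \<Rightarrow> bipoly"
  where "F_a4xi c t =
      cst (1 / 35 * c * t) * vx ^ 5 * vl ^ 3 + cst (2 / 7 * c * t) * vx ^ 4 * vl ^ 4
      + cst (36 / 35 * c * t) * vx ^ 3 * vl ^ 5 + cst (12 / 7 * c * t) * vx ^ 2 * vl ^ 6
      + cst (66 / 49 * c * t) * vx * vl ^ 7 + cst (99 / 245 * c * t) * vl ^ 8"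

definition G_a4xi :: "complex \<Rightarrow> bipoly"
  where "G_a4xi t = cst t * (vx ^ 2 + cst (11 / 5) * vx * vl + cst (6 / 5) * vl ^ 2)"

lemma scale_a4xi: "F_a4xi c t = cst t * F_a4xi c 1" "G_a4xi t = cst t * G_a4xi 1"
  by (rule ev_eqI, unfold F_a4xi_def G_a4xi_def ev_simps, simp add: algebra_simps)+

definition F_a6vii :: "complex \<Rightarrow> complex \<Rightarrow> complex \<Rightarrow> bipoly"
  where "F_a6vii \<alpha> c t =
      - cst (40 / (7 * (\<alpha> + 3)) * c * t) * vx ^ 5 * vl ^ 3
      + cst (100 * (\<alpha> + 2) / (7 * (\<alpha> + 3)) * c * t) * vx ^ 4 * vl ^ 4
      + cst (40 * (5 * \<alpha> + 1) / (7 * (\<alpha> + 3)) * c * t) * vx ^ 3 * vl ^ 5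
      + cst (20 * (16 * \<alpha> + 11) / (7 * (\<alpha> + 3)) * c * t) * vx ^ 2 * vl ^ 6
      + cst (10 * (154 * \<alpha> + 101) / (49 * (\<alpha> + 3)) * c * t) * vx * vl ^ 7
      + cst ((823 * \<alpha> + 539) / (98 * (\<alpha> + 3)) * c * t) * vl ^ 8"

definition G_a6vii :: "complex \<Rightarrow> bipoly"
  where "G_a6vii t = - cst t"

lemma scale_a6vii: "F_a6vii \<alpha> c t = cst t * F_a6vii \<alpha> c 1" "G_a6vii t = cst t * G_a6vii 1"
  by (rule ev_eqI, unfold F_a6vii_def G_a6vii_def ev_simps, simp add: algebra_simps)+

definition F_a6viii :: "complex \<Rightarrow> complex \<Rightarrow> bipoly"
  where "F_a6viii c t =
      - cst (2 / 7 * c * t) * vx ^ 6 * vl ^ 3 + cst (9 / 7 * c * t) * vx ^ 5 * vl ^ 4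
      - cst (9 / 7 * c * t) * vx ^ 4 * vl ^ 5 + cst (2 / 7 * c * t) * vx ^ 3 * vl ^ 6"

definition G_a6viii :: "complex \<Rightarrow> bipoly"
  where "G_a6viii t = - cst t * (vx + cst (1 / 7) * vl)"

lemma scale_a6viii: "F_a6viii c t = cst t * F_a6viii c 1" "G_a6viii t = cst t * G_a6viii 1"
  by (rule ev_eqI, unfold F_a6viii_def G_a6viii_def ev_simps, simp add: algebra_simps)+

definition F_a6ix :: "complex \<Rightarrow> complex \<Rightarrow> bipoly"
  where "F_a6ix c t =
      - cst (2 / 7 * c * t) * vx ^ 6 * vl ^ 3 - cst (3 * c * t) * vx ^ 5 * vl ^ 4
      - cst (12 * c * t) * vx ^ 4 * vl ^ 5 - cst (24 * c * t) * vx ^ 3 * vl ^ 6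
      - cst (180 / 7 * c * t) * vx ^ 2 * vl ^ 7 - cst (99 / 7 * c * t) * vx * vl ^ 8
      - cst (22 / 7 * c * t) * vl ^ 9"

definition G_a6ix :: "complex \<Rightarrow> bipoly"
  where "G_a6ix t = cst t * (vx + cst (6 / 7) * vl)"

lemma scale_a6ix: "F_a6ix c t = cst t * F_a6ix c 1" "G_a6ix t = cst t * G_a6ix 1"
  by (rule ev_eqI, unfold F_a6ix_def G_a6ix_def ev_simps, simp add: algebra_simps)+

lemma coc_m1iii:
  shows "coc (- 1) c d (- (1 / 2)) (3 / 2) (F_m1iii c d 1) (G_m1iii 1)"
proof -
  have "dvir (- (1 / 2)) (3 / 2) (F_m1iii c d 1) z x y = ev (Q_poly (- 1) c d) (- x - y) x * ev (G_m1iii 1) z (x + y)" for z x y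
    unfolding dvir_def F_m1iii_def G_m1iii_def ev_Q ev_simps by (simp add: field_simps eval_nat_numeral)
  moreover have "dgen (- 1) (- (1 / 2)) (3 / 2) (G_m1iii 1)"
    unfolding dgen_def G_m1iii_def ev_simps by (simp add: field_simps power2_eq_square)
  ultimately show ?thesis by (simp add: coc_def)
qed

lemma coc_m1v:
  shows "coc (- 1) c d (- 1) 2 (F_m1v c d 1) (G_m1v 1)"
proof -
  have "dvir (- 1) 2 (F_m1v c d 1) z x y = ev (Q_poly (- 1) c d) (- x - y) x * ev (G_m1v 1) z (x + y)" for z x y
    unfolding dvir_def F_m1v_def G_m1v_def ev_Q ev_simps by (simp add: field_simps eval_nat_numeral)
  moreover have "dgen (- 1) (- 1) 2 (G_m1v 1)"
    unfolding dgen_def G_m1v_def ev_simps by (simp add: field_simps power2_eq_square)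
  ultimately show ?thesis by (simp add: coc_def)
qed

lemma coc_a4v:
  assumes "\<alpha> \<noteq> 0" "\<alpha> \<notin> {- 2, - 4}"
  shows "coc (- 4) c d \<alpha> (\<alpha> + 5) (F_a4v \<alpha> c 1) (G_a4v 1)"
proof -
  have nz: "\<alpha> + 2 \<noteq> 0" "\<alpha> + 4 \<noteq> 0" using assms(2) by (auto simp: add_eq_0_iff2)
  \<comment> \<open>Writing c as this multiple of k clears all denominators; the cocycle equation
    then becomes a polynomial identity in \<alpha>, k and the variables.\<close>
  define k where "k = c / (10 * (\<alpha> * (\<alpha> + 2) * (\<alpha> + 4)))"
  have c: "c = 10 * (\<alpha> * (\<alpha> + 2) * (\<alpha> + 4)) * k" using nz assms(1) by (simp add: k_def)
  have e: "3 / (\<alpha> * u * w) * (10 * (\<alpha> * u * w) * k) * 1 = 30 * k"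
    "9 * p / (2 * (\<alpha> * u * w)) * (10 * (\<alpha> * u * w) * k) * 1 = 45 * p * k"
    "9 * p * q / (10 * (\<alpha> * u * w)) * (10 * (\<alpha> * u * w) * k) * 1 = 9 * p * q * k"
    "p * q / (10 * u * w) * (10 * (\<alpha> * u * w) * k) * 1 = \<alpha> * p * q * k"
    if "u \<noteq> 0" "w \<noteq> 0" for u w p q using that assms(1) by simp_all
  have "dvir \<alpha> (\<alpha> + 5) (F_a4v \<alpha> c 1) z x y = ev (Q_poly (- 4) c d) (- x - y) x * ev (G_a4v 1) z (x + y)" for z x y
    unfolding F_a4v_def c e[OF nz] unfolding dvir_def G_a4v_def ev_Q ev_simps
    by (simp add: algebra_simps eval_nat_numeral)
  moreover have "dgen (- 4) \<alpha> (\<alpha> + 5) (G_a4v 1)"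
    unfolding dgen_def G_a4v_def ev_simps by (simp add: field_simps power2_eq_square)
  ultimately show ?thesis by (simp add: coc_def)
qed

lemma coc_a4vi:
  shows "coc (- 4) c d (- 2) 3 (F_a4vi c 1) (G_a4vi 1)"
proof -
  have "dvir (- 2) 3 (F_a4vi c 1) z x y = ev (Q_poly (- 4) c d) (- x - y) x * ev (G_a4vi 1) z (x + y)" for z x y
  proof -
    obtain k where c: "c = 40 * k" by (metis mult.commute nonzero_divide_eq_eq zero_neq_numeral)
    show ?thesis
      unfolding c dvir_def F_a4vi_def G_a4vi_def ev_Q ev_simps by (simp add: field_simps eval_nat_numeral)
  qed
  moreover have "dgen (- 4) (- 2) 3 (G_a4vi 1)"
    unfolding dgen_def G_a4vi_def ev_simps by (simp add: field_simps power2_eq_square)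
  ultimately show ?thesis by (simp add: coc_def)
qed

lemma vir_obstr_6_factor: "2 * \<alpha> ^ 2 + 10 * \<alpha> + 3 = 2 * vir_obstr 6 \<alpha>"
  by (simp add: vir_obstr_def algebra_simps)

lemma coc_a4viii:
  assumes "2 * \<alpha> + 5 \<noteq> 0" "vir_obstr 6 \<alpha> \<noteq> 0"
  shows "coc (- 4) c d \<alpha> (\<alpha> + 6) (F_a4viii \<alpha> c 1) (G_a4viii \<alpha> 1)"
proof -
  have nz: "2 * \<alpha> ^ 2 + 10 * \<alpha> + 3 \<noteq> 0" using assms(2) unfolding vir_obstr_6_factor by simp
  define N where "N = (2 * \<alpha> + 5) * (2 * \<alpha> ^ 2 + 10 * \<alpha> + 3)"
  define k where "k = c / (70 * N)"
  have N: "N \<noteq> 0" using assms nz by (simp add: N_def)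
  have c: "c = 70 * N * k" using N by (simp add: k_def)
  have e: "3 / N * c * 1 = 210 * k"
    "3 * (2 * \<alpha> + 3) / N * c * 1 = 210 * (2 * \<alpha> + 3) * k"
    "9 * (\<alpha> + 1) * (2 * \<alpha> + 3) / (5 * N) * c * 1 = 126 * (\<alpha> + 1) * (2 * \<alpha> + 3) * k"
    "(\<alpha> + 1) * (2 * \<alpha> + 1) * (2 * \<alpha> + 3) / (5 * N) * c * 1 = 14 * (\<alpha> + 1) * (2 * \<alpha> + 1) * (2 * \<alpha> + 3) * k"
    "\<alpha> * (\<alpha> + 1) * (2 * \<alpha> + 1) * (2 * \<alpha> + 3) / (70 * N) * c * 1 = \<alpha> * (\<alpha> + 1) * (2 * \<alpha> + 1) * (2 * \<alpha> + 3) * k"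
    unfolding c using N by simp_all
  have "dvir \<alpha> (\<alpha> + 6) (F_a4viii \<alpha> c 1) z x y = ev (Q_poly (- 4) c d) (- x - y) x * ev (G_a4viii \<alpha> 1) z (x + y)" for z x y
    unfolding F_a4viii_def N_def[symmetric] e unfolding c N_def dvir_def G_a4viii_def ev_Q ev_simps
    by (simp add: field_simps eval_nat_numeral)
  moreover have "dgen (- 4) \<alpha> (\<alpha> + 6) (G_a4viii \<alpha> 1)"
    unfolding dgen_def G_a4viii_def ev_simps by (simp add: field_simps power2_eq_square)
  ultimately show ?thesis by (simp add: coc_def)
qed

lemma coc_a4ix:
  shows "coc (- 4) c d (- (5 / 2)) (7 / 2) (F_a4ix c 1) (G_a4ix 1)"
proof -
  have "dvir (- (5 / 2)) (7 / 2) (F_a4ix c 1) z x y = ev (Q_poly (- 4) c d) (- x - y) x * ev (G_a4ix 1) z (x + y)" for z x y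
  proof -
    \<comment> \<open>9310 = 2 * 5 * 7^2 * 19 is the least common denominator of the coefficients,
      and the substitution in x and y absorbs the halves in \<alpha>, \<alpha>' and
      \<open>g\<close>.\<close>
    obtain k X Y where c: "c = 9310 * k" and xy: "x = 2 * X" "y = 2 * Y"
      by (metis mult.commute nonzero_divide_eq_eq zero_neq_numeral)
    show ?thesis
      unfolding c xy dvir_def F_a4ix_def G_a4ix_def ev_Q ev_simps by (simp add: algebra_simps eval_nat_numeral)
  qed
  moreover have "dgen (- 4) (- (5 / 2)) (7 / 2) (G_a4ix 1)"
    unfolding dgen_def G_a4ix_def ev_simps by (simp add: field_simps power2_eq_square)
  ultimately show ?thesis by (simp add: coc_def)
qed

lemma coc_a4xi:
  shows "coc (- 4) c d (- 6) 1 (F_a4xi c 1) (G_a4xi 1)"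
proof -
  have "dvir (- 6) 1 (F_a4xi c 1) z x y = ev (Q_poly (- 4) c d) (- x - y) x * ev (G_a4xi 1) z (x + y)" for z x y
  proof -
    obtain k where c: "c = 245 * k" by (metis mult.commute nonzero_divide_eq_eq zero_neq_numeral)
    show ?thesis
      unfolding c dvir_def F_a4xi_def G_a4xi_def ev_Q ev_simps by (simp add: field_simps eval_nat_numeral)
  qed
  moreover have "dgen (- 4) (- 6) 1 (G_a4xi 1)"
    unfolding dgen_def G_a4xi_def ev_simps by (simp add: field_simps power2_eq_square)
  ultimately show ?thesis by (simp add: coc_def)
qed

lemma coc_a6vii:
  assumes "vir_obstr 7 \<alpha> = 0"
  shows "coc (- 6) c d \<alpha> (\<alpha> + 7) (F_a6vii \<alpha> c 1) (G_a6vii 1)"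
proof -
  have nz: "\<alpha> + 3 \<noteq> 0"
  proof
    assume "\<alpha> + 3 = 0"
    then have a: "\<alpha> = - 3" by (simp add: add_eq_0_iff2)
    show False using assms unfolding vir_obstr_def a by simp
  qed
  have g: "dgen (- 6) \<alpha> (\<alpha> + 7) (G_a6vii 1)"
    unfolding dgen_def G_a6vii_def ev_simps by (simp add: algebra_simps)
  define D where "D = \<alpha> + 3"
  define k where "k = c / (98 * D)"
  have D: "D \<noteq> 0" using nz by (simp add: D_def)
  have c: "c = 98 * D * k" using D by (simp add: k_def)
  have e: "40 / (7 * D) * c * 1 = 560 * k"
    "100 * (\<alpha> + 2) / (7 * D) * c * 1 = 1400 * (\<alpha> + 2) * k"
    "40 * (5 * \<alpha> + 1) / (7 * D) * c * 1 = 560 * (5 * \<alpha> + 1) * k"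
    "20 * (16 * \<alpha> + 11) / (7 * D) * c * 1 = 280 * (16 * \<alpha> + 11) * k"
    "10 * (154 * \<alpha> + 101) / (49 * D) * c * 1 = 20 * (154 * \<alpha> + 101) * k"
    "(823 * \<alpha> + 539) / (98 * D) * c * 1 = (823 * \<alpha> + 539) * k"
    unfolding c using D by simp_all
  have P: "2 * \<alpha> ^ 2 + 12 * \<alpha> + 7 = 2 * vir_obstr 7 \<alpha>" by (simp add: vir_obstr_def)
  \<comment> \<open>For general \<alpha> the equation fails by a multiple of 2 \<alpha>^2 + 12
    \<alpha> + 7, which is twice the obstruction for n = 7.\<close>
  have "dvir \<alpha> (\<alpha> + 7) (F_a6vii \<alpha> c 1) z x y = ev (Q_poly (- 6) c d) (- x - y) x * ev (G_a6vii 1) z (x + y)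
    + (2 * \<alpha> ^ 2 + 12 * \<alpha> + 7) * (7 * k) * (- 400 * z ^ 3 * x ^ 4 * y ^ 2 + 400 * z ^ 3 * x ^ 2 * y ^ 4
      - 600 * z ^ 2 * x ^ 5 * y ^ 2 - 600 * z ^ 2 * x ^ 4 * y ^ 3 + 600 * z ^ 2 * x ^ 3 * y ^ 4
      + 600 * z ^ 2 * x ^ 2 * y ^ 5 - 640 * z * x ^ 6 * y ^ 2 - 600 * z * x ^ 5 * y ^ 3
      + 600 * z * x ^ 3 * y ^ 5 + 640 * z * x ^ 2 * y ^ 6 - 220 * x ^ 7 * y ^ 2 - 320 * x ^ 6 * y ^ 3
      - 100 * x ^ 5 * y ^ 4 + 100 * x ^ 4 * y ^ 5 + 320 * x ^ 3 * y ^ 6 + 220 * x ^ 2 * y ^ 7)" for z x y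
    unfolding F_a6vii_def D_def[symmetric] e unfolding c D_def dvir_def G_a6vii_def ev_Q ev_simps
    by (simp add: algebra_simps eval_nat_numeral)
  then show ?thesis unfolding coc_def P using g assms by simp
qed

lemma coc_a6viii:
  shows "coc (- 6) c d (- 1) 7 (F_a6viii c 1) (G_a6viii 1)"
proof -
  have "dvir (- 1) 7 (F_a6viii c 1) z x y = ev (Q_poly (- 6) c d) (- x - y) x * ev (G_a6viii 1) z (x + y)" for z x y
  proof -
    obtain k where c: "c = 7 * k" by (metis mult.commute nonzero_divide_eq_eq zero_neq_numeral)
    show ?thesis
      unfolding c dvir_def F_a6viii_def G_a6viii_def ev_Q ev_simps by (simp add: field_simps eval_nat_numeral)
  qed
  moreover have "dgen (- 6) (- 1) 7 (G_a6viii 1)"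
    unfolding dgen_def G_a6viii_def ev_simps by (simp add: field_simps power2_eq_square)
  ultimately show ?thesis by (simp add: coc_def)
qed

lemma coc_a6ix:
  shows "coc (- 6) c d (- 6) 2 (F_a6ix c 1) (G_a6ix 1)"
proof -
  have "dvir (- 6) 2 (F_a6ix c 1) z x y = ev (Q_poly (- 6) c d) (- x - y) x * ev (G_a6ix 1) z (x + y)" for z x y
  proof -
    obtain k where c: "c = 7 * k" by (metis mult.commute nonzero_divide_eq_eq zero_neq_numeral)
    show ?thesis
      unfolding c dvir_def F_a6ix_def G_a6ix_def ev_Q ev_simps by (simp add: field_simps eval_nat_numeral)
  qed
  moreover have "dgen (- 6) (- 6) 2 (G_a6ix 1)"
    unfolding dgen_def G_a6ix_def ev_simps by (simp add: field_simps power2_eq_square)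
  ultimately show ?thesis by (simp add: coc_def)
qed

section \<open>Excluding all other parameters for a = -1, -4, -6\<close>

lemma dgen_multiple':
  assumes "dgen (- of_nat b) \<alpha> \<alpha>' g" "dgen (- of_nat b) \<alpha> \<alpha>' h" "\<alpha>' - \<alpha> - of_nat b - 1 = of_nat k"
    and "cf h 0 k \<noteq> 0"
  shows "\<exists>t. g = cst t * h"
proof -
  let ?t = "cf g 0 k / cf h 0 k"
  have "g - cst ?t * h = 0"
    by (rule dgen_lead[OF dgen_diff[OF assms(1) dgen_scale[OF assms(2)]] assms(3)]) (use assms(4) in simp)
  then show ?thesis by (metis eq_iff_diff_eq_0)
qed

text \<open>The coefficients of \<open>f\<close> at \<lambda>^0 and \<lambda>^1 are annihilated by
  the weight \<open>wt \<alpha> (k + 2) 2\<close>, while \<open>wt \<alpha> (k + 2) 3\<close> turns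
  them into c and d times the leading coefficient of \<open>g\<close>. As c or d is nonzero, the
  first weight must vanish: a linear condition on \<alpha>, one value for each degree of
  \<open>g\<close>.\<close>

lemma coc_m1_dgen:
  assumes co: "coc (- 1) c d \<alpha> \<alpha>' f g" and "g \<noteq> 0" and cd: "(c, d) \<noteq> (0, 0)" and \<alpha>: "\<alpha> \<noteq> 0"
  shows "\<alpha> = - (1 / 2) \<and> \<alpha>' = 3 / 2 \<or> \<alpha> = - 1 \<and> \<alpha>' = 2"
proof -
  have g: "dgen (- of_nat 1) \<alpha> \<alpha>' g" using co by (simp add: coc_def)
  obtain k where k: "\<alpha>' - \<alpha> - of_nat 1 - 1 = of_nat k" using dgen_nat[OF g \<open>g \<noteq> 0\<close>] .
  have nz: "cf g 0 k \<noteq> 0" using dgen_lead[OF g k] \<open>g \<noteq> 0\<close> by blast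
  note hom = dgen_homogeneous[OF g k]
  note q = tri_add[OF tri_scale[OF tri_diff[OF tri_add[OF tri_qmon[of 3 0 g] tri_qmon[of 2 1 g]]
      tri_add[OF tri_qmon[of 1 2 g] tri_qmon[of 0 3 g]]], of c]
    tri_scale[OF tri_diff[OF tri_qmon[of 3 1 g] tri_qmon[of 1 3 g]], of d]]
  have H: "dvir \<alpha> \<alpha>' f z x y =
    c * ((x ^ 3 * (y ^ 0 * ev g z (x + y)) + x ^ 2 * (y ^ 1 * ev g z (x + y)))
      - (x ^ 1 * (y ^ 2 * ev g z (x + y)) + x ^ 0 * (y ^ 3 * ev g z (x + y))))
    + d * (x ^ 3 * (y ^ 1 * ev g z (x + y)) - x ^ 1 * (y ^ 3 * ev g z (x + y)))" for z x y
    unfolding cocD(1)[OF co] ev_Q by (simp add: algebra_simps)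
  have a': "\<alpha>' = \<alpha> + of_nat k + 2" using k by (simp add: algebra_simps)
  have "wt \<alpha> (k + 2) 2 * cf f 0 (k + 2) = 0"
    using rel_0s[OF H q, of 2 "k + 2"] by (simp add: qmon_def)
  moreover have "wt \<alpha> (k + 2) 3 * cf f 0 (k + 2) = c * cf g 0 k"
    using rel_0s[OF H q, of 3 "k + 2"] by (simp add: qmon_def)
  moreover have "wt \<alpha> (k + 2) 2 * cf f 1 (k + 2) = 0"
    using rel_1s[OF H q, of 2 "k + 3"] a' by (simp add: qmon_def hom)
  moreover have "wt \<alpha> (k + 2) 3 * cf f 1 (k + 2) = d * cf g 0 k"
    using rel_1s[OF H q, of 3 "k + 3"] a' by (simp add: qmon_def hom)
  ultimately have "wt \<alpha> (k + 2) 2 = 0" using cd nz by (metis mult_eq_0_iff mult_zero_right)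
  then have "of_nat (k + 2) * (of_nat (k + 2) - 1 + 2 * \<alpha>) = 0" unfolding wt_2 by simp
  then have w: "of_nat k + 1 + 2 * \<alpha> = 0"
    unfolding mult_eq_0_iff of_nat_eq_0_iff by (simp add: algebra_simps)
  consider "k = 0" | "k = 1" | "k = 2" "\<alpha> = - 3" using dgen_degree[OF g k \<open>g \<noteq> 0\<close> \<alpha>] by force
  then show ?thesis
  proof cases
    case 1
    then have "2 * (\<alpha> + 1 / 2) = 0" using w by (simp add: algebra_simps)
    then have "\<alpha> = - (1 / 2)" unfolding eq_neg_iff_add_eq_0 by (metis mult_eq_0_iff zero_neq_numeral)
    then show ?thesis using a' 1 by simp
  next
    case 2
    then have "2 * (\<alpha> + 1) = 0" using w by (simp add: algebra_simps)
    then have "\<alpha> = - 1" unfolding eq_neg_iff_add_eq_0 by (metis mult_eq_0_iff zero_neq_numeral)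
    then show ?thesis using a' 2 by simp
  next
    case 3
    then show ?thesis using w by simp
  qed
qed

text \<open>The source enters exactly the pair (3, 4), which tests the coefficient at \<lambda>^6,
  and contributes a nonzero multiple of the leading coefficient of \<open>g\<close>. Hence there is
  no solution \<open>f\<close> on the zeros of \<open>vir_obstr\<close>.\<close>

lemma coc_m4_dgen:
  assumes co: "coc (- 4) c d \<alpha> \<alpha>' f g" and "g \<noteq> 0" and c: "c \<noteq> 0" and \<alpha>: "\<alpha> \<noteq> 0"
  shows "\<alpha>' = \<alpha> + 5 \<and> \<alpha> \<noteq> - 4 \<or> \<alpha>' = \<alpha> + 6 \<and> vir_obstr 6 \<alpha> \<noteq> 0 \<or> \<alpha> = - 6 \<and> \<alpha>' = 1"
proof -
  have g: "dgen (- of_nat 4) \<alpha> \<alpha>' g" using co by (simp add: coc_def)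
  obtain k where k: "\<alpha>' - \<alpha> - of_nat 4 - 1 = of_nat k" using dgen_nat[OF g \<open>g \<noteq> 0\<close>] .
  have nz: "cf g 0 k \<noteq> 0" using dgen_lead[OF g k] \<open>g \<noteq> 0\<close> by blast
  note q = tri_scale[OF tri_diff[OF tri_qmon[of 3 4 g] tri_qmon[of 4 3 g]], of c]
  have H: "dvir \<alpha> \<alpha>' f z x y =
    c * (x ^ 3 * (y ^ 4 * ev g z (x + y)) - x ^ 4 * (y ^ 3 * ev g z (x + y)))" for z x y
    unfolding cocD(1)[OF co] ev_Q by (simp add: algebra_simps)
  have a': "\<alpha>' = \<alpha> + of_nat k + 5" using k by (simp add: algebra_simps)
  have vir_obstr: "vir_obstr (k + 5) \<alpha> \<noteq> 0"
  proof
    assume vir_obstr: "vir_obstr (k + 5) \<alpha> = 0"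
    have "of_nat (18 * (k + 5)) * (c * cf g 0 k) = 0"
      using dvir_level5[OF H q, of "k + 5"] unfolding vir_obstr by (simp add: qmon_def)
    then show False using c nz unfolding mult_eq_0_iff of_nat_eq_0_iff by simp
  qed
  consider "k = 0" | "k = 1" | "k = 2" "\<alpha> = - 6" using dgen_degree[OF g k \<open>g \<noteq> 0\<close> \<alpha>] by force
  then show ?thesis
  proof cases
    case 1
    then have "\<alpha> \<noteq> - 4" using vir_obstr by (auto simp: vir_obstr_def)
    then show ?thesis using a' 1 by simp
  next
    case 2
    then show ?thesis using a' vir_obstr by simp
  next
    case 3
    then show ?thesis using a' by simp
  qed
qed

text \<open>Here the situation is reversed. The source has degree at least 9 in x and y, so the test
  at \<lambda>^6 does not notice it: off the zeros of \<open>vir_obstr\<close>, the coefficients of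
  \<open>f\<close> from \<lambda>^2 to \<lambda>^8 can be removed by a coboundary. The pair (3, 6)
  then exhibits the leading coefficient of \<open>g\<close> as 0. So \<alpha> has to be a
  zero.\<close>

lemma coc_m6_dgen:
  assumes co: "coc (- 6) c d \<alpha> \<alpha>' f g" and "g \<noteq> 0" and c: "c \<noteq> 0" and \<alpha>: "\<alpha> \<noteq> 0"
  shows "\<alpha>' = \<alpha> + 7 \<and> vir_obstr 7 \<alpha> = 0 \<or> \<alpha> = - 1 \<and> \<alpha>' = 7 \<or> \<alpha> = - 6 \<and> \<alpha>' = 2"
proof -
  have g: "dgen (- of_nat 6) \<alpha> \<alpha>' g" using co by (simp add: coc_def)
  obtain k where k: "\<alpha>' - \<alpha> - of_nat 6 - 1 = of_nat k" using dgen_nat[OF g \<open>g \<noteq> 0\<close>] .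
  have nz: "cf g 0 k \<noteq> 0" using dgen_lead[OF g k] \<open>g \<noteq> 0\<close> by blast
  note q = tri_scale[OF tri_diff[OF tri_add[OF tri_diff[OF tri_scale[OF tri_qmon[of 3 6 g], of 2]
      tri_scale[OF tri_qmon[of 4 5 g], of 9]] tri_scale[OF tri_qmon[of 5 4 g], of 9]]
      tri_scale[OF tri_qmon[of 6 3 g], of 2]], of c]
  let ?H = "\<lambda>z x y. c * (2 * (x ^ 3 * (y ^ 6 * ev g z (x + y))) - 9 * (x ^ 4 * (y ^ 5 * ev g z (x + y)))
      + 9 * (x ^ 5 * (y ^ 4 * ev g z (x + y))) - 2 * (x ^ 6 * (y ^ 3 * ev g z (x + y))))"
  have H: "dvir \<alpha> \<alpha>' f z x y = ?H z x y" for z x y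
    unfolding cocD(1)[OF co] ev_Q by (simp add: algebra_simps)
  have a': "\<alpha>' = \<alpha> + of_nat k + 7" using k by (simp add: algebra_simps)
  let ?n = "k + 7"
  have vir_obstr: "vir_obstr ?n \<alpha> = 0"
  proof (rule ccontr)
    assume vir_obstr: "vir_obstr ?n \<alpha> \<noteq> 0"
    have "- (of_nat ?n - 2) * (of_nat ?n - 3) * (of_nat ?n - 4) * vir_obstr ?n \<alpha> *
      (wt \<alpha> ?n 3 * cf f 2 (?n - 1) - wt \<alpha> ?n 2 * cf f 3 (?n - 2)) = 0"
      using dvir_level5[OF H q, of ?n] by (simp add: qmon_def)
    moreover have "of_nat ?n - of_nat j \<noteq> (0::complex)" if "j < 7" for j
    proof -
      have "of_nat ?n \<noteq> (of_nat j :: complex)" using that unfolding of_nat_eq_iff by simp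
      then show ?thesis by (metis eq_iff_diff_eq_0)
    qed
    from this[of 2] this[of 3] this[of 4]
    have "of_nat ?n - 2 \<noteq> (0::complex)" "of_nat ?n - 3 \<noteq> (0::complex)" "of_nat ?n - 4 \<noteq> (0::complex)"
      by simp_all
    then have "- (of_nat ?n - 2) * (of_nat ?n - 3) * (of_nat ?n - 4) * vir_obstr ?n \<alpha> \<noteq> (0::complex)"
      using vir_obstr by (metis mult_eq_0_iff neg_equal_0_iff_equal)
    ultimately have "wt \<alpha> ?n 3 * cf f 2 (?n - 1) = wt \<alpha> ?n 2 * cf f 3 (?n - 2)"
      by (metis mult_eq_0_iff eq_iff_diff_eq_0)
    moreover have "2 \<le> ?n" by simp
    ultimately obtain \<kappa> where \<kappa>: "cf f 2 (?n - 1) = wt \<alpha> ?n 2 * \<kappa>" "cf f 3 (?n - 2) = wt \<alpha> ?n 3 * \<kappa>"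
      using wt_2_3_proportional by metis
    define h where "h = f - cob \<alpha> \<alpha>' (monom \<kappa> ?n)"
    have H': "dvir \<alpha> \<alpha>' h z x y = ?H z x y" for z x y
      by (simp add: h_def dvir_diff dvir_cob H)
    define a where "a i = cf h i (?n + 1 - i)" for i
    have a2: "a 2 = 0" and a3: "a 3 = 0"
      using cob_monom_wt(1)[of ?n \<alpha> \<alpha>' \<kappa>] cob_monom_wt(2)[of ?n \<alpha> \<alpha>' \<kappa>] \<kappa>
      by (simp_all add: a_def h_def numeral_2_eq_2 numeral_3_eq_3)
    have "a 4 = 0" using rel_rs[OF H' q, of 2 3 "?n + 1"] a2 a3
      by (simp add: qmon_def a_def[symmetric, of 2] a_def choose_numeral)
    moreover from this have "a 5 = 0" using rel_rs[OF H' q, of 2 4 "?n + 1"] a2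
      by (simp add: qmon_def a_def choose_numeral)
    moreover from this have "a 6 = 0" using rel_rs[OF H' q, of 2 5 "?n + 1"] a2
      by (simp add: qmon_def a_def choose_numeral)
    moreover from this have "a 7 = 0" using rel_rs[OF H' q, of 2 6 "?n + 1"] a2
      by (simp add: qmon_def a_def choose_numeral)
    moreover from this have "a 8 = 0" using rel_rs[OF H' q, of 2 7 "?n + 1"] a2
      by (simp add: qmon_def a_def choose_numeral)
    ultimately have "c * cf g 0 k = 0" using rel_rs[OF H' q, of 3 6 "?n + 1"] a3
      by (simp add: qmon_def a_def choose_numeral)
    then show False using c nz by simp
  qed
  consider "k = 0" | "k = 1" | "k = 2" "\<alpha> = - 8" using dgen_degree[OF g k \<open>g \<noteq> 0\<close> \<alpha>] by force
  then show ?thesis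
  proof cases
    case 1
    then show ?thesis using a' vir_obstr by simp
  next
    case 2
    then have "(\<alpha> + 1) * (\<alpha> + 6) = 0" using vir_obstr by (simp add: vir_obstr_def power2_eq_square algebra_simps)
    then have "\<alpha> = - 1 \<or> \<alpha> = - 6" by (simp add: eq_neg_iff_add_eq_0)
    then show ?thesis using a' 2 by auto
  next
    case 3
    then show ?thesis using vir_obstr by (simp add: vir_obstr_def)
  qed
qed

lemma dvir_trivial_ex:
  assumes "\<And>z x y. dvir \<alpha> \<alpha>' h z x y = 0" "\<alpha>' = \<alpha> + of_nat n" "\<alpha> \<noteq> 0"
    and "n = 1 \<or> 7 \<le> n \<or> 5 \<le> n \<and> vir_obstr n \<alpha> \<noteq> 0"
  shows "\<exists>\<phi>. h = cob \<alpha> \<alpha>' \<phi>"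
  using dvir_trivial[of \<alpha> n h] assms by metis

text \<open>Here \<open>k\<close> is the degree of \<open>g\<close>. The condition on b + 1 + k =
  \<alpha>' - \<alpha> makes all cocycles with zero \<open>g\<close> coboundaries, and the nonzero
  leading coefficient of \<open>G 1\<close> makes every other \<open>g\<close> a multiple of
  it.\<close>

lemma ext_basis_family1:
  assumes a: "a = - of_nat b" and F: "coc a c d \<alpha> \<alpha>' (F 1) (G 1)"
    and n: "\<alpha>' = \<alpha> + of_nat (b + 1 + k)" and G: "cf (G 1) 0 k \<noteq> 0"
    and sF: "\<And>t. F t = cst t * F 1" and sG: "\<And>t. G t = cst t * G 1" and \<alpha>: "\<alpha> \<noteq> 0"
    and v: "7 \<le> b + 1 + k \<or> 5 \<le> b + 1 + k \<and> vir_obstr (b + 1 + k) \<alpha> \<noteq> 0"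
    and l: "\<And>m F' G'. ext_list a c d \<alpha> \<alpha>' m F' G' \<longleftrightarrow> m = 1 \<and> (\<exists>t. t \<noteq> 0 \<and> F' = F t \<and> G' = G t)"
  shows "\<exists>n b. ext_basis a c d \<alpha> \<alpha>' n b"
proof (rule ext_basis_special1[OF F])
  show "G 1 \<noteq> 0" using G by auto
  show "\<exists>t. g = cst t * G 1" if "coc a c d \<alpha> \<alpha>' f g" for f g
    by (rule dgen_multiple'[OF _ _ _ G, of b \<alpha> \<alpha>']) (use cocD(2)[OF that] cocD(2)[OF F] a n in auto)
  show "\<exists>\<phi>. h = cob \<alpha> \<alpha>' \<phi>" if "\<And>z x y. dvir \<alpha> \<alpha>' h z x y = 0" for h
    by (rule dvir_trivial_ex[OF that n \<alpha>]) (use v in auto)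
  show "ext_list a c d \<alpha> \<alpha>' m F' G' \<longleftrightarrow> m = 1 \<and> (\<exists>t. t \<noteq> 0 \<and> F' = cst t * F 1 \<and> G' = cst t * G 1)" for m F' G'
    unfolding l by (simp only: sF[symmetric] sG[symmetric])
qed

lemma ext_basis_family2:
  assumes a: "a = - of_nat b" and F: "coc a c d \<alpha> \<alpha>' (F 1) (G 1)"
    and n: "\<alpha>' = \<alpha> + of_nat (b + 1 + k)" and G: "cf (G 1) 0 k \<noteq> 0"
    and sF: "\<And>t. F t = cst t * F 1" and sG: "\<And>t. G t = cst t * G 1"
    and sw: "\<And>s. cst s * w 1 = w s" and w: "\<And>z x y. dvir \<alpha> \<alpha>' (w 1) z x y = 0"
    and w0: "\<And>s \<phi>. w s = cob \<alpha> \<alpha>' \<phi> \<Longrightarrow> s = 0"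
    and v: "\<And>h. (\<And>z x y. dvir \<alpha> \<alpha>' h z x y = 0) \<Longrightarrow> \<exists>s \<phi>. h = w s + cob \<alpha> \<alpha>' \<phi>"
    and l: "\<And>m F' G'. ext_list a c d \<alpha> \<alpha>' m F' G' \<longleftrightarrow>
      m = 2 \<and> (\<exists>s t. (s, t) \<noteq> (0, 0) \<and> F' = w s + F t \<and> G' = G t)"
  shows "\<exists>n b. ext_basis a c d \<alpha> \<alpha>' n b"
proof (rule ext_basis_special2[OF F, where w = "w 1"], unfold sw sF[symmetric] sG[symmetric])
  show "G 1 \<noteq> 0" using G by auto
  show "\<exists>t. g = G t" if "coc a c d \<alpha> \<alpha>' f g" for f g
  proof -
    have "\<exists>t. g = cst t * G 1"
      by (rule dgen_multiple'[OF _ _ _ G, of b \<alpha> \<alpha>']) (use cocD(2)[OF that] cocD(2)[OF F] a n in auto)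
    then show ?thesis using sG by metis
  qed
qed (use w w0 v l in blast)+

lemma ext_list_form_m1:
  "vir2 s - cst (2 * d * t) * vx ^ 2 * vl - cst (c * t) * (2 * vx ^ 2 - vl ^ 2) = vir2 s + F_m1iii c d t"
  "vir3 s - cst (d * t / 4) * (2 * vx ^ 3 * vl + vl ^ 4)
    - cst (c * t / 2) * (vx ^ 3 - 2 * vx * vl ^ 2 - 2 * vl ^ 3) = vir3 s + F_m1v c d t"
  by (rule ev_eqI, unfold F_m1iii_def F_m1v_def ev_simps, simp)+

lemma ext_list_m1:
  assumes "ext_list (- 1) c d \<alpha> \<alpha>' m F G"
  shows "vlist \<alpha> \<alpha>' m F \<and> G = 0 \<and> \<not> (\<alpha> = - (1 / 2) \<and> \<alpha>' = 3 / 2) \<and> \<not> (\<alpha> = - 1 \<and> \<alpha>' = 2) \<or>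
    \<alpha> = - (1 / 2) \<and> \<alpha>' = 3 / 2 \<and> m = 2 \<and> (\<exists>s t. (s, t) \<noteq> (0, 0) \<and> F = vir2 s + F_m1iii c d t \<and> G = G_m1iii t) \<or>
    \<alpha> = - 1 \<and> \<alpha>' = 2 \<and> m = 2 \<and> (\<exists>s t. (s, t) \<noteq> (0, 0) \<and> F = vir3 s + F_m1v c d t \<and> G = G_m1v t)"
  using assms
proof (cases rule: ext_list.cases)
  case am1_iii
  then show ?thesis unfolding ext_list_form_m1 G_m1iii_def by blast
next
  case am1_v
  then show ?thesis unfolding ext_list_form_m1 G_m1v_def by blast
qed (auto simp: vlist_def r19_simps)

lemma ext_list_m4:
  assumes "ext_list (- 4) c d \<alpha> \<alpha>' m F G"
  shows "vlist \<alpha> \<alpha>' m F \<and> G = 0 \<or> m = 1 \<and> (\<exists>t. t \<noteq> 0 \<and>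
    (\<alpha>' = \<alpha> + 5 \<and> \<alpha> \<notin> {- 2, - 4} \<and> F = F_a4v \<alpha> c t \<and> G = G_a4v t \<or>
     \<alpha> = - 2 \<and> \<alpha>' = 3 \<and> F = F_a4vi c t \<and> G = G_a4vi t \<or>
     \<alpha>' = \<alpha> + 6 \<and> \<alpha> \<noteq> - (5 / 2) \<and> vir_obstr 6 \<alpha> \<noteq> 0 \<and> F = F_a4viii \<alpha> c t \<and> G = G_a4viii \<alpha> t \<or>
     \<alpha> = - (5 / 2) \<and> \<alpha>' = 7 / 2 \<and> F = F_a4ix c t \<and> G = G_a4ix t \<or>
     \<alpha> = - 6 \<and> \<alpha>' = 1 \<and> F = F_a4xi c t \<and> G = G_a4xi t))"
  using assms
proof (cases rule: ext_list.cases)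
  case a4_v
  then show ?thesis unfolding F_a4v_def G_a4v_def by blast
next
  case a4_vi
  then show ?thesis unfolding F_a4vi_def G_a4vi_def by blast
next
  case a4_viii
  then show ?thesis unfolding F_a4viii_def G_a4viii_def r19_iff by blast
next
  case a4_ix
  then show ?thesis unfolding F_a4ix_def G_a4ix_def by blast
next
  case a4_xi
  then show ?thesis unfolding F_a4xi_def G_a4xi_def by blast
qed (auto simp: vlist_def r19_simps)

lemma ext_list_m6:
  assumes "ext_list (- 6) c d \<alpha> \<alpha>' m F G"
  shows "vlist \<alpha> \<alpha>' m F \<and> G = 0 \<or> m = 1 \<and> (\<exists>t. t \<noteq> 0 \<and>
    (\<alpha>' = \<alpha> + 7 \<and> vir_obstr 7 \<alpha> = 0 \<and> F = F_a6vii \<alpha> c t \<and> G = G_a6vii t \<or>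
     \<alpha> = - 1 \<and> \<alpha>' = 7 \<and> F = F_a6viii c t \<and> G = G_a6viii t \<or>
     \<alpha> = - 6 \<and> \<alpha>' = 2 \<and> F = F_a6ix c t \<and> G = G_a6ix t))"
  using assms
proof (cases rule: ext_list.cases)
  case (a6_vii \<epsilon>)
  then have "\<alpha>' = \<alpha> + 7" by simp
  moreover have "vir_obstr 7 \<alpha> = 0" using a6_vii unfolding r22_iff by auto
  ultimately show ?thesis using a6_vii unfolding F_a6vii_def G_a6vii_def by blast
next
  case a6_viii
  then show ?thesis unfolding F_a6viii_def G_a6viii_def by blast
next
  case a6_ix
  then show ?thesis unfolding F_a6ix_def G_a6ix_def by blast
qed (auto simp: vlist_def r19_simps)

lemma ext_list_vii:
  assumes "vir_obstr 7 \<alpha> = 0" "t \<noteq> 0"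
  shows "ext_list (- 6) c d \<alpha> (\<alpha> + 7) 1 (F_a6vii \<alpha> c t) (G_a6vii t)"
proof -
  obtain \<epsilon> :: complex where e: "\<epsilon> \<in> {1, - 1}" "\<alpha> = - 3 + \<epsilon> * r22 / 2"
  proof -
    from assms(1) have "\<exists>\<epsilon>\<in>{1, - 1 :: complex}. \<alpha> = - 3 + \<epsilon> * r22 / 2"
      unfolding r22_iff
    proof (elim disjE)
      assume "\<alpha> = - 3 + r22 / 2"
      then show ?thesis by (intro bexI[of _ 1]) auto
    next
      assume "\<alpha> = - 3 - r22 / 2"
      then show ?thesis by (intro bexI[of _ "- 1"]) auto
    qed
    then show ?thesis using that by blast
  qed
  then have "\<alpha> + 7 = 4 + \<epsilon> * r22 / 2" by simp
  from a6_vii[OF e this assms(2)] show ?thesis unfolding F_a6vii_def G_a6vii_def .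
qed

lemma cf_G:
  "cf (G_m1iii 1) 0 0 \<noteq> 0" "cf (G_m1v 1) 0 1 \<noteq> 0" "cf (G_a4v 1) 0 0 \<noteq> 0" "cf (G_a4vi 1) 0 0 \<noteq> 0"
  "cf (G_a4viii \<alpha> 1) 0 1 \<noteq> 0" "cf (G_a4ix 1) 0 1 \<noteq> 0" "cf (G_a4xi 1) 0 2 \<noteq> 0" "cf (G_a6vii 1) 0 0 \<noteq> 0"
  "cf (G_a6viii 1) 0 1 \<noteq> 0" "cf (G_a6ix 1) 0 1 \<noteq> 0"
  by (simp_all add: G_m1iii_def G_m1v_def G_a4v_def G_a4vi_def G_a4viii_def G_a4ix_def G_a4xi_def
    G_a6vii_def G_a6viii_def G_a6ix_def bipoly_numeral_simps)

lemma ext_basis_m1: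
  assumes \<alpha>: "\<alpha> \<noteq> 0" and cd: "(c, d) \<noteq> (0, 0)"
  shows "\<exists>n b. ext_basis (- 1) c d \<alpha> \<alpha>' n b"
proof -
  consider "\<alpha> = - (1 / 2)" "\<alpha>' = 3 / 2" | "\<alpha> = - 1" "\<alpha>' = 2"
    | "\<not> (\<alpha> = - (1 / 2) \<and> \<alpha>' = 3 / 2)" "\<not> (\<alpha> = - 1 \<and> \<alpha>' = 2)" by blast
  then show ?thesis
  proof cases
    case 1
    show ?thesis
      unfolding 1
    proof (rule ext_basis_family2[where b = 1 and k = 0 and w = vir2, OF _ coc_m1iii _ cf_G(1) scale_m1iii])
      show "cst s * vir2 1 = vir2 s" for s by (rule vir_unit)
      show "dvir (- (1 / 2)) (3 / 2) (vir2 1) z x y = 0" for z x y using dvir_vir2[of "- (1 / 2)" 1] by simp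
      show "s = 0" if "vir2 s = cob (- (1 / 2)) (3 / 2) \<phi>" for s \<phi>
        using vir_independent(2)[of "- (1 / 2)" s "3 / 2" \<phi>] that by simp
      show "\<exists>s \<phi>. h = vir2 s + cob (- (1 / 2)) (3 / 2) \<phi>" if "\<And>z x y. dvir (- (1 / 2)) (3 / 2) h z x y = 0" for h
      proof -
        have e: "- (1 / 2) + of_nat 2 = (3 / 2 :: complex)" "- (1 / 2) \<noteq> (0 :: complex)" by simp_all
        show ?thesis using dvir_class2[of "- (1 / 2)" h, unfolded e(1), OF that e(2)] by metis
      qed
      show "ext_list (- 1) c d (- (1 / 2)) (3 / 2) m F G \<longleftrightarrow> m = 2 \<and>
        (\<exists>s t. (s, t) \<noteq> (0, 0) \<and> F = vir2 s + F_m1iii c d t \<and> G = G_m1iii t)" (is "?l \<longleftrightarrow> ?r") for m F G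
      proof
        assume ?l
        then show ?r using ext_list_m1[of c d "- (1 / 2)" "3 / 2" m F G] by simp
      next
        assume ?r
        then show ?l unfolding ext_list_form_m1[symmetric] G_m1iii_def using am1_iii by metis
      qed
    qed simp_all
  next
    case 2
    show ?thesis
      unfolding 2
    proof (rule ext_basis_family2[where b = 1 and k = 1 and w = vir3, OF _ coc_m1v _ cf_G(2) scale_m1v])
      show "cst s * vir3 1 = vir3 s" for s by (rule vir_unit)
      show "dvir (- 1) 2 (vir3 1) z x y = 0" for z x y using dvir_vir3[of "- 1" 1] by simp
      show "s = 0" if "vir3 s = cob (- 1) 2 \<phi>" for s \<phi>
        using vir_independent(3)[of "- 1" s 2 \<phi>] that by simp
      show "\<exists>s \<phi>. h = vir3 s + cob (- 1) 2 \<phi>" if "\<And>z x y. dvir (- 1) 2 h z x y = 0" for h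
      proof -
        have e: "- 1 + of_nat 3 = (2 :: complex)" "- 1 \<noteq> (0 :: complex)" by simp_all
        show ?thesis using dvir_class3[of "- 1" h, unfolded e(1), OF that e(2)] by metis
      qed
      show "ext_list (- 1) c d (- 1) 2 m F G \<longleftrightarrow> m = 2 \<and>
        (\<exists>s t. (s, t) \<noteq> (0, 0) \<and> F = vir3 s + F_m1v c d t \<and> G = G_m1v t)" (is "?l \<longleftrightarrow> ?r") for m F G
      proof
        assume ?l
        then show ?r using ext_list_m1[of c d "- 1" 2 m F G] by simp
      next
        assume ?r
        then show ?l unfolding ext_list_form_m1[symmetric] G_m1v_def using am1_v by metis
      qed
    qed simp_all
  next
    case 3
    show ?thesis
    proof (rule ext_basis_vir[OF \<alpha>])
      show "g = 0" if "coc (- 1) c d \<alpha> \<alpha>' f g" for f g using coc_m1_dgen[OF that _ cd \<alpha>] 3 by blast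
      show "ext_list (- 1) c d \<alpha> \<alpha>' m F G \<longleftrightarrow> vlist \<alpha> \<alpha>' m F \<and> G = 0" for m F G
        using ext_list_m1[of c d \<alpha> \<alpha>' m F G] ext_list_vlist(3)[of \<alpha> \<alpha>' m F c d] 3 by blast
    qed
  qed
qed

lemma ext_basis_m4:
  assumes \<alpha>: "\<alpha> \<noteq> 0" and c: "c \<noteq> 0"
  shows "\<exists>n b. ext_basis (- 4) c d \<alpha> \<alpha>' n b"
proof -
  note D = ext_list_m4[of c d \<alpha> \<alpha>']
  have P55: "vir_obstr 5 \<alpha> = \<alpha> * (\<alpha> + 4)" by (simp add: vir_obstr_def power2_eq_square algebra_simps)
  consider "\<alpha>' = \<alpha> + 5" "\<alpha> \<notin> {- 2, - 4}" | "\<alpha> = - 2" "\<alpha>' = 3"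
    | "\<alpha>' = \<alpha> + 6" "vir_obstr 6 \<alpha> \<noteq> 0" "\<alpha> \<noteq> - (5 / 2)" | "\<alpha> = - (5 / 2)" "\<alpha>' = 7 / 2" | "\<alpha> = - 6" "\<alpha>' = 1"
    | "\<not> (\<alpha>' = \<alpha> + 5 \<and> \<alpha> \<noteq> - 4)" "\<not> (\<alpha>' = \<alpha> + 6 \<and> vir_obstr 6 \<alpha> \<noteq> 0)" "\<not> (\<alpha> = - 6 \<and> \<alpha>' = 1)"
    by force
  then show ?thesis
  proof cases
    case 1
    show ?thesis
    proof (rule ext_basis_family1[where b = 4 and k = 0, OF _ _ _ cf_G(3) scale_a4v])
      show "coc (- 4) c d \<alpha> \<alpha>' (F_a4v \<alpha> c 1) (G_a4v 1)" unfolding 1(1) by (rule coc_a4v[OF \<alpha> 1(2)])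
      have "\<alpha> + 4 \<noteq> 0" using 1(2) by (auto simp: add_eq_0_iff2)
      then show "7 \<le> 4 + 1 + (0::nat) \<or> 5 \<le> 4 + 1 + (0::nat) \<and> vir_obstr (4 + 1 + 0) \<alpha> \<noteq> 0" using P55 \<alpha> by simp
      show "ext_list (- 4) c d \<alpha> \<alpha>' m F G \<longleftrightarrow> m = 1 \<and> (\<exists>t. t \<noteq> 0 \<and> F = F_a4v \<alpha> c t \<and> G = G_a4v t)"
        (is "?l \<longleftrightarrow> ?r") for m F G
      proof
        assume ?l
        from D[OF this] 1 show ?r by (auto simp: vlist_def)
      next
        assume ?r
        then show ?l unfolding F_a4v_def G_a4v_def 1(1) using a4_v[OF 1(2) _ refl] by metis
      qed
    qed (use 1 \<alpha> in auto)
  next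
    case 2
    show ?thesis
      unfolding 2
    proof (rule ext_basis_family1[where b = 4 and k = 0, OF _ coc_a4vi _ cf_G(4) scale_a4vi])
      show "ext_list (- 4) c d (- 2) 3 m F G \<longleftrightarrow> m = 1 \<and> (\<exists>t. t \<noteq> 0 \<and> F = F_a4vi c t \<and> G = G_a4vi t)"
        (is "?l \<longleftrightarrow> ?r") for m F G
      proof
        assume ?l
        from ext_list_m4[OF this] show ?r by (auto simp: vlist_def)
      next
        assume ?r
        then show ?l unfolding F_a4vi_def G_a4vi_def using a4_vi by metis
      qed
    qed (auto simp: vir_obstr_def)
  next
    case 3
    have nz: "2 * \<alpha> + 5 \<noteq> 0"
    proof
      assume "2 * \<alpha> + 5 = 0"
      then have "2 * (\<alpha> + 5 / 2) = 0" by (simp add: algebra_simps)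
      then have "\<alpha> = - (5 / 2)" unfolding eq_neg_iff_add_eq_0 by (metis mult_eq_0_iff zero_neq_numeral)
      then show False using 3(3) by simp
    qed
    show ?thesis
    proof (rule ext_basis_family1[where b = 4 and k = 1, OF _ _ _ cf_G(5) scale_a4viii])
      show "coc (- 4) c d \<alpha> \<alpha>' (F_a4viii \<alpha> c 1) (G_a4viii \<alpha> 1)"
        unfolding 3(1) by (rule coc_a4viii[OF nz 3(2)])
      show "ext_list (- 4) c d \<alpha> \<alpha>' m F G \<longleftrightarrow> m = 1 \<and> (\<exists>t. t \<noteq> 0 \<and> F = F_a4viii \<alpha> c t \<and> G = G_a4viii \<alpha> t)"
        (is "?l \<longleftrightarrow> ?r") for m F G
      proof
        assume ?l
        from D[OF this] 3 show ?r by (auto simp: vlist_def)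
      next
        assume ?r
        moreover have "\<alpha> \<notin> {- (5 / 2), - (5 / 2) + r19 / 2, - (5 / 2) - r19 / 2}" using 3(2,3) unfolding r19_iff by simp
        ultimately show ?l unfolding F_a4viii_def G_a4viii_def 3(1) using a4_viii[OF _ _ refl] by metis
      qed
    qed (use 3 \<alpha> in auto)
  next
    case 4
    show ?thesis
      unfolding 4
    proof (rule ext_basis_family1[where b = 4 and k = 1, OF _ coc_a4ix _ cf_G(6) scale_a4ix])
      show "ext_list (- 4) c d (- (5 / 2)) (7 / 2) m F G \<longleftrightarrow> m = 1 \<and> (\<exists>t. t \<noteq> 0 \<and> F = F_a4ix c t \<and> G = G_a4ix t)"
        (is "?l \<longleftrightarrow> ?r") for m F G
      proof
        assume ?l
        from ext_list_m4[OF this] show ?r by (auto simp: vlist_def vir_obstr_def power2_eq_square)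
      next
        assume ?r
        then show ?l unfolding F_a4ix_def G_a4ix_def using a4_ix by metis
      qed
    qed (auto simp: vir_obstr_def power2_eq_square)
  next
    case 5
    show ?thesis
      unfolding 5
    proof (rule ext_basis_family1[where b = 4 and k = 2, OF _ coc_a4xi _ cf_G(7) scale_a4xi])
      show "ext_list (- 4) c d (- 6) 1 m F G \<longleftrightarrow> m = 1 \<and> (\<exists>t. t \<noteq> 0 \<and> F = F_a4xi c t \<and> G = G_a4xi t)"
        (is "?l \<longleftrightarrow> ?r") for m F G
      proof
        assume ?l
        from ext_list_m4[OF this] show ?r by (auto simp: vlist_def)
      next
        assume ?r
        then show ?l unfolding F_a4xi_def G_a4xi_def using a4_xi by metis
      qed
    qed auto
  next
    case 6
    show ?thesis
    proof (rule ext_basis_vir[OF \<alpha>])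
      show "g = 0" if "coc (- 4) c d \<alpha> \<alpha>' f g" for f g using coc_m4_dgen[OF that _ c \<alpha>] 6 by blast
      \<comment> \<open>These two isolated entries have \<alpha>' - \<alpha> = 5 and 6 with nonzero
        obstruction, which the assumptions of the present case rule out.\<close>
      have "\<not> (\<alpha> = - 2 \<and> \<alpha>' = 3)" "\<not> (\<alpha> = - (5 / 2) \<and> \<alpha>' = 7 / 2)"
        using 6 by (auto simp: vir_obstr_def power2_eq_square)
      then show "ext_list (- 4) c d \<alpha> \<alpha>' m F G \<longleftrightarrow> vlist \<alpha> \<alpha>' m F \<and> G = 0" for m F G
        using D[of m F G] ext_list_vlist(4)[of \<alpha> \<alpha>' m F c d] 6 by blast
    qed
  qed
qed

lemma ext_basis_m6:
  assumes \<alpha>: "\<alpha> \<noteq> 0" and c: "c \<noteq> 0"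
  shows "\<exists>n b. ext_basis (- 6) c d \<alpha> \<alpha>' n b"
proof -
  note D = ext_list_m6[of c d \<alpha> \<alpha>']
  consider "\<alpha>' = \<alpha> + 7" "vir_obstr 7 \<alpha> = 0" | "\<alpha> = - 1" "\<alpha>' = 7" | "\<alpha> = - 6" "\<alpha>' = 2"
    | "\<not> (\<alpha>' = \<alpha> + 7 \<and> vir_obstr 7 \<alpha> = 0)" "\<not> (\<alpha> = - 1 \<and> \<alpha>' = 7)" "\<not> (\<alpha> = - 6 \<and> \<alpha>' = 2)" by blast
  then show ?thesis
  proof cases
    case 1
    show ?thesis
    proof (rule ext_basis_family1[where b = 6 and k = 0, OF _ _ _ cf_G(8) scale_a6vii])
      show "coc (- 6) c d \<alpha> \<alpha>' (F_a6vii \<alpha> c 1) (G_a6vii 1)" unfolding 1(1) by (rule coc_a6vii[OF 1(2)])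
      show "ext_list (- 6) c d \<alpha> \<alpha>' m F G \<longleftrightarrow> m = 1 \<and> (\<exists>t. t \<noteq> 0 \<and> F = F_a6vii \<alpha> c t \<and> G = G_a6vii t)"
        (is "?l \<longleftrightarrow> ?r") for m F G
      proof
        assume ?l
        from D[OF this] 1 show ?r by (auto simp: vlist_def)
      next
        assume ?r
        then show ?l unfolding 1(1) using ext_list_vii[OF 1(2)] by metis
      qed
    qed (use 1 \<alpha> in auto)
  next
    case 2
    show ?thesis
      unfolding 2
    proof (rule ext_basis_family1[where b = 6 and k = 1, OF _ coc_a6viii _ cf_G(9) scale_a6viii])
      show "ext_list (- 6) c d (- 1) 7 m F G \<longleftrightarrow> m = 1 \<and> (\<exists>t. t \<noteq> 0 \<and> F = F_a6viii c t \<and> G = G_a6viii t)"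
        (is "?l \<longleftrightarrow> ?r") for m F G
      proof
        assume ?l
        from ext_list_m6[OF this] show ?r by (auto simp: vlist_def)
      next
        assume ?r
        then show ?l unfolding F_a6viii_def G_a6viii_def using a6_viii by metis
      qed
    qed auto
  next
    case 3
    show ?thesis
      unfolding 3
    proof (rule ext_basis_family1[where b = 6 and k = 1, OF _ coc_a6ix _ cf_G(10) scale_a6ix])
      show "ext_list (- 6) c d (- 6) 2 m F G \<longleftrightarrow> m = 1 \<and> (\<exists>t. t \<noteq> 0 \<and> F = F_a6ix c t \<and> G = G_a6ix t)"
        (is "?l \<longleftrightarrow> ?r") for m F G
      proof
        assume ?l
        from ext_list_m6[OF this] show ?r by (auto simp: vlist_def)
      next
        assume ?r
        then show ?l unfolding F_a6ix_def G_a6ix_def using a6_ix by metis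
      qed
    qed auto
  next
    case 4
    show ?thesis
    proof (rule ext_basis_vir[OF \<alpha>])
      show "g = 0" if "coc (- 6) c d \<alpha> \<alpha>' f g" for f g using coc_m6_dgen[OF that _ c \<alpha>] 4 by blast
      show "ext_list (- 6) c d \<alpha> \<alpha>' m F G \<longleftrightarrow> vlist \<alpha> \<alpha>' m F \<and> G = 0" for m F G
        using D[of m F G] ext_list_vlist(5)[of \<alpha> \<alpha>' m F c d] 4 by blast
    qed
  qed
qed

theorem ext_basis_exists:
  assumes "a \<in> {1, 0, - 1, - 4, - 6}" "Q_poly a c d \<noteq> 0" "\<alpha> \<noteq> 0"
  obtains n b where "ext_basis a c d \<alpha> \<alpha>' n b"
proof -
  have "\<exists>n b. ext_basis a c d \<alpha> \<alpha>' n b"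
    using assms(1)
  proof (elim insertE emptyE)
    assume "a = 1"
    then show ?thesis using assms(2) Q_poly_nonzero(1) ext_basis_a1[OF assms(3)] by blast
  next
    assume "a = 0"
    then show ?thesis using assms(2) Q_poly_nonzero(2) ext_basis_a0[OF assms(3)] by blast
  next
    assume "a = - 1"
    then show ?thesis using assms(2) Q_poly_nonzero(3) ext_basis_m1[OF assms(3)] by blast
  next
    assume "a = - 4"
    then show ?thesis using assms(2) Q_poly_nonzero(4) ext_basis_m4[OF assms(3)] by blast
  next
    assume "a = - 6"
    then show ?thesis using assms(2) Q_poly_nonzero(5) ext_basis_m6[OF assms(3)] by blast
  qed
  then show ?thesis using that by blast
qed

section \<open>Conformal modules and extensions\<close>

text \<open>The sum defining \<open>lam_subst\<close> ends at the degree, which is not additive; a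
  common upper bound makes sums of polynomials comparable.\<close>

lemma lam_subst_le:
  assumes "module s" "degree P \<le> n"
  shows "lam_subst s P q = (\<Sum>i\<le>n. s (q ^ i) (coeff P i))"
proof -
  interpret module s by fact
  show ?thesis
    unfolding lam_subst_def
    by (rule sum.mono_neutral_left) (use assms(2) in \<open>auto simp: coeff_eq_0\<close>)
qed

lemma lam_subst_add:
  assumes "module s" shows "lam_subst s (P + Q) q = lam_subst s P q + lam_subst s Q q"
proof -
  interpret module s by fact
  let ?n = "max (degree P) (degree Q)"
  show ?thesis
    using lam_subst_le[OF assms, of P ?n] lam_subst_le[OF assms, of Q ?n]
      lam_subst_le[OF assms, of "P + Q" ?n] degree_add_le_max[of P Q]
    by (simp add: scale_right_distrib sum.distrib)
qed

lemma lam_subst_0: "module s \<Longrightarrow> lam_subst s 0 q = 0"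
  by (simp add: lam_subst_def module.scale_zero_right)

lemma lam_subst_map:
  assumes "module s'" and "h 0 = 0" and add: "\<And>u w. h (u + w) = h u + h w" and h: "\<And>q u. h (s q u) = s' q (h u)"
  shows "lam_subst s' (map_poly h P) q = h (lam_subst s P q)"
proof -
  have sum: "h (\<Sum>i\<in>I. F i) = (\<Sum>i\<in>I. h (F i))" if "finite I" for F and I :: "nat set"
    using that by induction (simp_all add: \<open>h 0 = 0\<close> add)
  have "lam_subst s' (map_poly h P) q = (\<Sum>i\<le>degree P. s' (q ^ i) (coeff (map_poly h P) i))"
    by (rule lam_subst_le[OF assms(1)]) (simp add: map_poly_degree_leq)
  also have "\<dots> = h (lam_subst s P q)"
    by (simp add: lam_subst_def sum coeff_map_poly \<open>h 0 = 0\<close> h)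
  finally show ?thesis .
qed

lemma lam_subst_bact:
  assumes "module s" shows "lam_subst s (bact s f v) q = s (poly f q) v"
proof -
  interpret module s by fact
  have "lam_subst s (bact s f v) q = (\<Sum>i\<le>degree f. s (q ^ i) (coeff (bact s f v) i))"
    by (rule lam_subst_le[OF assms]) (simp add: bact_def map_poly_degree_leq)
  also have "\<dots> = s (poly f q) v"
    by (simp add: bact_def coeff_map_poly poly_altdef scale_sum_left mult.commute)
  finally show ?thesis .
qed

text \<open>Replacing \<open>x\<close> by \<open>2 x\<close> and subtracting \<open>2\<^sup>n\<close> times the original eliminates the leading term.\<close>

lemma polynomial_identity:
  fixes s :: "complex poly \<Rightarrow> 'v::ab_group_add \<Rightarrow> 'v"
  assumes "module s" and "\<And>x. (\<Sum>i\<le>n. s [:x ^ i:] (c i)) = 0" and "i \<le> n"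
  shows "c i = 0"
  using assms(2,3)
proof (induction n arbitrary: c i)
  case 0
  interpret module s by fact
  show ?case using 0(1)[of 1] 0(2) by (simp flip: one_pCons)
next
  case (Suc n)
  interpret module s by fact
  let ?k = "\<lambda>i. 2 ^ i - 2 ^ Suc n :: complex"
  have "(\<Sum>i\<le>n. s [:x ^ i:] (s [:?k i:] (c i))) = 0" for x
  proof -
    have "(\<Sum>i\<le>Suc n. s [:x ^ i:] (s [:?k i:] (c i))) =
      (\<Sum>i\<le>Suc n. s [:(2 * x) ^ i:] (c i) - s [:2 ^ Suc n:] (s [:x ^ i:] (c i)))"
      by (rule sum.cong) (simp_all add: power_mult_distrib algebra_simps flip: scale_left_diff_distrib)
    also have "\<dots> = (\<Sum>i\<le>Suc n. s [:(2 * x) ^ i:] (c i)) - s [:2 ^ Suc n:] (\<Sum>i\<le>Suc n. s [:x ^ i:] (c i))"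
      by (simp only: sum_subtractf scale_sum_right)
    also have "\<dots> = 0" by (simp only: Suc.prems(1) scale_zero_right diff_zero)
    finally show ?thesis by simp
  qed
  then have *: "s [:?k i:] (c i) = 0" if "i \<le> n" for i using Suc.IH[of "\<lambda>i. s [:?k i:] (c i)" i] that by blast
  have lt: "c i = 0" if "i \<le> n" for i
  proof -
    have "(2::complex) ^ i \<noteq> 2 ^ Suc n"
    proof
      assume "(2::complex) ^ i = 2 ^ Suc n"
      then have "of_nat (2 ^ i) = (of_nat (2 ^ Suc n) :: complex)" by simp
      then have "(2::nat) ^ i = 2 ^ Suc n" unfolding of_nat_eq_iff .
      then show False using that by (simp add: power_inject_exp del: power_Suc)
    qed
    then have "s [:inverse (?k i):] (s [:?k i:] (c i)) = c i" by (simp flip: one_pCons)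
    then show ?thesis unfolding *[OF that] by simp
  qed
  then have "s [:1 ^ Suc n:] (c (Suc n)) = 0" using Suc.prems(1)[of 1] by simp
  then have "c (Suc n) = 0" by (simp flip: one_pCons)
  then show ?case using lt Suc.prems(2) by (cases "i = Suc n") auto
qed

text \<open>The module may have torsion, so roots cannot be counted as for polynomials over a
  domain; elimination by nonzero complex scalars takes that place.\<close>

lemma lam_subst_eqI:
  assumes "module s" and "\<And>x. lam_subst s P [:x:] = lam_subst s Q [:x:]"
  shows "P = Q"
proof -
  interpret module s by fact
  let ?n = "max (degree P) (degree Q)"
  have "(\<Sum>i\<le>?n. s [:x ^ i:] (coeff P i - coeff Q i)) = 0" for x
    using assms(2)[of x] lam_subst_le[OF assms(1), of P ?n] lam_subst_le[OF assms(1), of Q ?n]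
    by (simp add: scale_right_diff_distrib sum_subtractf poly_const_pow)
  then have *: "coeff P i - coeff Q i = 0" if "i \<le> ?n" for i
    using polynomial_identity[OF assms(1), where n = ?n and c = "\<lambda>i. coeff P i - coeff Q i"] that by blast
  show ?thesis
  proof (rule poly_eqI)
    fix i show "coeff P i = coeff Q i"
      using *[of i] by (cases "i \<le> ?n") (auto simp: coeff_eq_0)
  qed
qed

lemma pcompose_shift_pCons: "pcompose (pCons k p) q = [:k:] + q * pcompose p q"
  by (simp add: pcompose_pCons)

context sesquilinear
begin

definition lev :: "complex \<Rightarrow> 'r \<Rightarrow> 'v \<Rightarrow> 'v"
  where "lev x a v = lam_subst s (prod a v) [:x:]"

lemma module_s: "module s" ..

lemma lev_add: "lev x (a + b) v = lev x a v + lev x b v" "lev x a (v + w) = lev x a v + lev x a w"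
  by (simp_all add: lev_def add_left add_right lam_subst_add[OF module_s])

lemma lev_const:
  "lev x (r [:k:] a) v = s [:k:] (lev x a v)" "lev x a (s [:k:] v) = s [:k:] (lev x a v)"
proof -
  have "lam_subst s (map_poly (s [:k:]) P) [:x:] = s [:k:] (lam_subst s P [:x:])" for P
    by (rule lam_subst_map[OF module_s]) (simp_all add: V.scale_right_distrib mult.commute)
  then show "lev x (r [:k:] a) v = s [:k:] (lev x a v)" "lev x a (s [:k:] v) = s [:k:] (lev x a v)"
    by (simp_all add: lev_def scale_left scale_right)
qed

text \<open>Sesquilinearity is postulated for constants and for the derivation; induction on the
  polynomial extends it to all scalars.\<close>

lemma lev_scale_left: "lev x (r p a) v = s [:poly p (- x):] (lev x a v)"
proof (induction p)
  case 0
  have "lev x (r 0 a) v = lev x (r [:0:] a) v" by (simp only: pCons_0_0)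
  also have "\<dots> = 0" by (simp only: lev_const) (simp add: pCons_0_0)
  finally show ?case by simp
next
  case (pCons k p)
  have "pCons k p = [:k:] + [:0, 1:] * p" by simp
  then have "r (pCons k p) a = r [:k:] a + r [:0, 1:] (r p a)"
    by (simp only: R.scale_left_distrib R.scale_scale)
  then have "lev x (r (pCons k p) a) v = s [:k:] (lev x a v) + s [:- x:] (s [:poly p (- x):] (lev x a v))"
    by (simp only: lev_add lev_const) (simp only: lev_def deriv_left pCons.IH[unfolded lev_def])
  also have "\<dots> = s [:poly (pCons k p) (- x):] (lev x a v)"
    by (simp add: mult.commute flip: V.scale_left_distrib)
  finally show ?case .
qed

lemma lev_scale_right: "lev x a (s p v) = s (pcompose p [:x, 1:]) (lev x a v)"
proof (induction p)
  case 0
  have "lev x a (s 0 v) = lev x a (s [:0:] v)" by (simp only: pCons_0_0)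
  also have "\<dots> = 0" by (simp only: lev_const) (simp add: pCons_0_0)
  finally show ?case by simp
next
  case (pCons k p)
  have "pCons k p = [:k:] + [:0, 1:] * p" by simp
  then have "s (pCons k p) v = s [:k:] v + s [:0, 1:] (s p v)"
    by (simp only: V.scale_left_distrib V.scale_scale)
  then have "lev x a (s (pCons k p) v) =
    s [:k:] (lev x a v) + s [:x, 1:] (s (pcompose p [:x, 1:]) (lev x a v))"
    by (simp only: lev_add lev_const) (simp only: lev_def deriv_right pCons.IH[unfolded lev_def])
  also have "\<dots> = s (pcompose (pCons k p) [:x, 1:]) (lev x a v)"
    by (simp only: V.scale_scale pcompose_shift_pCons V.scale_left_distrib)
  finally show ?case .
qed

end

text \<open>A product is usually known through its values at \<lambda> = x; agreement at all x gives
  back the identities between polynomials in \<lambda>.\<close>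

lemma sesquilinearI:
  fixes r :: "complex poly \<Rightarrow> 'r::ab_group_add \<Rightarrow> 'r"
    and s :: "complex poly \<Rightarrow> 'v::ab_group_add \<Rightarrow> 'v" and prod :: "'r \<Rightarrow> 'v \<Rightarrow> 'v poly"
  assumes r: "module r" and s: "module s"
    and "\<And>x a b v. lam_subst s (prod (a + b) v) [:x:] = lam_subst s (prod a v) [:x:] + lam_subst s (prod b v) [:x:]"
    and "\<And>x a v w. lam_subst s (prod a (v + w)) [:x:] = lam_subst s (prod a v) [:x:] + lam_subst s (prod a w) [:x:]"
    and l: "\<And>x p a v. lam_subst s (prod (r p a) v) [:x:] = s [:poly p (- x):] (lam_subst s (prod a v) [:x:])"
    and r: "\<And>x p a v. lam_subst s (prod a (s p v)) [:x:] = s (pcompose p [:x, 1:]) (lam_subst s (prod a v) [:x:])"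
  shows "sesquilinear r s prod"
proof -
  interpret R: module r by fact
  interpret V: module s by fact
  have m: "lam_subst s (map_poly (s [:k:]) P) [:x:] = s [:k:] (lam_subst s P [:x:])" for P k x
    by (rule lam_subst_map[OF s]) (simp_all add: V.scale_right_distrib mult.commute)
  show ?thesis
  proof (unfold_locales)
    show "prod (a + b) v = prod a v + prod b v" for a b v
      by (rule lam_subst_eqI[OF s]) (simp add: assms(3) lam_subst_add[OF s])
    show "prod a (v + w) = prod a v + prod a w" for a v w
      by (rule lam_subst_eqI[OF s]) (simp add: assms(4) lam_subst_add[OF s])
    show "prod (r [:k:] a) v = map_poly (s [:k:]) (prod a v)" for k a v
      by (rule lam_subst_eqI[OF s]) (simp add: l m)
    show "prod a (s [:k:] v) = map_poly (s [:k:]) (prod a v)" for k a v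
      by (rule lam_subst_eqI[OF s]) (simp add: assms(6) m)
    show "lam_subst s (prod (r [:0, 1:] a) v) [:x:] = s [:- x:] (lam_subst s (prod a v) [:x:])" for a v x
      by (simp add: l)
    show "lam_subst s (prod a (s [:0, 1:] v)) [:x:] = s [:x, 1:] (lam_subst s (prod a v) [:x:])" for a v x
      by (simp add: assms(6) pcompose_pCons)
  qed
qed

section \<open>Coordinates and rules for evaluated actions\<close>

lemma free_basis_single:
  assumes "module s" "free_basis s {v}"
  shows "\<exists>p. w = s p v" and "s p v = s q v \<Longrightarrow> p = q"
proof -
  interpret module s by fact
  have "w \<in> span {v}" using assms(2) by (simp add: free_basis_def)
  then show "\<exists>p. w = s p v" unfolding span_singleton by auto
  assume "s p v = s q v"
  then have "s (p - q) v = 0" by (simp add: scale_left_diff_distrib)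
  moreover have "\<not> dependent {v}" using assms(2) by (simp add: free_basis_def)
  moreover have "dependent {v}" if "s (p - q) v = 0" "p \<noteq> q"
    unfolding dependent_explicit by (intro exI[of _ "{v}"] exI[of _ "\<lambda>_. p - q"]) (use that in simp)
  ultimately show "p = q" by blast
qed

lemma free_basis_pair:
  assumes "module s" "free_basis s {a, b}" "a \<noteq> b"
  shows "\<exists>p q. w = s p a + s q b" and "s p a + s q b = s p' a + s q' b \<Longrightarrow> p = p' \<and> q = q'"
proof -
  interpret module s by fact
  have "w \<in> span {a, b}" using assms(2) by (simp add: free_basis_def)
  then show "\<exists>p q. w = s p a + s q b"
  proof -
    have "w \<in> range (\<lambda>u. \<Sum>y\<in>{a, b}. s (u y) y)" using \<open>w \<in> span {a, b}\<close> by (simp add: span_finite)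
    then show ?thesis using assms(3) by auto
  qed
  assume "s p a + s q b = s p' a + s q' b"
  then have e: "s (p - p') a + s (q - q') b = 0" by (simp add: scale_left_diff_distrib algebra_simps)
  have nd: "\<not> dependent {a, b}" using assms(2) by (simp add: free_basis_def)
  let ?u = "\<lambda>w. if w = a then p - p' else q - q'"
  have "(\<Sum>w\<in>{a, b}. s (?u w) w) = 0" using e assms(3) by simp
  moreover have "dependent {a, b}" if "(\<Sum>w\<in>{a, b}. s (?u w) w) = 0" "\<exists>w\<in>{a, b}. ?u w \<noteq> 0"
    unfolding dependent_explicit by (intro exI[of _ "{a, b}"] exI[of _ ?u] conjI) (use that in simp_all)
  ultimately have "\<forall>w\<in>{a, b}. ?u w = 0" using nd by blast
  then show "p = p' \<and> q = q'" using assms(3) by (auto split: if_splits)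
qed

lemma bracket_at_rules:
  assumes "lie_conformal_algebra R"
  shows "bracket_at R x (a + a') b = bracket_at R x a b + bracket_at R x a' b"
    and "bracket_at R x a (b + b') = bracket_at R x a b + bracket_at R x a b'"
    and "bracket_at R x (smul R p a) b = smul R [:poly p (- x):] (bracket_at R x a b)"
    and "bracket_at R x a (smul R p b) = smul R (pcompose p [:x, 1:]) (bracket_at R x a b)"
proof -
  interpret sesquilinear "smul R" "smul R" "bracket R"
    using assms by (simp add: lie_conformal_algebra_def)
  show "bracket_at R x (a + a') b = bracket_at R x a b + bracket_at R x a' b"
    "bracket_at R x a (b + b') = bracket_at R x a b + bracket_at R x a b'"
    "bracket_at R x (smul R p a) b = smul R [:poly p (- x):] (bracket_at R x a b)"
    "bracket_at R x a (smul R p b) = smul R (pcompose p [:x, 1:]) (bracket_at R x a b)"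
    unfolding bracket_at_def lev_def[symmetric] by (rule lev_add lev_scale_left lev_scale_right)+
qed

lemma action_at_rules:
  assumes "sesquilinear (smul R) (smul M) (action M)"
  shows "action_at M x (a + a') v = action_at M x a v + action_at M x a' v"
    and "action_at M x a (v + w) = action_at M x a v + action_at M x a w"
    and "action_at M x (smul R p a) v = smul M [:poly p (- x):] (action_at M x a v)"
    and "action_at M x a (smul M p v) = smul M (pcompose p [:x, 1:]) (action_at M x a v)"
proof -
  interpret sesquilinear "smul R" "smul M" "action M" by fact
  show "action_at M x (a + a') v = action_at M x a v + action_at M x a' v"
    "action_at M x a (v + w) = action_at M x a v + action_at M x a w"
    "action_at M x (smul R p a) v = smul M [:poly p (- x):] (action_at M x a v)"
    "action_at M x a (smul M p v) = smul M (pcompose p [:x, 1:]) (action_at M x a v)"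
    unfolding action_at_def lev_def[symmetric] by (rule lev_add lev_scale_left lev_scale_right)+
qed

lemma conformal_moduleD:
  assumes "conformal_module R M"
  shows "lie_conformal_algebra R" "sesquilinear (smul R) (smul M) (action M)" "module (smul R)" "module (smul M)"
    "action_at M x a (action_at M y b v) =
      action_at M (x + y) (bracket_at R x a b) v + action_at M y b (action_at M x a v)"
proof -
  show 1: "lie_conformal_algebra R" "sesquilinear (smul R) (smul M) (action M)"
    "action_at M x a (action_at M y b v) =
      action_at M (x + y) (bracket_at R x a b) v + action_at M y b (action_at M x a v)"
    using assms unfolding conformal_module_def conformal_module_axioms_def by blast+
  show "module (smul R)" "module (smul M)" using 1(2) by (simp_all add: sesquilinear_def)
qed

lemma conf_homD:
  assumes "conf_hom M N h"
  shows "h 0 = 0" "h (x + y) = h x + h y" "h (x - y) = h x - h y" "h (smul M p x) = smul N p (h x)"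
    and "action_at N z a (h x) = h (action_at M z a x)"
proof -
  have mh: "module_hom (smul M) (smul N) h" using assms by (simp add: conf_hom_def)
  interpret module_hom "smul M" "smul N" h by fact
  show "h 0 = 0" "h (x + y) = h x + h y" "h (x - y) = h x - h y" "h (smul M p x) = smul N p (h x)"
    by (rule zero add diff scale)+
  have "action N a (h x) = map_poly h (action M a x)" using assms by (simp add: conf_hom_def)
  then show "action_at N z a (h x) = h (action_at M z a x)"
    using lam_subst_map[of "smul N" h "smul M" "action M a x" "[:z:]"] m2.module_axioms
    by (simp add: action_at_def zero add scale)
qed

lemma conf_homI:
  assumes M: "module (smul M)" and N: "module (smul N)"
    and add: "\<And>x y. h (x + y) = h x + h y" and scale: "\<And>p x. h (smul M p x) = smul N p (h x)"
    and act: "\<And>z a x. action_at N z a (h x) = h (action_at M z a x)"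
  shows "conf_hom M N h"
  unfolding conf_hom_def
proof (intro conjI allI)
  show "module_hom (smul M) (smul N) h"
    using M N add scale by (simp add: module_hom_def module_hom_axioms_def)
  have h0: "h 0 = 0" using add[of 0 0] by simp
  fix a x
  show "action N a (h x) = map_poly h (action M a x)"
  proof (rule lam_subst_eqI[OF N])
    fix z
    show "lam_subst (smul N) (action N a (h x)) [:z:] = lam_subst (smul N) (map_poly h (action M a x)) [:z:]"
      using act[of z a x] lam_subst_map[of "smul N" h "smul M" "action M a x" "[:z:]"] N h0 add scale
      by (simp add: action_at_def)
  qed
qed

section \<open>Lifts of the generator and their pairs (f, g)\<close>

locale rank_two_pair =
  fixes R :: "('r::ab_group_add) lie_conf" and A B :: 'r
    and a c d \<alpha> \<beta> \<alpha>' \<beta>' :: complex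
    and V :: "('r, 'v::ab_group_add) conf_mod" and v :: 'v
    and V' :: "('r, 'w::ab_group_add) conf_mod" and v' :: 'w
  assumes R: "rank_two_type_II R A B a c d"
    and V: "rank_one_module R A B V v \<alpha> \<beta>"
    and V': "rank_one_module R A B V' v' \<alpha>' \<beta>'"
begin

lemma modules: "module (smul R)" "module (smul V)" "module (smul V')"
  using V V' conformal_moduleD(3,4) by (auto simp: rank_one_module_def)

lemma lca: "lie_conformal_algebra R"
  using R by (simp add: rank_two_type_II_def)

lemmas br = bracket_at_rules[OF lca]

lemma ex_R: "\<exists>p q. r = smul R p A + smul R q B"
  and inj_R: "smul R p A + smul R q B = smul R p' A + smul R q' B \<Longrightarrow> p = p' \<and> q = q'"
  using free_basis_pair[OF modules(1)] R by (auto simp: rank_two_type_II_def)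

lemma ex_V: "\<exists>p. u = smul V p v" and inj_V: "smul V p v = smul V q v \<Longrightarrow> p = q"
  using free_basis_single[OF modules(2)] V by (auto simp: rank_one_module_def)

lemma ex_V': "\<exists>p. w = smul V' p v'" and inj_V': "smul V' p v' = smul V' q v' \<Longrightarrow> p = q"
  using free_basis_single[OF modules(3)] V' by (auto simp: rank_one_module_def)

lemma act_V: "action_at V x A v = smul V [:\<beta> + \<alpha> * x, 1:] v" "action_at V x B v = 0"
proof -
  have "poly (vx + cst \<alpha> * vl + cst \<beta>) [:x:] = [:\<beta> + \<alpha> * x, 1:]" by simp
  then show "action_at V x A v = smul V [:\<beta> + \<alpha> * x, 1:] v"
    using V by (simp add: rank_one_module_def action_at_def lam_subst_bact[OF modules(2)])
  show "action_at V x B v = 0"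
    using V by (simp add: rank_one_module_def action_at_def lam_subst_0[OF modules(2)])
qed

lemma act_V': "action_at V' x A v' = smul V' [:\<beta>' + \<alpha>' * x, 1:] v'" "action_at V' x B v' = 0"
proof -
  have "poly (vx + cst \<alpha>' * vl + cst \<beta>') [:x:] = [:\<beta>' + \<alpha>' * x, 1:]" by simp
  then show "action_at V' x A v' = smul V' [:\<beta>' + \<alpha>' * x, 1:] v'"
    using V' by (simp add: rank_one_module_def action_at_def lam_subst_bact[OF modules(3)])
  show "action_at V' x B v' = 0"
    using V' by (simp add: rank_one_module_def action_at_def lam_subst_0[OF modules(3)])
qed

text \<open>The third bracket comes from skew-symmetry: under \<lambda> \<mapsto> - \<lambda> -
  \<partial>, the negative of \<partial> + a \<lambda> becomes a \<lambda> + (a - 1)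
  \<partial>.\<close>

lemma bracket_gen:
  "bracket_at R x A A = smul R [:2 * x, 1:] A + smul R (poly (Q_poly a c d) [:x:]) B"
  "bracket_at R x A B = smul R [:a * x, 1:] B"
  "bracket_at R x B A = smul R [:a * x, a - 1:] B"
  "bracket_at R x B B = 0"
proof -
  have e: "poly (vx + 2 * vl) [:x:] = [:2 * x, 1:]" "poly (vx + cst a * vl) [:x:] = [:a * x, 1:]"
    "- poly (vx + cst a * vl) [:- x, - 1:] = [:a * x, a - 1:]"
    by (simp_all add: numeral_poly)
  show "bracket_at R x A A = smul R [:2 * x, 1:] A + smul R (poly (Q_poly a c d) [:x:]) B"
    "bracket_at R x A B = smul R [:a * x, 1:] B" "bracket_at R x B B = 0"
    using R by (simp_all only: rank_two_type_II_def bracket_at_def lam_subst_bact[OF modules(1)]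
      lam_subst_add[OF modules(1)] lam_subst_0[OF modules(1)] e)
  have "bracket_at R x B A = - lam_subst (smul R) (bracket R A B) [:- x, - 1:]"
    using lca by (simp add: lie_conformal_algebra_def)
  also have "\<dots> = - smul R (poly (vx + cst a * vl) [:- x, - 1:]) B"
    using R by (simp only: rank_two_type_II_def lam_subst_bact[OF modules(1)])
  also have "\<dots> = smul R (- poly (vx + cst a * vl) [:- x, - 1:]) B"
    by (simp only: module.scale_minus_left[OF modules(1)])
  finally show "bracket_at R x B A = smul R [:a * x, a - 1:] B" unfolding e .
qed

text \<open>The middle module is arbitrary here, so one notion serves a given extension, a twisted
  sum and the direct sum; comparing extensions becomes comparing pairs.\<close>

definition lifted ::
  "('r, 'e::ab_group_add) conf_mod \<Rightarrow> ('v \<Rightarrow> 'e) \<Rightarrow> ('e \<Rightarrow> 'w) \<Rightarrow> 'e \<Rightarrow> bipoly \<Rightarrow> bipoly \<Rightarrow> bool"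
  where "lifted E \<iota> \<pi> e f g \<longleftrightarrow> \<pi> e = v' \<and>
    (\<forall>x. action_at E x A e = smul E [:\<beta>' + \<alpha>' * x, 1:] e + \<iota> (smul V (poly f [:x:]) v)) \<and>
    (\<forall>x. action_at E x B e = \<iota> (smul V (poly g [:x:]) v))"

text \<open>These are the module axioms for (A, A) and (A, B) on a lift. The axiom for (B, A) is the
  second one with x and y exchanged, and for (B, B) both sides are zero since B annihilates the
  submodule.\<close>

definition cocb :: "bipoly \<Rightarrow> bipoly \<Rightarrow> bool"
  where "cocb f g \<longleftrightarrow>
    (\<forall>z x y. (z + x + \<beta>' + \<alpha>' * y) * ev f z x + (z + \<beta> + \<alpha> * x) * ev f (z + x) y
      - (z + y + \<beta>' + \<alpha>' * x) * ev f z y - (z + \<beta> + \<alpha> * y) * ev f (z + y) x - (x - y) * ev f z (x + y)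
      = ev (Q_poly a c d) (- x - y) x * ev g z (x + y)) \<and>
    (\<forall>z x y. (z + \<beta> + \<alpha> * x) * ev g (z + x) y - (z + y + \<beta>' + \<alpha>' * x) * ev g z y
      = ((a - 1) * x - y) * ev g z (x + y))"

definition is_cobb :: "complex poly \<Rightarrow> bipoly \<Rightarrow> bool"
  where "is_cobb \<phi> f \<longleftrightarrow> (\<forall>z x. ev f z x = (z + \<beta> + \<alpha> * x) * poly \<phi> (z + x) - (z + \<beta>' + \<alpha>' * x) * poly \<phi> z)"

context
  fixes E :: "('r, 'e::ab_group_add) conf_mod" and \<iota> \<pi> e
  assumes ext: "extension R V E V' \<iota> \<pi>" and e: "\<pi> e = v'"
begin

lemma cmE: "conformal_module R E"
  using ext by (simp add: extension_def)

lemma modE: "module (smul E)"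
  using conformal_moduleD(4)[OF cmE] .

lemmas act = action_at_rules[OF conformal_moduleD(2)[OF cmE]]

lemma hom_\<iota>: "conf_hom V E \<iota>" and hom_\<pi>: "conf_hom E V' \<pi>"
  and inj_\<iota>: "inj \<iota>" and exact: "range \<iota> = {x. \<pi> x = 0}"
  using ext by (simp_all add: extension_def)

text \<open>Coordinates on the middle module: since the quotient is free on v', the choice of a lift
  \<open>e\<close> splits the sequence over the polynomials in the derivation.\<close>

definition N :: "complex poly \<Rightarrow> complex poly \<Rightarrow> 'e"
  where "N p q = smul E p e + \<iota> (smul V q v)"

lemma \<pi>_\<iota>: "\<pi> (\<iota> u) = 0"
  using exact by blast

lemma \<pi>_N: "\<pi> (N p q) = smul V' p v'"
  by (simp add: N_def conf_homD[OF hom_\<pi>] \<pi>_\<iota> e)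

lemma N_inj: "N p q = N p' q' \<Longrightarrow> p = p' \<and> q = q'"
proof
  assume *: "N p q = N p' q'"
  then show p: "p = p'" using \<pi>_N inj_V' by metis
  from * have "\<iota> (smul V q v) = \<iota> (smul V q' v)" unfolding N_def p by simp
  then show "q = q'" using inj_\<iota> inj_V by (metis injD)
qed

lemma N_ex:
  assumes "\<pi> y = smul V' p v'" obtains q where "y = N p q"
proof -
  have "\<pi> (y - smul E p e) = 0" using assms e by (simp add: conf_homD[OF hom_\<pi>])
  then obtain u where "y - smul E p e = \<iota> u" using exact by blast
  moreover obtain q where "u = smul V q v" using ex_V by blast
  ultimately show ?thesis using that[of q] by (simp add: N_def algebra_simps)
qed

lemma N_ex2: obtains p q where "y = N p q"
  using ex_V'[of "\<pi> y"] N_ex by metis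

lemma N_add: "N p q + N p' q' = N (p + p') (q + q')"
  by (simp add: N_def conf_homD[OF hom_\<iota>] module.scale_left_distrib[OF modE]
    module.scale_left_distrib[OF modules(2)] algebra_simps)

lemma N_smul: "smul E r (N p q) = N (r * p) (r * q)"
  by (simp add: N_def module.scale_right_distrib[OF modE] module.scale_scale[OF modE]
    conf_homD(4)[OF hom_\<iota>, symmetric] module.scale_scale[OF modules(2)])

lemma N_e: "N 1 0 = e" "N 0 q = \<iota> (smul V q v)" "N 0 0 = 0"
  by (simp_all add: N_def module.scale_one[OF modE] module.scale_zero_left[OF modE]
    module.scale_zero_left[OF modules(2)] conf_homD[OF hom_\<iota>])

lemma act_\<iota>:
  "action_at E x A (\<iota> (smul V q v)) = N 0 (pcompose q [:x, 1:] * [:\<beta> + \<alpha> * x, 1:])"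
  "action_at E x B (\<iota> (smul V q v)) = 0"
proof -
  have V: "sesquilinear (smul R) (smul V) (action V)"
    using V conformal_moduleD(2) by (auto simp: rank_one_module_def)
  show "action_at E x A (\<iota> (smul V q v)) = N 0 (pcompose q [:x, 1:] * [:\<beta> + \<alpha> * x, 1:])"
    "action_at E x B (\<iota> (smul V q v)) = 0"
    by (simp_all only: conf_homD(5)[OF hom_\<iota>] action_at_rules(4)[OF V] act_V N_e
      module.scale_scale[OF modules(2)] module.scale_zero_right[OF modules(2)] conf_homD(1)[OF hom_\<iota>])
qed

lemma lifted_exists: "\<exists>f g. lifted E \<iota> \<pi> e f g"
proof -
  have *: "\<exists>f. \<forall>x. action_at E x b e = smul E (poly F [:x:]) e + \<iota> (smul V (poly f [:x:]) v)"
    if F: "action V' b v' = bact (smul V') F v'" for b F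
  proof -
    \<comment> \<open>Reads off the coordinate in the submodule. Applying it to the coefficients of
      the action yields \<open>f\<close> as a polynomial, hence with finitely many terms.\<close>
    define \<kappa> where "\<kappa> y = (THE q. \<exists>p. y = N p q)" for y
    have \<kappa>: "\<kappa> (N p q) = q" for p q
      unfolding \<kappa>_def by (rule the_equality) (use N_inj in blast)+
    define f where "f = map_poly \<kappa> (action E b e)"
    have "action E b e = bact (smul E) F e + map_poly \<iota> (bact (smul V) f v)"
    proof (rule poly_eqI)
      fix i
      have "map_poly \<pi> (action E b e) = bact (smul V') F v'"
        using hom_\<pi> F e unfolding conf_hom_def by metis
      from arg_cong[OF this, of "\<lambda>P. coeff P i"]
      have "\<pi> (coeff (action E b e) i) = smul V' (coeff F i) v'"
        by (simp add: coeff_map_poly conf_homD[OF hom_\<pi>] bact_def module.scale_zero_left[OF modules(3)])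
      then obtain q where q: "coeff (action E b e) i = N (coeff F i) q" using N_ex by blast
      have "\<kappa> 0 = 0" using \<kappa>[of 0 0] unfolding N_e(3) .
      then have "coeff f i = q" by (simp add: f_def coeff_map_poly q \<kappa>)
      then show "coeff (action E b e) i = coeff (bact (smul E) F e + map_poly \<iota> (bact (smul V) f v)) i"
        by (simp add: q N_def bact_def coeff_map_poly conf_homD[OF hom_\<iota>] module.scale_zero_left[OF modE]
          module.scale_zero_left[OF modules(2)])
    qed
    then have "action_at E x b e = smul E (poly F [:x:]) e + \<iota> (smul V (poly f [:x:]) v)" for x
      using lam_subst_map[of "smul E" \<iota> "smul V" "bact (smul V) f v" "[:x:]"] modE
      by (simp add: action_at_def lam_subst_add lam_subst_bact conf_homD[OF hom_\<iota>] modules(2))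
    then show ?thesis by blast
  qed
  have "action V' A v' = bact (smul V') (vx + cst \<alpha>' * vl + cst \<beta>') v'" "action V' B v' = bact (smul V') 0 v'"
    using V' by (simp_all add: rank_one_module_def bact_def)
  from this[THEN *] obtain f g where
    f: "\<And>x. action_at E x A e = smul E (poly (vx + cst \<alpha>' * vl + cst \<beta>') [:x:]) e + \<iota> (smul V (poly f [:x:]) v)" and
    g: "\<And>x. action_at E x B e = smul E (poly 0 [:x:]) e + \<iota> (smul V (poly g [:x:]) v)"
    by blast
  have "lifted E \<iota> \<pi> e f g"
    unfolding lifted_def by (simp add: e f g module.scale_zero_left[OF modE])
  then show ?thesis by blast
qed

context
  fixes f g
  assumes lf: "lifted E \<iota> \<pi> e f g"
begin

lemma act_N:
  "action_at E x A (N p q) = N (pcompose p [:x, 1:] * [:\<beta>' + \<alpha>' * x, 1:])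
    (pcompose p [:x, 1:] * poly f [:x:] + pcompose q [:x, 1:] * [:\<beta> + \<alpha> * x, 1:])"
  "action_at E x B (N p q) = N 0 (pcompose p [:x, 1:] * poly g [:x:])"
proof -
  have "action_at E x A e = N [:\<beta>' + \<alpha>' * x, 1:] (poly f [:x:])"
    "action_at E x B e = N 0 (poly g [:x:])"
    using lf by (simp_all add: lifted_def N_def module.scale_zero_left[OF modE])
  then show "action_at E x A (N p q) = N (pcompose p [:x, 1:] * [:\<beta>' + \<alpha>' * x, 1:])
      (pcompose p [:x, 1:] * poly f [:x:] + pcompose q [:x, 1:] * [:\<beta> + \<alpha> * x, 1:])"
    "action_at E x B (N p q) = N 0 (pcompose p [:x, 1:] * poly g [:x:])"
    unfolding N_def[of p q] act(2) act(4) act_\<iota> by (simp_all only: N_smul N_add mult_zero_right add_0_right)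
qed

lemma lifted_cocb: "cocb f g"
proof -
  have gen: "action_at E x a' (action_at E y b (N 1 0)) =
      action_at E (x + y) (bracket_at R x a' b) (N 1 0) + action_at E y b (action_at E x a' (N 1 0))" for x y a' b
    by (rule conformal_moduleD(5)[OF cmE])
  note s = act_N act(1,3) N_add N_smul bracket_gen
  show ?thesis
    unfolding cocb_def
  proof (intro conjI allI)
    fix z x y :: complex
    from arg_cong[OF conjunct2[OF N_inj[OF gen[of x A y A, unfolded s]]], of "\<lambda>p. poly p z"]
    show "(z + x + \<beta>' + \<alpha>' * y) * ev f z x + (z + \<beta> + \<alpha> * x) * ev f (z + x) y
      - (z + y + \<beta>' + \<alpha>' * x) * ev f z y - (z + \<beta> + \<alpha> * y) * ev f (z + y) x - (x - y) * ev f z (x + y)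
      = ev (Q_poly a c d) (- x - y) x * ev g z (x + y)"
      by (simp add: poly_pcompose ev_def algebra_simps pcompose_1)
    from arg_cong[OF conjunct2[OF N_inj[OF gen[of x A y B, unfolded s]]], of "\<lambda>p. poly p z"]
    show "(z + \<beta> + \<alpha> * x) * ev g (z + x) y - (z + y + \<beta>' + \<alpha>' * x) * ev g z y
      = ((a - 1) * x - y) * ev g z (x + y)"
      by (simp add: poly_pcompose ev_def algebra_simps pcompose_1)
  qed
qed

lemma lifted_change:
  assumes "is_cobb \<phi> (f' - f)"
  shows "lifted E \<iota> \<pi> (e + \<iota> (smul V \<phi> v)) f' g"
proof -
  have e': "e + \<iota> (smul V \<phi> v) = N 1 \<phi>" by (simp add: N_def module.scale_one[OF modE])
  have f': "poly f' [:x:] = poly f [:x:] + (pcompose \<phi> [:x, 1:] * [:\<beta> + \<alpha> * x, 1:] - [:\<beta>' + \<alpha>' * x, 1:] * \<phi>)" for x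
  proof (rule poly_eqI_consts[of "\<lambda>z. z"])
    fix z
    have "ev f' z x = ev f z x + ((z + \<beta> + \<alpha> * x) * poly \<phi> (z + x) - (z + \<beta>' + \<alpha>' * x) * poly \<phi> z)"
      using assms unfolding is_cobb_def ev_simps by (metis add.commute diff_add_cancel)
    then show "poly (poly f' [:x:]) z = poly (poly f [:x:] +
        (pcompose \<phi> [:x, 1:] * [:\<beta> + \<alpha> * x, 1:] - [:\<beta>' + \<alpha>' * x, 1:] * \<phi>)) z"
      by (simp add: ev_def poly_pcompose algebra_simps)
  qed simp
  have cancel: "u + (y + (w - u)) = y + w" for u y w :: "complex poly"
    by (simp add: algebra_simps)
  show ?thesis
    unfolding lifted_def e'
    by (simp only: \<pi>_N module.scale_one[OF modules(3)] act_N N_smul N_e(2)[symmetric] pcompose_1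
      mult_1_left mult_1_right N_add add_0_right add_0_left f' cancel simp_thms)
qed

text \<open>Two lifts differ by an element of the submodule, which B annihilates. Hence
  \<open>g\<close> is an invariant of the extension, and \<open>f\<close> is one modulo
  coboundaries.\<close>

lemma lifted_unique:
  assumes "lifted E \<iota> \<pi> e' f' g'"
  shows "g' = g" and "\<exists>\<phi>. is_cobb \<phi> (f' - f)"
proof -
  have "\<pi> e' = smul V' 1 v'" using assms by (simp add: lifted_def module.scale_one[OF modules(3)])
  then obtain \<phi> where e': "e' = N 1 \<phi>" using N_ex by blast
  have "N [:\<beta>' + \<alpha>' * x, 1:] (poly f [:x:] + pcompose \<phi> [:x, 1:] * [:\<beta> + \<alpha> * x, 1:]) =
      N [:\<beta>' + \<alpha>' * x, 1:] ([:\<beta>' + \<alpha>' * x, 1:] * \<phi> + poly f' [:x:])"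
    "N 0 (poly g [:x:]) = N 0 (poly g' [:x:])" for x
    using assms unfolding lifted_def e'
    by (simp_all only: act_N N_smul N_e(2)[symmetric] pcompose_1 mult_1_left mult_1_right N_add add_0_right)
  note * = this[THEN N_inj, THEN conjunct2]
  show "g' = g"
    by (rule poly_eqI_consts[of "\<lambda>x. [:x:]"]) (simp_all add: *(2) inj_def)
  have "ev (f' - f) z x = (z + \<beta> + \<alpha> * x) * poly \<phi> (z + x) - (z + \<beta>' + \<alpha>' * x) * poly \<phi> z" for z x
    using arg_cong[OF *(1)[of x], of "\<lambda>p. poly p z"] by (simp add: ev_def poly_pcompose algebra_simps)
  then show "\<exists>\<phi>. is_cobb \<phi> (f' - f)" unfolding is_cobb_def by blast
qed

end

lemma lifted_hom:
  assumes "conf_hom E E' h" "\<And>u. h (\<iota> u) = \<iota>' u" "\<And>y. \<pi>' (h y) = \<pi> y" "lifted E \<iota> \<pi> e f g"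
  shows "lifted E' \<iota>' \<pi>' (h e) f g"
  using assms(4) by (simp add: lifted_def conf_homD[OF assms(1)] assms(2,3))

end

text \<open>In the coordinates given by a lift the action depends on the pair alone, so the map that
  preserves coordinates is an equivalence.\<close>

lemma ext_equivI:
  assumes E: "extension R V E V' \<iota> \<pi>" and E': "extension R V E' V' \<iota>' \<pi>'"
    and l: "lifted E \<iota> \<pi> e f g" and l': "lifted E' \<iota>' \<pi>' e' f g"
  shows "ext_equiv E \<iota> \<pi> E' \<iota>' \<pi>'"
proof -
  have e: "\<pi> e = v'" and e': "\<pi>' e' = v'" using l l' by (simp_all add: lifted_def)
  note N = N_inj[OF E e] N_ex2[OF E e] N_add[OF E e] N_smul[OF E e] N_e[OF E e] act_N[OF E e l] \<pi>_N[OF E e]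
  note N' = N_add[OF E' e'] N_smul[OF E' e'] N_e[OF E' e'] act_N[OF E' e' l'] \<pi>_N[OF E' e']
  define h where "h y = (THE y'. \<exists>p q. y = N E \<iota> e p q \<and> y' = N E' \<iota>' e' p q)" for y
  have h: "h (N E \<iota> e p q) = N E' \<iota>' e' p q" for p q
    unfolding h_def by (rule the_equality) (use N(1) in blast)+
  have add: "h (x + y) = h x + h y" for x y
    by (rule N(2)[of x], rule N(2)[of y]) (simp only: N(3) N'(1) h)
  have scale: "h (smul E p x) = smul E' p (h x)" for p x
    by (rule N(2)[of x]) (simp only: N(4) N'(2) h)
  have gen: "action_at E' z A (h x) = h (action_at E z A x)" "action_at E' z B (h x) = h (action_at E z B x)" for z x
    by (rule N(2)[of x]; simp only: N(8,9) N'(6,7) h)+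
  have act: "action_at E' z a (h x) = h (action_at E z a x)" for z a x
  proof -
    obtain p q where a: "a = smul R p A + smul R q B" using ex_R by blast
    show ?thesis
      unfolding a
      by (simp only: act[OF E e] act[OF E' e'] add scale gen)
  qed
  have "conf_hom E E' h" using modE[OF E e] modE[OF E' e'] add scale act by (rule conf_homI)
  moreover have "h (\<iota> u) = \<iota>' u" for u
    using ex_V[of u] h[of 0] unfolding N(6) N'(4) by metis
  moreover have "\<pi>' (h x) = \<pi> x" for x
    by (rule N(2)[of x]) (simp only: N(10) N'(8) h)
  ultimately show ?thesis unfolding ext_equiv_def by blast
qed

end

section \<open>Constructing an extension from a pair (f, g)\<close>

text \<open>The triples that satisfy the bracket axiom are closed under sums and, by
  sesquilinearity, under polynomial scalars in each argument; so generators suffice.\<close>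

lemma conformal_moduleI:
  assumes R: "lie_conformal_algebra R" and M: "sesquilinear (smul R) (smul M) (action M)"
    and gen_R: "\<And>r. \<exists>p q. r = smul R p A + smul R q B"
    and gen_M: "\<And>w. \<exists>p q. w = smul M p u + smul M q u'"
    and gen: "\<And>x y a b w. a \<in> {A, B} \<Longrightarrow> b \<in> {A, B} \<Longrightarrow> w \<in> {u, u'} \<Longrightarrow>
      action_at M x a (action_at M y b w) =
      action_at M (x + y) (bracket_at R x a b) w + action_at M y b (action_at M x a w)"
  shows "conformal_module R M"
proof -
  define J where "J a b w \<longleftrightarrow> (\<forall>x y. action_at M x a (action_at M y b w) =
      action_at M (x + y) (bracket_at R x a b) w + action_at M y b (action_at M x a w))" for a b w
  interpret M: module "smul M" using M by (simp add: sesquilinear_def)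
  note r = action_at_rules[OF M] bracket_at_rules[OF R]
  have add: "J a b w \<Longrightarrow> J a' b w \<Longrightarrow> J (a + a') b w" "J a b w \<Longrightarrow> J a b' w \<Longrightarrow> J a (b + b') w"
    "J a b w \<Longrightarrow> J a b w' \<Longrightarrow> J a b (w + w')" for a a' b b' w w'
    by (simp_all add: J_def r ac_simps)
  have scale: "J (smul R p a) b w" "J a (smul R p b) w" "J a b (smul M p w)" if "J a b w" for a b p w
  proof -
    have 1: "pcompose [:k:] q = [:k:]" for k and q :: "complex poly" by simp
    show "J (smul R p a) b w"
      using that by (simp add: J_def r 1 M.scale_right_distrib del: pcompose_const)
    show "J a (smul R p b) w"
      using that by (simp add: J_def r 1 M.scale_right_distrib poly_pcompose algebra_simps del: pcompose_const)
    have 2: "pcompose (pcompose p [:y, 1:]) [:x, 1:] = pcompose p [:x + y, 1:]" for x y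
      by (simp add: pcompose_assoc[symmetric] pcompose_pCons add.commute)
    show "J a b (smul M p w)"
      using that by (simp add: J_def r 2 M.scale_right_distrib add.commute)
  qed
  have J0: "J a b w" if "a \<in> {A, B}" "b \<in> {A, B}" "w \<in> {u, u'}" for a b w
    using gen[OF that] unfolding J_def by blast
  have J1: "J a b w" if "a \<in> {A, B}" "b \<in> {A, B}" for a b w
  proof -
    obtain p q where w: "w = smul M p u + smul M q u'" using gen_M by blast
    show ?thesis unfolding w by (intro add(3) scale(3) J0 that insertI1 insertI2)
  qed
  have J2: "J a b w" if "a \<in> {A, B}" for a b w
  proof -
    obtain p q where b: "b = smul R p A + smul R q B" using gen_R by blast
    show ?thesis unfolding b by (intro add(2) scale(2) J1 that insertI1 insertI2)
  qed
  have "J a b w" for a b w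
  proof -
    obtain p q where a: "a = smul R p A + smul R q B" using gen_R by blast
    show ?thesis unfolding a by (intro add(1) scale(1) J2 insertI1 insertI2)
  qed
  then show ?thesis
    unfolding conformal_module_def conformal_module_axioms_def J_def using R M by blast
qed

definition csubst :: "complex poly \<Rightarrow> bipoly \<Rightarrow> bipoly"
  where "csubst p P = poly (map_poly cst p) P"

lemma ev_csubst: "ev (csubst p P) z x = poly p (ev P z x)"
  by (induction p) (simp_all add: csubst_def ev_simps map_poly_pCons)

context rank_two_pair
begin

definition crd :: "'w \<Rightarrow> complex poly"
  where "crd w = (THE p. w = smul V' p v')"

definition crdA :: "'r \<Rightarrow> complex poly"
  where "crdA r = (THE p. \<exists>q. r = smul R p A + smul R q B)"

definition crdB :: "'r \<Rightarrow> complex poly"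
  where "crdB r = (THE q. \<exists>p. r = smul R p A + smul R q B)"

lemma crd_smul: "crd (smul V' p v') = p"
  unfolding crd_def by (rule the_equality) (use inj_V' in blast)+

lemma crdA_smul: "crdA (smul R p A + smul R q B) = p"
  unfolding crdA_def by (rule the_equality) (use inj_R in blast)+

lemma crdB_smul: "crdB (smul R p A + smul R q B) = q"
  unfolding crdB_def by (rule the_equality) (use inj_R in blast)+

lemma crd_hom: "crd (w + w') = crd w + crd w'" "crd (smul V' p w) = p * crd w" "crd v' = 1"
proof -
  interpret module "smul V'" by (rule modules(3))
  obtain q q' where w: "w = smul V' q v'" and w': "w' = smul V' q' v'" using ex_V' by metis
  show "crd (w + w') = crd w + crd w'" "crd (smul V' p w) = p * crd w"
    by (simp_all add: w w' crd_smul flip: scale_left_distrib)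
  show "crd v' = 1" using crd_smul[of 1] by simp
qed

lemma crdAB_hom:
  "crdA (r + r') = crdA r + crdA r'" "crdA (smul R p r) = p * crdA r" "crdA A = 1" "crdA B = 0"
  "crdB (r + r') = crdB r + crdB r'" "crdB (smul R p r) = p * crdB r" "crdB A = 0" "crdB B = 1"
proof -
  interpret module "smul R" by (rule modules(1))
  obtain q s q' s' where r: "r = smul R q A + smul R s B" and r': "r' = smul R q' A + smul R s' B"
    using ex_R by metis
  have 1: "r + r' = smul R (q + q') A + smul R (s + s') B"
    by (simp add: r r' scale_left_distrib)
  have 2: "smul R p r = smul R (p * q) A + smul R (p * s) B"
    by (simp add: r scale_right_distrib)
  show "crdA (r + r') = crdA r + crdA r'" "crdA (smul R p r) = p * crdA r"
    "crdB (r + r') = crdB r + crdB r'" "crdB (smul R p r) = p * crdB r"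
    unfolding 1 2 unfolding r r' crdA_smul crdB_smul by (rule refl)+
  show "crdA A = 1" "crdA B = 0" "crdB A = 0" "crdB B = 1"
    using crdA_smul[of 1 0] crdA_smul[of 0 1] crdB_smul[of 1 0] crdB_smul[of 0 1] by simp_all
qed

text \<open>
  The cocycle with values \<open>f\<close> and \<open>g\<close> on the generators, extended by sesquilinearity in terms of
  coordinates; \<open>gam\<close> is its value at \<open>\<lambda> = x\<close>.
\<close>

definition gam_poly :: "bipoly \<Rightarrow> bipoly \<Rightarrow> 'r \<Rightarrow> 'w \<Rightarrow> bipoly"
  where "gam_poly f g r w = csubst (crd w) (vx + vl) * (csubst (crdA r) (- vl) * f + csubst (crdB r) (- vl) * g)"

text \<open>The first component is zero because extensions of a free module split over the
  polynomials in the derivation; the twist can be placed entirely in the action.\<close>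

definition zc :: "bipoly \<Rightarrow> bipoly \<Rightarrow> (complex poly \<Rightarrow> 'w \<Rightarrow> 'v) \<times> ('r \<Rightarrow> 'w \<Rightarrow> 'v poly)"
  where "zc f g = (\<lambda>q w. 0, \<lambda>r w. bact (smul V) (gam_poly f g r w) v)"

definition gam :: "bipoly \<Rightarrow> bipoly \<Rightarrow> complex \<Rightarrow> 'r \<Rightarrow> 'w \<Rightarrow> complex poly"
  where "gam f g x r w = pcompose (crd w) [:x, 1:] *
    ([:poly (crdA r) (- x):] * poly f [:x:] + [:poly (crdB r) (- x):] * poly g [:x:])"

lemma poly_gam_poly: "poly (gam_poly f g r w) [:x:] = gam f g x r w"
proof (rule poly_eqI_consts[of "\<lambda>z. z"])
  fix z
  have "ev (gam_poly f g r w) z x = poly (gam f g x r w) z"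
    by (simp add: gam_poly_def gam_def ev_simps ev_pCons ev_csubst poly_pcompose ev_def[of f] ev_def[of g] add.commute)
  then show "poly (poly (gam_poly f g r w) [:x:]) z = poly (gam f g x r w) z" by (simp only: ev_def)
qed simp

lemma lam_subst_zc: "lam_subst (smul V) (snd (zc f g) r w) [:x:] = smul V (gam f g x r w) v"
  by (simp add: zc_def lam_subst_bact[OF modules(2)] poly_gam_poly)

lemma zc_add: "zc f g + zc f' g' = zc (f + f') (g + g')"
proof -
  have "snd (zc f g) r w + snd (zc f' g') r w = snd (zc (f + f') (g + g')) r w" for r w
    by (rule lam_subst_eqI[OF modules(2)])
      (simp add: lam_subst_add[OF modules(2)] lam_subst_zc gam_def distrib_left smult_add_right add_ac
        flip: module.scale_left_distrib[OF modules(2)])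
  then show ?thesis by (simp add: prod_eq_iff fun_eq_iff) (simp add: zc_def)
qed

lemma zc_0: "zc 0 0 = (\<lambda>q w. 0, \<lambda>r w. 0)"
  by (simp add: zc_def gam_poly_def bact_def)

lemma zc_scale: "cocycle_scale V k (zc f g) = zc (cst k * f) (cst k * g)"
proof -
  interpret module "smul V" by (rule modules(2))
  have "map_poly (smul V [:k:]) (snd (zc f g) r w) = snd (zc (cst k * f) (cst k * g)) r w" for r w
  proof (rule lam_subst_eqI[OF modules(2)])
    fix x
    have "lam_subst (smul V) (map_poly (smul V [:k:]) (snd (zc f g) r w)) [:x:] = smul V ([:k:] * gam f g x r w) v"
      using lam_subst_map[OF modules(2), of "smul V [:k:]" "smul V" "snd (zc f g) r w" "[:x:]"]
      by (simp add: lam_subst_zc scale_right_distrib mult.commute)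
    also have "[:k:] * gam f g x r w = gam (cst k * f) (cst k * g) x r w"
      by (simp add: gam_def algebra_simps smult_add_right)
    finally show "lam_subst (smul V) (map_poly (smul V [:k:]) (snd (zc f g) r w)) [:x:] =
      lam_subst (smul V) (snd (zc (cst k * f) (cst k * g)) r w) [:x:]"
      by (simp add: lam_subst_zc)
  qed
  then show ?thesis by (simp add: zc_def cocycle_scale_def)
qed

lemma zc_sum: "(\<Sum>i<n::nat. cocycle_scale V (k i) (zc (F i) (G i))) =
  zc (\<Sum>i<n. cst (k i) * F i) (\<Sum>i<n. cst (k i) * G i)"
proof (induction n)
  case 0
  then show ?case by (simp add: zc_0 zero_prod_def zero_fun_def)
next
  case (Suc n)
  then show ?case by (simp add: zc_add zc_scale)
qed

lemma smul_zc: "smul (twisted_sum V V' (zc f g)) q (u, w) = (smul V q u, smul V' q w)"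
  by (simp add: twisted_sum_def zc_def)

lemma module_zc: "module (smul (twisted_sum V V' (zc f g)))"
proof -
  interpret V: module "smul V" by (rule modules(2))
  interpret V': module "smul V'" by (rule modules(3))
  show ?thesis
    by standard (auto simp: smul_zc V.scale_right_distrib V.scale_left_distrib V'.scale_right_distrib
      V'.scale_left_distrib)
qed

lemma action_at_zc:
  "action_at (twisted_sum V V' (zc f g)) x r (u, w) =
    (action_at V x r u + smul V (gam f g x r w) v, action_at V' x r w)"
proof -
  let ?s = "smul (twisted_sum V V' (zc f g))"
  have 1: "lam_subst ?s (map_poly incl P) q = incl (lam_subst (smul V) P q)" for P q
    by (rule lam_subst_map[OF module_zc])
      (simp_all add: zero_prod_def smul_zc module.scale_zero_right[OF modules(3)])
  have 2: "lam_subst ?s (map_poly (Pair 0) P) q = (0, lam_subst (smul V') P q)" for P q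
    by (rule lam_subst_map[OF module_zc])
      (simp_all add: zero_prod_def smul_zc module.scale_zero_right[OF modules(2)])
  have 3: "action (twisted_sum V V' (zc f g)) r (u, w) =
      map_poly incl (action V r u + snd (zc f g) r w) + map_poly (Pair 0) (action V' r w)"
    by (simp add: twisted_sum_def case_prod_beta)
  show ?thesis
    unfolding action_at_def 3 lam_subst_add[OF module_zc] 1 2 lam_subst_add[OF modules(2)] lam_subst_zc
    by simp
qed

lemma action_zc_eqI:
  assumes "\<And>x. action_at (twisted_sum V V' (zc f g)) x r y = lam_subst (smul (twisted_sum V V' (zc f g))) P [:x:]"
  shows "action (twisted_sum V V' (zc f g)) r y = P"
  by (rule lam_subst_eqI[OF module_zc]) (use assms in \<open>simp add: action_at_def\<close>)

lemma conformal_modules: "conformal_module R V" "conformal_module R V'"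
  using V V' by (simp_all add: rank_one_module_def)

lemma sesquilinear_zc: "sesquilinear (smul R) (smul (twisted_sum V V' (zc f g))) (action (twisted_sum V V' (zc f g)))"
proof (rule sesquilinearI[OF modules(1) module_zc], unfold action_at_def[symmetric])
  interpret V: module "smul V" by (rule modules(2))
  note r = action_at_rules[OF conformal_moduleD(2)[OF conformal_modules(1)]]
    action_at_rules[OF conformal_moduleD(2)[OF conformal_modules(2)]]
  fix x r r' p and y y' :: "'v \<times> 'w"
  let ?T = "twisted_sum V V' (zc f g)"
  obtain u w u' w' where y: "y = (u, w)" "y' = (u', w')" by fastforce
  have g: "gam f g x (r + r') w = gam f g x r w + gam f g x r' w"
    "gam f g x r (w + w') = gam f g x r w + gam f g x r w'"
    "gam f g x (smul R p r) w = [:poly p (- x):] * gam f g x r w"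
    "gam f g x r (smul V' p w) = pcompose p [:x, 1:] * gam f g x r w"
    by (rule poly_eqI_consts[of "\<lambda>z. z"];
        simp add: gam_def crd_hom crdAB_hom poly_pcompose pcompose_add pcompose_mult algebra_simps)+
  show "action_at ?T x (r + r') y = action_at ?T x r y + action_at ?T x r' y"
    "action_at ?T x r (y + y') = action_at ?T x r y + action_at ?T x r y'"
    "action_at ?T x (smul R p r) y = smul ?T [:poly p (- x):] (action_at ?T x r y)"
    "action_at ?T x r (smul ?T p y) = smul ?T (pcompose p [:x, 1:]) (action_at ?T x r y)"
    unfolding y plus_prod_def fst_conv snd_conv smul_zc action_at_zc g r
      V.scale_left_distrib V.scale_right_distrib V.scale_scale
    by (simp_all only: ac_simps)
qed

lemma conformal_module_zc:
  assumes "cocb f g" shows "conformal_module R (twisted_sum V V' (zc f g))"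
proof (rule conformal_moduleI[OF lca sesquilinear_zc, where A = A and B = B and u = "(v, 0)" and u' = "(0, v')"])
  interpret V: module "smul V" by (rule modules(2))
  interpret V': module "smul V'" by (rule modules(3))
  let ?T = "twisted_sum V V' (zc f g)"
  fix r show "\<exists>p q. r = smul R p A + smul R q B" by (rule ex_R)
next
  interpret V: module "smul V" by (rule modules(2))
  interpret V': module "smul V'" by (rule modules(3))
  fix y :: "'v \<times> 'w"
  obtain u w p q where "y = (u, w)" "u = smul V p v" "w = smul V' q v'" using ex_V ex_V' by (metis prod.exhaust)
  then have "y = smul (twisted_sum V V' (zc f g)) p (v, 0) + smul (twisted_sum V V' (zc f g)) q (0, v')"
    by (simp add: smul_zc)
  then show "\<exists>p q. y = smul (twisted_sum V V' (zc f g)) p (v, 0) + smul (twisted_sum V V' (zc f g)) q (0, v')"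
    by blast
next
  interpret V: module "smul V" by (rule modules(2))
  interpret V': module "smul V'" by (rule modules(3))
  let ?T = "twisted_sum V V' (zc f g)"
  note rV = action_at_rules[OF conformal_moduleD(2)[OF conformal_modules(1)]]
  fix x y r s w
  assume rs: "r \<in> {A, B}" "s \<in> {A, B}" and w: "w \<in> {(v, 0), (0, v')}"
  have crd0: "crd 0 = 0" using crd_smul[of 0] by simp
  have a0: "action_at V' x r 0 = 0" for x r
    using action_at_rules(2)[OF conformal_moduleD(2)[OF conformal_modules(2)], of x r 0 0] by simp
  have a0V: "action_at V x r 0 = 0" for x r
    using rV(2)[of x r 0 0] by simp
  have g0: "gam f g x r 0 = 0" for x r by (simp add: gam_def crd0)
  show "action_at ?T x r (action_at ?T y s w) =
      action_at ?T (x + y) (bracket_at R x r s) w + action_at ?T y s (action_at ?T x r w)"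
  proof (cases "w = (v, 0)")
    case True
    then show ?thesis
      using conformal_moduleD(5)[OF conformal_modules(1), of x r y s v]
      by (simp add: action_at_zc a0 g0)
  next
    case False
    then have w: "w = (0, v')" using w by simp
    have g: "gam f g x A (smul V' p v') = pcompose p [:x, 1:] * poly f [:x:]"
      "gam f g x B (smul V' p v') = pcompose p [:x, 1:] * poly g [:x:]"
      "gam f g x (smul R q A + smul R q' B) v' = [:poly q (- x):] * poly f [:x:] + [:poly q' (- x):] * poly g [:x:]"
      for x p q q'
      by (simp_all add: gam_def crd_hom crdAB_hom crdA_smul crdB_smul pcompose_1)
    have aV: "action_at V x A (smul V q v) = smul V (pcompose q [:x, 1:] * [:\<beta> + \<alpha> * x, 1:]) v"
      "action_at V x B (smul V q v) = 0" for x q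
      by (simp_all add: rV act_V)
    have br: "bracket_at R x A A = smul R [:2 * x, 1:] A + smul R (poly (Q_poly a c d) [:x:]) B"
      "bracket_at R x A B = smul R 0 A + smul R [:a * x, 1:] B"
      "bracket_at R x B A = smul R 0 A + smul R [:a * x, a - 1:] B"
      "bracket_at R x B B = smul R 0 A + smul R 0 B" for x
      by (simp_all add: bracket_gen module.scale_zero_left[OF modules(1)])
    \<comment> \<open>\<open>L\<close> and \<open>K\<close> are coefficients of v in the terms of
      the bracket axiom. A Boolean stands for a generator, True for A and False for B, so that the
      one identity \<open>LK\<close> covers all four pairs.\<close>
    define L where "L r s x y = (case (r, s) of (True, True) \<Rightarrow>
        pcompose (poly f [:y:]) [:x, 1:] * [:\<beta> + \<alpha> * x, 1:] + pcompose [:\<beta>' + \<alpha>' * y, 1:] [:x, 1:] * poly f [:x:]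
      | (True, False) \<Rightarrow> pcompose (poly g [:y:]) [:x, 1:] * [:\<beta> + \<alpha> * x, 1:]
      | (False, True) \<Rightarrow> pcompose [:\<beta>' + \<alpha>' * y, 1:] [:x, 1:] * poly g [:x:]
      | _ \<Rightarrow> 0)" for r s x y
    have L: "fst (action_at ?T x (if r then A else B) (action_at ?T y (if s then A else B) (0, v'))) =
      smul V (L r s x y) v" for r s x y
      by (cases r; cases s) (simp_all add: action_at_zc a0V act_V' g(1,2)[of _ 1, simplified] g aV L_def
        g0 a0 V.scale_left_distrib pcompose_1)
    define K where "K r s x y = (case (r, s) of (True, True) \<Rightarrow>
        [:poly [:2 * x, 1:] (- (x + y)):] * poly f [:x + y:] +
        [:poly (poly (Q_poly a c d) [:x:]) (- (x + y)):] * poly g [:x + y:]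
      | (True, False) \<Rightarrow> [:poly [:a * x, 1:] (- (x + y)):] * poly g [:x + y:]
      | (False, True) \<Rightarrow> [:poly [:a * x, a - 1:] (- (x + y)):] * poly g [:x + y:]
      | _ \<Rightarrow> 0)" for r s x y
    have K: "fst (action_at ?T (x + y) (bracket_at R x (if r then A else B) (if s then A else B)) (0, v')) =
      smul V (K r s x y) v" for r s x y
      by (cases r; cases s; simp only: if_True if_False br action_at_zc fst_conv a0V g K_def prod.case bool.case)
        simp_all
    have LK: "L r s x y = K r s x y + L s r y x" for r s
    proof (rule poly_eqI_consts[of "\<lambda>z. z"])
      fix z
      have 1: "(z + x + \<beta>' + \<alpha>' * y) * ev f z x + (z + \<beta> + \<alpha> * x) * ev f (z + x) y
          - (z + y + \<beta>' + \<alpha>' * x) * ev f z y - (z + \<beta> + \<alpha> * y) * ev f (z + y) x - (x - y) * ev f z (x + y)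
          = ev (Q_poly a c d) (- x - y) x * ev g z (x + y)"
        "(z + \<beta> + \<alpha> * x) * ev g (z + x) y - (z + y + \<beta>' + \<alpha>' * x) * ev g z y
          = ((a - 1) * x - y) * ev g z (x + y)"
        "(z + \<beta> + \<alpha> * y) * ev g (z + y) x - (z + x + \<beta>' + \<alpha>' * y) * ev g z x
          = ((a - 1) * y - x) * ev g z (y + x)"
        using assms unfolding cocb_def by blast+
      show "poly (L r s x y) z = poly (K r s x y + L s r y x) z"
        using 1 by (cases r; cases s) (simp_all add: L_def K_def poly_pcompose ev_def algebra_simps)
    qed simp
    have "(\<exists>i. r = (if i then A else B))" "(\<exists>j. s = (if j then A else B))" using rs by (metis insert_iff singletonD)+
    then obtain i j where ij: "r = (if i then A else B)" "s = (if j then A else B)" by blast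
    show ?thesis
    proof (rule prod_eqI)
      show "fst (action_at ?T x r (action_at ?T y s w)) =
        fst (action_at ?T (x + y) (bracket_at R x r s) w + action_at ?T y s (action_at ?T x r w))"
        unfolding ij w fst_add L K LK[of i j] V.scale_left_distrib ..
      show "snd (action_at ?T x r (action_at ?T y s w)) =
        snd (action_at ?T (x + y) (bracket_at R x r s) w + action_at ?T y s (action_at ?T x r w))"
        using conformal_moduleD(5)[OF conformal_modules(2), of x r y s v'] by (simp add: w action_at_zc)
    qed
  qed
qed

lemma extension_zc:
  assumes "cocb f g" shows "extension R V (twisted_sum V V' (zc f g)) V' incl snd"
proof -
  interpret V: module "smul V" by (rule modules(2))
  interpret V': module "smul V'" by (rule modules(3))
  have "crd 0 = 0" using crd_smul[of 0] by simp
  then have g0: "gam f g x r 0 = 0" for x r by (simp add: gam_def)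
  have a0: "action_at V' x r 0 = 0" for x r
    using action_at_rules(2)[OF conformal_moduleD(2)[OF conformal_modules(2)], of x r 0 0] by simp
  have "conf_hom V (twisted_sum V V' (zc f g)) incl"
    by (rule conf_homI[OF modules(2) module_zc]) (simp_all add: smul_zc action_at_zc g0 a0)
  moreover have "conf_hom (twisted_sum V V' (zc f g)) V' snd"
    by (rule conf_homI[OF module_zc modules(3)]) (auto simp: smul_zc action_at_zc)
  ultimately show ?thesis
    unfolding extension_def using conformal_module_zc[OF assms] conformal_modules
    by (auto simp: inj_def)
qed

lemma lifted_zc: "lifted (twisted_sum V V' (zc f g)) incl snd (0, v') f g"
proof -
  interpret V: module "smul V" by (rule modules(2))
  have "action_at V x r 0 = 0" for x r
    using action_at_rules(2)[OF conformal_moduleD(2)[OF conformal_modules(1)], of x r 0 0] by simp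
  then show ?thesis
    by (simp add: lifted_def action_at_zc smul_zc act_V' gam_def crd_hom crdAB_hom pcompose_1)
qed

lemma standard_ext_zc:
  assumes "cocb f g"
  shows "standard_ext R A B V v \<alpha> \<beta> V' v' \<alpha>' \<beta>' f g (twisted_sum V V' (zc f g))"
proof -
  let ?T = "twisted_sum V V' (zc f g)"
  interpret V: module "smul V" by (rule modules(2))
  interpret V': module "smul V'" by (rule modules(3))
  note l = lifted_zc[of f g, unfolded lifted_def]
  have "crd 0 = 0" using crd_smul[of 0] by simp
  then have g0: "gam f g x r 0 = 0" for x r by (simp add: gam_def)
  have a0: "action_at V' x r 0 = 0" for x r
    using action_at_rules(2)[OF conformal_moduleD(2)[OF conformal_modules(2)], of x r 0 0] by simp
  have e: "poly (vx + cst \<alpha> * vl + cst \<beta>) [:x:] = [:\<beta> + \<alpha> * x, 1:]"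
    "poly (vx + cst \<alpha>' * vl + cst \<beta>') [:x:] = [:\<beta>' + \<alpha>' * x, 1:]" for x by simp_all
  note T = lam_subst_bact[OF module_zc] lam_subst_add[OF module_zc] lam_subst_0[OF module_zc]
  have "smul ?T = smul (direct_sum V V')" by (simp add: twisted_sum_def zc_def)
  moreover have "action ?T A (v, 0) = bact (smul ?T) (vx + cst \<alpha> * vl + cst \<beta>) (v, 0)"
    by (rule action_zc_eqI)
      (simp only: T e action_at_zc smul_zc g0 a0 act_V V.scale_zero_left V'.scale_zero_right add_0_right)
  moreover have "action ?T B (v, 0) = 0"
    by (rule action_zc_eqI)
      (simp only: T e action_at_zc g0 a0 act_V V.scale_zero_left add_0_right zero_prod_def)
  moreover have "action ?T A (0, v') =
      bact (smul ?T) (vx + cst \<alpha>' * vl + cst \<beta>') (0, v') + bact (smul ?T) f (v, 0)"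
    by (rule action_zc_eqI)
      (use l in \<open>simp only: T e smul_zc V'.scale_zero_right\<close>)
  moreover have "action ?T B (0, v') = bact (smul ?T) g (v, 0)"
    by (rule action_zc_eqI)
      (use l in \<open>simp only: T e smul_zc V'.scale_zero_right\<close>)
  ultimately show ?thesis
    unfolding standard_ext_def using extension_zc[OF assms] by blast
qed

end

section \<open>Removing \<beta> by a shift, and computing Ext\<close>

lemma coc_add_scale:
  assumes "coc a c d \<alpha> \<alpha>' f g" "coc a c d \<alpha> \<alpha>' f' g'"
  shows "coc a c d \<alpha> \<alpha>' (f + cst k * f') (g + cst k * g')"
  unfolding coc_def dgen_def
proof (intro conjI allI)
  fix z x y
  have e: "dvir \<alpha> \<alpha>' f z x y = ev (Q_poly a c d) (- x - y) x * ev g z (x + y)"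
    "dvir \<alpha> \<alpha>' f' z x y = ev (Q_poly a c d) (- x - y) x * ev g' z (x + y)"
    "(z + \<alpha> * x) * ev g (z + x) y - (z + y + \<alpha>' * x) * ev g z y = ((a - 1) * x - y) * ev g z (x + y)"
    "(z + \<alpha> * x) * ev g' (z + x) y - (z + y + \<alpha>' * x) * ev g' z y = ((a - 1) * x - y) * ev g' z (x + y)"
    using assms unfolding coc_def dgen_def by blast+
  show "dvir \<alpha> \<alpha>' (f + cst k * f') z x y =
      ev (Q_poly a c d) (- x - y) x * ev (g + cst k * g') z (x + y)"
    unfolding dvir_add dvir_scale ev_simps e(1,2) by (simp only: algebra_simps)
  show "(z + \<alpha> * x) * ev (g + cst k * g') (z + x) y - (z + y + \<alpha>' * x) * ev (g + cst k * g') z y =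
      ((a - 1) * x - y) * ev (g + cst k * g') z (x + y)"
    using arg_cong2[OF e(3) arg_cong[OF e(4), of "\<lambda>u. k * u"], of "(+)"]
    unfolding ev_simps by (simp only: algebra_simps)
qed

lemma coc_sum:
  fixes n :: nat
  assumes "\<And>i. i < n \<Longrightarrow> coc a c d \<alpha> \<alpha>' (F i) (G i)"
  shows "coc a c d \<alpha> \<alpha>' (\<Sum>i<n. cst (k i) * F i) (\<Sum>i<n. cst (k i) * G i)"
  using assms
proof (induction n)
  case 0
  show ?case by (simp add: coc_dvirI dvir_def ev_simps)
next
  case (Suc n)
  then show ?case using coc_add_scale[of a c d \<alpha> \<alpha>' _ _ "F n" "G n" "k n"] by simp
qed

lemma ev_shift: "ev (shift \<beta> f) z x = ev f (z + \<beta>) x"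
  by (induction f) (simp_all add: shift_def map_poly_pCons ev_pCons ev_simps poly_pcompose add.commute)

lemma shift_shift: "shift \<beta> (shift (- \<beta>) f) = f"
  by (rule ev_eqI) (simp add: ev_shift)

lemma shift_sum: "shift \<beta> (\<Sum>i<n::nat. cst (k i) * F i) = (\<Sum>i<n. cst (k i) * shift \<beta> (F i))"
proof (induction n)
  case 0
  show ?case by (simp add: shift_def)
next
  case (Suc n)
  have "shift \<beta> (f + cst (k n) * F n) = shift \<beta> f + cst (k n) * shift \<beta> (F n)" for f
    by (rule ev_eqI) (simp only: ev_shift ev_simps)
  then show ?case using Suc by simp
qed

lemma shift_eq_0_iff: "shift \<beta> f = 0 \<longleftrightarrow> f = 0"
proof
  assume "shift \<beta> f = 0"
  moreover have "ev f z x = ev (shift \<beta> f) (z - \<beta>) x" for z x by (simp add: ev_shift)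
  ultimately show "f = 0" by (intro ev_eqI) (simp add: ev_simps)
qed (simp add: shift_def)

text \<open>The same map \<open>h\<close> works: \<gamma> depends on an element only through its
  component in W, and \<open>h\<close> preserves that component and fixes the submodule, so \<gamma>
  may be subtracted on both sides.\<close>

lemma twisted_sum_diff:
  fixes V :: "('r, 'v::ab_group_add) conf_mod" and W :: "('r, 'w::ab_group_add) conf_mod"
  assumes h: "conf_hom (twisted_sum V W y) (twisted_sum V W (\<lambda>q w. 0, \<gamma>)) h"
    and incl: "\<And>u. h (incl u) = incl u" and snd: "\<And>x. snd (h x) = snd x"
  shows "trivial_cocycle V W (y - (\<lambda>q w. 0, \<gamma>))"
proof -
  obtain \<delta> \<gamma>' where y: "y = (\<delta>, \<gamma>')" by fastforce
  note hom = conf_homD[OF h]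
  have "module_hom (smul (twisted_sum V W y)) (smul (twisted_sum V W (\<lambda>q w. 0, \<gamma>))) h"
    using h by (simp add: conf_hom_def)
  then have 1: "module_hom (smul (twisted_sum V W (y - (\<lambda>q w. 0, \<gamma>)))) (smul (direct_sum V W)) h"
    by (simp add: twisted_sum_def y)
  have "action (direct_sum V W) r (h x) = map_poly h (action (twisted_sum V W (y - (\<lambda>q w. 0, \<gamma>))) r x)" for r x
  proof -
    obtain u w where x: "x = (u, w)" by fastforce
    obtain u' where hx: "h x = (u', w)" using snd[of x] by (metis x prod.collapse snd_conv)
    have sub: "map_poly (incl :: 'v \<Rightarrow> 'v \<times> 'w) (P - Q) = map_poly incl P - map_poly incl Q" for P Q :: "'v poly"
      by (rule poly_eqI) (simp add: coeff_map_poly zero_prod_def)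
    have sub': "map_poly h (P - Q) = map_poly h P - map_poly h Q" for P Q
      by (rule poly_eqI) (simp add: coeff_map_poly hom)
    have "action (direct_sum V W) r (h x) =
        action (twisted_sum V W (\<lambda>q w. 0, \<gamma>)) r (h x) - map_poly incl (\<gamma> r w)"
      using sub[of "action V r u' + \<gamma> r w" "\<gamma> r w"] by (simp add: twisted_sum_def hx)
    also have "\<dots> = map_poly h (action (twisted_sum V W y) r x) - map_poly h (map_poly incl (\<gamma> r w))"
    proof -
      have "map_poly h (map_poly incl (\<gamma> r w)) = map_poly incl (\<gamma> r w)"
        by (rule poly_eqI) (simp add: coeff_map_poly hom incl zero_prod_def[symmetric])
      moreover have "action (twisted_sum V W (\<lambda>q w. 0, \<gamma>)) r (h x) = map_poly h (action (twisted_sum V W y) r x)"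
        using h unfolding conf_hom_def by blast
      ultimately show ?thesis by (simp only:)
    qed
    also have "\<dots> = map_poly h (action (twisted_sum V W y) r x - map_poly incl (\<gamma> r w))"
      by (simp only: sub')
    also have "action (twisted_sum V W y) r x - map_poly incl (\<gamma> r w) =
        action (twisted_sum V W (y - (\<lambda>q w. 0, \<gamma>))) r x"
      using sub[of "action V r u + \<gamma>' r w" "\<gamma> r w"] by (simp add: twisted_sum_def x y add_diff_eq)
    finally show ?thesis .
  qed
  with 1 show ?thesis
    unfolding trivial_cocycle_def trivial_ext_def ext_equiv_def conf_hom_def using incl snd by blast
qed

context rank_two_pair
begin

lemma cocb_trivial:
  assumes "cocb f g" "\<beta> \<noteq> \<beta>'"
  shows "g = 0" and "\<exists>\<phi>. is_cobb \<phi> f"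
proof -
  have f: "(z + x + \<beta>' + \<alpha>' * y) * ev f z x + (z + \<beta> + \<alpha> * x) * ev f (z + x) y
      - (z + y + \<beta>' + \<alpha>' * x) * ev f z y - (z + \<beta> + \<alpha> * y) * ev f (z + y) x - (x - y) * ev f z (x + y)
      = ev (Q_poly a c d) (- x - y) x * ev g z (x + y)"
    and g: "(z + \<beta> + \<alpha> * x) * ev g (z + x) y - (z + y + \<beta>' + \<alpha>' * x) * ev g z y
      = ((a - 1) * x - y) * ev g z (x + y)" for z x y
    using assms(1) unfolding cocb_def by blast+
  have "(\<beta> - \<beta>') * ev g z y = 0" for z y using g[of z 0 y] by (simp add: algebra_simps)
  then show 0: "g = 0" using assms(2) by (intro ev_eqI) (simp add: ev_simps)
  \<comment> \<open>At y = 0 the equation expresses (\<beta> - \<beta>') f through the restriction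
    of \<open>f\<close> to \<lambda> = 0; dividing gives this \<phi>.\<close>
  let ?\<phi> = "smult (1 / (\<beta> - \<beta>')) (poly f 0)"
  have "(\<beta> - \<beta>') * ev f z x = (z + \<beta> + \<alpha> * x) * ev f (z + x) 0 - (z + \<beta>' + \<alpha>' * x) * ev f z 0" for z x
    using f[of z x 0] by (simp add: 0 ev_simps algebra_simps)
  then have "ev f z x = ((z + \<beta> + \<alpha> * x) * ev f (z + x) 0 - (z + \<beta>' + \<alpha>' * x) * ev f z 0) / (\<beta> - \<beta>')" for z x
    using assms(2) by (simp add: nonzero_eq_divide_eq mult.commute)
  then have "is_cobb ?\<phi> f"
    unfolding is_cobb_def by (simp add: ev_def diff_divide_distrib)
  then show "\<exists>\<phi>. is_cobb \<phi> f" ..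
qed

lemma cocb_shift:
  assumes "\<beta>' = \<beta>" shows "cocb (shift \<beta> F) (shift \<beta> G) \<longleftrightarrow> coc a c d \<alpha> \<alpha>' F G"
proof
  assume "coc a c d \<alpha> \<alpha>' F G"
  then have *: "dvir \<alpha> \<alpha>' F (z + \<beta>) x y = ev (Q_poly a c d) (- x - y) x * ev G (z + \<beta>) (x + y)"
    "((z + \<beta>) + \<alpha> * x) * ev G ((z + \<beta>) + x) y - ((z + \<beta>) + y + \<alpha>' * x) * ev G (z + \<beta>) y
      = ((a - 1) * x - y) * ev G (z + \<beta>) (x + y)" for z x y
    unfolding coc_def dgen_def by blast+
  show "cocb (shift \<beta> F) (shift \<beta> G)"
    unfolding cocb_def
  proof (intro conjI allI)
    fix z x y :: complex
    show "(z + x + \<beta>' + \<alpha>' * y) * ev (shift \<beta> F) z x + (z + \<beta> + \<alpha> * x) * ev (shift \<beta> F) (z + x) y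
        - (z + y + \<beta>' + \<alpha>' * x) * ev (shift \<beta> F) z y - (z + \<beta> + \<alpha> * y) * ev (shift \<beta> F) (z + y) x
        - (x - y) * ev (shift \<beta> F) z (x + y)
        = ev (Q_poly a c d) (- x - y) x * ev (shift \<beta> G) z (x + y)"
      using *(1)[of z x y] unfolding dvir_def ev_shift assms by (simp add: algebra_simps)
    show "(z + \<beta> + \<alpha> * x) * ev (shift \<beta> G) (z + x) y - (z + y + \<beta>' + \<alpha>' * x) * ev (shift \<beta> G) z y
        = ((a - 1) * x - y) * ev (shift \<beta> G) z (x + y)"
      using *(2)[of z x y] unfolding ev_shift assms by (simp add: algebra_simps)
  qed
next
  assume *: "cocb (shift \<beta> F) (shift \<beta> G)"
  show "coc a c d \<alpha> \<alpha>' F G"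
    unfolding coc_def dgen_def dvir_def
  proof (intro conjI allI)
    fix z x y :: complex
    obtain t where z: "z = t + \<beta>" by (metis diff_add_cancel)
    have "(t + x + \<beta>' + \<alpha>' * y) * ev (shift \<beta> F) t x + (t + \<beta> + \<alpha> * x) * ev (shift \<beta> F) (t + x) y
      - (t + y + \<beta>' + \<alpha>' * x) * ev (shift \<beta> F) t y - (t + \<beta> + \<alpha> * y) * ev (shift \<beta> F) (t + y) x
      - (x - y) * ev (shift \<beta> F) t (x + y)
      = ev (Q_poly a c d) (- x - y) x * ev (shift \<beta> G) t (x + y)"
      "(t + \<beta> + \<alpha> * x) * ev (shift \<beta> G) (t + x) y - (t + y + \<beta>' + \<alpha>' * x) * ev (shift \<beta> G) t y
      = ((a - 1) * x - y) * ev (shift \<beta> G) t (x + y)"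
      using * unfolding cocb_def by blast+
    then show "(z + x + \<alpha>' * y) * ev F z x + (z + \<alpha> * x) * ev F (z + x) y
        - (z + y + \<alpha>' * x) * ev F z y - (z + \<alpha> * y) * ev F (z + y) x - (x - y) * ev F z (x + y)
        = ev (Q_poly a c d) (- x - y) x * ev G z (x + y)"
      "(z + \<alpha> * x) * ev G (z + x) y - (z + y + \<alpha>' * x) * ev G z y = ((a - 1) * x - y) * ev G z (x + y)"
      unfolding ev_shift assms z by (simp_all add: algebra_simps)
  qed
qed

lemma is_cobb_shift:
  assumes "\<beta>' = \<beta>" shows "is_cobb \<phi> (shift \<beta> F) \<longleftrightarrow> F = cob \<alpha> \<alpha>' (pcompose \<phi> [:- \<beta>, 1:])"
proof
  assume *: "is_cobb \<phi> (shift \<beta> F)"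
  show "F = cob \<alpha> \<alpha>' (pcompose \<phi> [:- \<beta>, 1:])"
  proof (rule ev_eqI)
    fix z x
    have "ev (shift \<beta> F) (z - \<beta>) x = ((z - \<beta>) + \<beta> + \<alpha> * x) * poly \<phi> ((z - \<beta>) + x)
        - ((z - \<beta>) + \<beta>' + \<alpha>' * x) * poly \<phi> (z - \<beta>)"
      using * unfolding is_cobb_def by blast
    then show "ev F z x = ev (cob \<alpha> \<alpha>' (pcompose \<phi> [:- \<beta>, 1:])) z x"
      by (simp add: ev_shift ev_cob assms poly_pcompose algebra_simps)
  qed
next
  assume F: "F = cob \<alpha> \<alpha>' (pcompose \<phi> [:- \<beta>, 1:])"
  show "is_cobb \<phi> (shift \<beta> F)"
    unfolding is_cobb_def F by (simp add: ev_shift ev_cob assms poly_pcompose algebra_simps)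
qed

text \<open>The direct sum has a lift with pair (0, 0). An equivalence carries the given lift to a
  lift with the same pair, which can differ from (0, 0) by a coboundary in \<open>f\<close> only;
  conversely, a coboundary is undone by changing the lift.\<close>

lemma trivial_ext_iff:
  assumes E: "extension R V E V' \<iota> \<pi>" and l: "lifted E \<iota> \<pi> e f g"
  shows "trivial_ext V E V' \<iota> \<pi> \<longleftrightarrow> g = 0 \<and> (\<exists>\<phi>. is_cobb \<phi> f)"
proof -
  have e: "\<pi> e = v'" using l by (simp add: lifted_def)
  have "cocb 0 0" by (simp add: cocb_def ev_simps)
  note D = extension_zc[OF this, unfolded zc_0] lifted_zc[of 0 0, unfolded zc_0]
  show ?thesis
  proof
    assume "trivial_ext V E V' \<iota> \<pi>"
    then obtain h where h: "conf_hom E (direct_sum V V') h" "\<And>u. h (\<iota> u) = incl u" "\<And>x. snd (h x) = \<pi> x"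
      unfolding trivial_ext_def ext_equiv_def by blast
    have "lifted (direct_sum V V') incl snd (h e) f g"
      using lifted_hom[OF E e h l] .
    from lifted_unique[OF D(1) _ D(2) this] show "g = 0 \<and> (\<exists>\<phi>. is_cobb \<phi> f)" by simp
  next
    assume *: "g = 0 \<and> (\<exists>\<phi>. is_cobb \<phi> f)"
    then obtain \<phi> where "is_cobb \<phi> f" by blast
    then have "is_cobb (- \<phi>) (0 - f)" unfolding is_cobb_def ev_simps by (simp add: algebra_simps)
    from lifted_change[OF E e l this] show "trivial_ext V E V' \<iota> \<pi>"
      unfolding trivial_ext_def using ext_equivI[OF E D(1) _ D(2)] * by blast
  qed
qed

lemma zc_trivial_iff:
  assumes "cocb f g"
  shows "trivial_cocycle V V' (zc f g) \<longleftrightarrow> g = 0 \<and> (\<exists>\<phi>. is_cobb \<phi> f)"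
  unfolding trivial_cocycle_def by (rule trivial_ext_iff[OF extension_zc[OF assms] lifted_zc])

lemma ext_cocycle_zc: "cocb f g \<Longrightarrow> ext_cocycle R V V' (zc f g)"
  unfolding ext_cocycle_def using extension_zc by (simp add: zc_def)

text \<open>An abstract cocycle \<open>y\<close> may also twist the derivation. Its class is still
  that of the normal form \<open>zc f g\<close>, since equal pairs give equivalent
  extensions.\<close>

lemma trivial_cocycle_diff_zc:
  assumes y: "ext_cocycle R V V' y" and l: "lifted (twisted_sum V V' y) incl snd e f g"
    and c: "cocb f g"
  shows "trivial_cocycle V V' (y - zc f g)"
proof -
  have E: "extension R V (twisted_sum V V' y) V' incl snd" using y by (simp add: ext_cocycle_def)
  have z: "zc f g = (\<lambda>q w. 0, snd (zc f g))" by (simp add: zc_def)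
  obtain h where "conf_hom (twisted_sum V V' y) (twisted_sum V V' (zc f g)) h"
    "\<And>u. h (incl u) = incl u" "\<And>x. snd (h x) = snd x"
    using ext_equivI[OF E extension_zc[OF c] l lifted_zc] unfolding ext_equiv_def by blast
  then show ?thesis using twisted_sum_diff[of V V' y "snd (zc f g)" h] z by metis
qed

lemma standard_form:
  assumes E: "extension R V E V' \<iota> \<pi>" and l: "lifted E \<iota> \<pi> e f g" and c: "cocb f g"
  shows "\<exists>M. standard_ext R A B V v \<alpha> \<beta> V' v' \<alpha>' \<beta>' f g M \<and> ext_equiv E \<iota> \<pi> M incl snd"
  using standard_ext_zc[OF c] ext_equivI[OF E extension_zc[OF c] l lifted_zc] by blast

lemma lift_exists:
  assumes E: "extension R V E V' \<iota> \<pi>"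
  obtains e f g where "\<pi> e = v'" "lifted E \<iota> \<pi> e f g" "cocb f g"
proof -
  obtain e where e: "\<pi> e = v'" using E unfolding extension_def by (metis surjD)
  then show ?thesis using that lifted_exists[OF E e] lifted_cocb[OF E e] by blast
qed

lemma lift_normal:
  assumes E: "extension R V E V' \<iota> \<pi>" and "\<beta>' = \<beta>" and b: "ext_basis a c d \<alpha> \<alpha>' n b"
  obtains e k where "lifted E \<iota> \<pi> e (shift \<beta> (\<Sum>i<n. cst (k i) * fst (b i))) (shift \<beta> (\<Sum>i<n. cst (k i) * snd (b i)))"
proof -
  obtain e f g where e: "\<pi> e = v'" and l: "lifted E \<iota> \<pi> e f g" and c: "cocb f g"
    using lift_exists[OF E] by blast
  have "coc a c d \<alpha> \<alpha>' (shift (- \<beta>) f) (shift (- \<beta>) g)"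
    using c cocb_shift[OF assms(2), of "shift (- \<beta>) f" "shift (- \<beta>) g"] by (simp add: shift_shift)
  from b[unfolded ext_basis_def, THEN conjunct2, THEN conjunct2, THEN conjunct1, rule_format, OF this]
  obtain k \<phi> where k: "shift (- \<beta>) f = (\<Sum>i<n. cst (k i) * fst (b i)) + cob \<alpha> \<alpha>' \<phi>"
    "shift (- \<beta>) g = (\<Sum>i<n. cst (k i) * snd (b i))"
    by blast
  let ?F = "\<Sum>i<n. cst (k i) * fst (b i)"
  have "shift \<beta> ?F - f = shift \<beta> (- cob \<alpha> \<alpha>' \<phi>)"
  proof -
    have "- cob \<alpha> \<alpha>' \<phi> = ?F - shift (- \<beta>) f" unfolding k(1) by simp
    also have "shift \<beta> \<dots> = shift \<beta> ?F - f"
      by (rule ev_eqI) (simp add: ev_shift ev_simps)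
    finally show ?thesis by simp
  qed
  moreover have "- cob \<alpha> \<alpha>' \<phi> = cob \<alpha> \<alpha>' (pcompose (- pcompose \<phi> [:\<beta>, 1:]) [:- \<beta>, 1:])"
    by (rule ev_eqI) (simp add: ev_simps ev_cob poly_pcompose algebra_simps)
  ultimately have "is_cobb (- pcompose \<phi> [:\<beta>, 1:]) (shift \<beta> ?F - f)"
    using is_cobb_shift[OF assms(2)] by simp
  note l' = lifted_change[OF E e l this]
  have g: "g = shift \<beta> (\<Sum>i<n. cst (k i) * snd (b i))" unfolding k(2)[symmetric] shift_shift ..
  show ?thesis by (rule that[OF l'[unfolded g]])
qed

text \<open>As \<open>zc\<close> is linear in the pair and detects coboundaries, independence and
  spanning pass from pairs of polynomials to classes of cocycles.\<close>

lemma Ext_dim_ext_basis: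
  assumes "\<beta>' = \<beta>" and b: "ext_basis a c d \<alpha> \<alpha>' n b"
  shows "Ext_dim R V' V n"
proof -
  define z where "z i = zc (shift \<beta> (fst (b i))) (shift \<beta> (snd (b i)))" for i
  define F G where "F k = (\<Sum>i<n. cst (k i) * fst (b i))" and "G k = (\<Sum>i<n. cst (k i) * snd (b i))" for k
  have zsum: "(\<Sum>i<n. cocycle_scale V (k i) (z i)) = zc (shift \<beta> (F k)) (shift \<beta> (G k))" for k
    unfolding z_def zc_sum shift_sum F_def G_def ..
  have cocb: "cocb (shift \<beta> (F k)) (shift \<beta> (G k))" for k
    unfolding cocb_shift[OF assms(1)] F_def G_def
    by (rule coc_sum) (use b in \<open>simp add: ext_basis_def\<close>)
  have "\<forall>i<n. ext_cocycle R V V' (z i)"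
    using b by (simp add: z_def ext_cocycle_zc cocb_shift[OF assms(1)] ext_basis_def)
  moreover have "\<forall>i<n. k i = 0" if triv: "trivial_cocycle V V' (\<Sum>i<n. cocycle_scale V (k i) (z i))" for k
  proof -
    obtain \<phi> where "F k = cob \<alpha> \<alpha>' \<phi>" "G k = 0"
      using triv unfolding zsum zc_trivial_iff[OF cocb] is_cobb_shift[OF assms(1)] shift_eq_0_iff by blast
    then show ?thesis using b unfolding ext_basis_def F_def G_def by blast
  qed
  moreover have "\<exists>k. trivial_cocycle V V' (y - (\<Sum>i<n. cocycle_scale V (k i) (z i)))"
    if y: "ext_cocycle R V V' y" for y
  proof -
    have "extension R V (twisted_sum V V' y) V' incl snd" using y by (simp add: ext_cocycle_def)
    from lift_normal[OF this assms] obtain e k where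
      "lifted (twisted_sum V V' y) incl snd e (shift \<beta> (F k)) (shift \<beta> (G k))"
      unfolding F_def G_def by blast
    from trivial_cocycle_diff_zc[OF y this cocb] show ?thesis unfolding zsum by blast
  qed
  ultimately show ?thesis unfolding Ext_dim_def by blast
qed

end

theorem theorem6p6:
  fixes R :: "('r::ab_group_add) lie_conf" and A B :: 'r
    and a c d \<alpha> \<beta> \<alpha>' \<beta>' :: complex
    and V :: "('r, 'v::ab_group_add) conf_mod" and v :: 'v
    and V' :: "('r, 'w::ab_group_add) conf_mod" and v' :: 'w
  assumes "rank_two_type_II R A B a c d" and "Q_poly a c d \<noteq> 0"
    and "rank_one_module R A B V v \<alpha> \<beta>" and "\<alpha> \<noteq> 0"
    and "rank_one_module R A B V' v' \<alpha>' \<beta>'" and "\<alpha>' \<noteq> 0"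
  shows
    "(\<forall>(E :: ('r, 'e::ab_group_add) conf_mod) \<iota> \<pi>. extension R V E V' \<iota> \<pi> \<longrightarrow>
        (\<exists>f g M. standard_ext R A B V v \<alpha> \<beta> V' v' \<alpha>' \<beta>' f g M \<and>
                 ext_equiv E \<iota> \<pi> M incl snd)) \<and>
     (\<forall>(E :: ('r, 'e) conf_mod) \<iota> \<pi>. extension R V E V' \<iota> \<pi> \<and> \<not> trivial_ext V E V' \<iota> \<pi> \<longrightarrow>
        \<beta> = \<beta>' \<and>
        (\<exists>n F G M. ext_list a c d \<alpha> \<alpha>' n F G \<and>
                   standard_ext R A B V v \<alpha> \<beta> V' v' \<alpha>' \<beta>' (shift \<beta> F) (shift \<beta> G) M \<and>
                   ext_equiv E \<iota> \<pi> M incl snd)) \<and>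
     (\<forall>n F G. \<beta> = \<beta>' \<and> ext_list a c d \<alpha> \<alpha>' n F G \<longrightarrow>
        (\<exists>M. standard_ext R A B V v \<alpha> \<beta> V' v' \<alpha>' \<beta>' (shift \<beta> F) (shift \<beta> G) M \<and>
             \<not> trivial_ext V M V' incl snd) \<and>
        Ext_dim R V' V n)"
proof -
  interpret rank_two_pair R A B a c d \<alpha> \<beta> \<alpha>' \<beta>' V v V' v'
    using assms by unfold_locales
  have "a \<in> {1, 0, - 1, - 4, - 6}" using assms(1) by (simp add: rank_two_type_II_def)
  then obtain n b where b: "ext_basis a c d \<alpha> \<alpha>' n b"
    using ext_basis_exists assms(2,4) by blast
  define F G where "F k = (\<Sum>i<n. cst (k i) * fst (b i))" and "G k = (\<Sum>i<n. cst (k i) * snd (b i))" for k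
  have coc: "coc a c d \<alpha> \<alpha>' (F k) (G k)" for k
    unfolding F_def G_def by (rule coc_sum) (use b in \<open>simp add: ext_basis_def\<close>)
  have indep: "\<forall>i<n. k i = 0" if "F k = cob \<alpha> \<alpha>' \<phi>" "G k = 0" for k \<phi>
    using b that unfolding ext_basis_def F_def G_def by blast
  \<comment> \<open>One basis settles all claims: it spans, which brings each extension into normal
    form; it is independent, which makes the nonzero combinations nontrivial; and it has n elements,
    the dimension. The present fact identifies those combinations with the list.\<close>
  have list: "ext_list a c d \<alpha> \<alpha>' m F' G' \<longleftrightarrow> m = n \<and> (\<exists>k. (\<exists>i<n. k i \<noteq> 0) \<and> F' = F k \<and> G' = G k)" for m F' G'
    using b unfolding ext_basis_def F_def G_def by blast
  show ?thesis
  proof (intro conjI allI impI)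
    fix E :: "('r, 'e) conf_mod" and \<iota> \<pi>
    assume E: "extension R V E V' \<iota> \<pi>"
    show "\<exists>f g M. standard_ext R A B V v \<alpha> \<beta> V' v' \<alpha>' \<beta>' f g M \<and> ext_equiv E \<iota> \<pi> M incl snd"
      using lift_exists[OF E] standard_form[OF E] by metis
  next
    fix E :: "('r, 'e) conf_mod" and \<iota> \<pi>
    assume "extension R V E V' \<iota> \<pi> \<and> \<not> trivial_ext V E V' \<iota> \<pi>"
    then have E: "extension R V E V' \<iota> \<pi>" and nt: "\<not> trivial_ext V E V' \<iota> \<pi>" by auto
    show \<beta>: "\<beta> = \<beta>'"
      using lift_exists[OF E] trivial_ext_iff[OF E] cocb_trivial nt by metis
    obtain e k where l: "lifted E \<iota> \<pi> e (shift \<beta> (F k)) (shift \<beta> (G k))"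
      using lift_normal[OF E \<beta>[symmetric] b] unfolding F_def G_def by blast
    have "\<exists>i<n. k i \<noteq> 0"
    proof (rule ccontr)
      assume "\<not> (\<exists>i<n. k i \<noteq> 0)"
      then have "F k = 0" "G k = 0" by (simp_all add: F_def G_def)
      then have "shift \<beta> (G k) = 0 \<and> is_cobb 0 (shift \<beta> (F k))"
        unfolding is_cobb_shift[OF \<beta>[symmetric]] shift_eq_0_iff by (simp add: cob_0)
      then show False using nt trivial_ext_iff[OF E l] by blast
    qed
    moreover have "cocb (shift \<beta> (F k)) (shift \<beta> (G k))"
      using coc cocb_shift[OF \<beta>[symmetric]] by blast
    ultimately show "\<exists>n F G M. ext_list a c d \<alpha> \<alpha>' n F G \<and>
        standard_ext R A B V v \<alpha> \<beta> V' v' \<alpha>' \<beta>' (shift \<beta> F) (shift \<beta> G) M \<and> ext_equiv E \<iota> \<pi> M incl snd"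
      using standard_form[OF E l] list by blast
  next
    fix m F' G'
    assume *: "\<beta> = \<beta>' \<and> ext_list a c d \<alpha> \<alpha>' m F' G'"
    then have \<beta>: "\<beta>' = \<beta>" by simp
    obtain k where k: "m = n" "\<exists>i<n. k i \<noteq> 0" "F' = F k" "G' = G k" using * list by blast
    have c: "cocb (shift \<beta> F') (shift \<beta> G')" using coc cocb_shift[OF \<beta>] k(3,4) by blast
    have "\<not> trivial_ext V (twisted_sum V V' (zc (shift \<beta> F') (shift \<beta> G'))) V' incl snd"
      unfolding trivial_ext_iff[OF extension_zc[OF c] lifted_zc] shift_eq_0_iff is_cobb_shift[OF \<beta>]
      unfolding k(3,4) using indep[of k] k(2) by blast
    then show "\<exists>M. standard_ext R A B V v \<alpha> \<beta> V' v' \<alpha>' \<beta>' (shift \<beta> F') (shift \<beta> G') M \<and>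
        \<not> trivial_ext V M V' incl snd"
      using standard_ext_zc[OF c] by blast
    show "Ext_dim R V' V m" unfolding k(1) by (rule Ext_dim_ext_basis[OF \<beta> b])
  qed
qed

end
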